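(* Let $Q$ be a pairwise $\mathcal C$-non-overlapping finite set of value-free constrained linear patterns and $f\in\mathcal D$ an $n$-ary defined symbol. Then $\mathcal G_{\mathcal C}(\mathrm{Co}_f(Q))=\mathcal G_{\mathcal C}(f(x_1,\dots,x_n)\,[\mathsf{true}])\setminus\mathcal G_{\mathcal C}(\{t\,[\psi]\in Q\mid\mathrm{root}(t)=f\})$, and $\mathrm{Co}_f(Q)$ is a complement of $Q$ w.r.t. $f$, where $x_1,\dots,x_n$ are pairwise distinct variables.
   Context: Signature and theories: $\mathcal S=\mathcal S_{\mathrm{theory}}\uplus\mathcal S_{\mathrm{term}}$ sorts, $\Sigma=\Sigma_{\mathrm{theory}}\cup\Sigma_{\mathrm{terms}}$ an $\mathcal S$-sorted signature, $\mathcal V$ countably infinite sorted variables. Symbols of $\Sigma_{\mathrm{theory}}$ have only theory sorts; each theory sort $\iota$ has a nonempty universe $\mathcal I(\iota)$, symbols of $\Sigma_{\mathrm{theory}}$ have interpretations $\mathcal J(f)$, and $\mathrm{Val}_\iota\subseteq\Sigma_{\mathrm{theory}}$ is a set of value constants of sort $\iota$ mapped bijectively onto $\mathcal I(\iota)$; $\mathrm{Val}=\bigcup_\iota\mathrm{Val}_\iota$, $\Sigma_{\mathrm{terms}}\cap\Sigma_{\mathrm{theory}}\subseteq\mathrm{Val}$. There is a sort $\mathsf{bool}$ with values $\mathsf{true},\mathsf{false}$ and the usual connectives and equalities, interpreted as usual. A constraint is a term of $T(\Sigma_{\mathrm{theory}},\mathcal V)$ of sort $\mathsf{bool}$; $\gamma$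 respects $\varphi$ if $x\gamma\in\mathrm{Val}$ for $x\in\mathrm{Var}(\varphi)$ and $\varphi\gamma$ evaluates to true; $\varphi$ is satisfiable if some substitution respects it. Constructors: $\Sigma=\mathcal D\uplus\mathcal C$, $\mathrm{Val}\subseteq\mathcal C$. Standing assumptions: $\Sigma_{\mathrm{terms}}$ finite; no $c\in\mathcal C\setminus\mathrm{Val}$ has result sort in $\mathcal S_{\mathrm{theory}}$. $\mathcal C$-substitution: sort-preserving with range in $T(\mathcal C,\mathcal V)$. Pattern: $f(t_1,\dots,t_n)$, $f\in\mathcal D$, $t_i\in T(\mathcal C,\mathcal V)$. Constrained terms $t\,[\psi]$ (term, constraint): linear if $t$ linear; value-free if $t$ has no symbol of $\mathrm{Val}$; constrained pattern if $t$ a pattern. $\mathcal G_{\mathcal C}(t\,[\psi])=\{t\sigma\mid\sigma$ a $\mathcal C$-substitution, $x\sigma$ ground for $x\in\mathrm{Var}(t)$, $\sigma$ respects $\psi\}$; $\mathcal G_{\mathcal C}(P)=\bigcup_{p\in P}\mathcal G_{\mathcal C}(p)$. $\mathcal C$-non-overlapping: disjoint $\mathcal G_{\mathcal C}$-sets; pairwise $\mathcal C$-non-overlapping: any two different elements are. Constrained terms are identified up to $\doteq$ (renaming of variables together with logical equivalence of the existential closures of the constraints over variables not in the term); sets are taken modulo $\doteq$. $\mathrm{Co}(x)=\emptyset$ for variables; $\mathrm{Co}(c(u_1,\dots,u_n))=\{c'(x_1,\dots,x_m)\mid c'\ne c$ in $\mathcal C$ with the same result sort as $c\}\cup\bigcup_i\{c(u_1,\dots,u_{i-1},u'_i,y_{i+1},\dots,y_n)\mid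 u'_i\in\mathrm{Co}(u_i)\}$ (fresh distinct variables). $\mathrm{CoSub}(\sigma)=\{\rho\mid\mathrm{Dom}(\rho)=\mathrm{Dom}(\sigma),\rho\ne\sigma,\forall x\in\mathrm{Dom}(\sigma).\ x\rho\in\mathrm{Co}(x\sigma)\cup\{x\sigma\}\}$. $s\,[\varphi]$, $t\,[\psi]$ unifiable: $s,t$ have an mgu $\theta$ with $\mathrm{Dom}(\theta)\subseteq\mathrm{Var}(s,t)$, $x\theta\in\mathrm{Val}\cup\mathcal V$ for $x\in\mathrm{Var}(\varphi,\psi)$, and $\varphi\theta\wedge\psi\theta$ satisfiable. $s\,[\varphi]\ominus t\,[\psi]$ (value-free $s\,[\varphi]$, value-free linear $t\,[\psi]$): take variable-disjoint variant $t'\,[\psi']\doteq t\,[\psi]$; if unifiable with $\sigma$ an mgu of $s,t'$, it is $\{s\rho\,[\varphi\sigma]\mid\rho\in\mathrm{CoSub}(\sigma),s\rho\ne s\sigma\}\cup\{s\sigma\,[\varphi\sigma\wedge\neg\psi'\sigma]\mid$ satisfiable$\}$; otherwise $\{s\,[\varphi]\}$. For finite sets $P,Q$ of value-free constrained linear patterns (nondeterministically): if $P=P'\uplus\{s\,[\varphi]\}$, $Q=Q'\uplus\{t\,[\psi]\}$ with $s\,[\varphi]\ominus t\,[\psi]\ne\{s\,[\varphi]\}$ then $P\ominus Q=(P'\cup(s\,[\varphi]\ominus t\,[\psi]))\ominus(Q'\cup(t\,[\psi]\ominus s\,[\varphi]))$, else $P\ominus Q=P$. $\mathrm{Co}_f(Q)=\{f(x_1,\dots,x_n)\,[\mathsf{true}]\}\ominus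 Q$ with $x_1,\dots,x_n$ pairwise distinct variables. A set $P$ of constrained patterns is a complement of $Q$ w.r.t. $f$ if $\mathcal G_{\mathcal C}(P)=\mathcal G_{\mathcal C}(f(x_1,\dots,x_n)\,[\mathsf{true}])\setminus\mathcal G_{\mathcal C}(Q)$.
   Formalization: Each t [ψ] in Q is assumed equivalent (up to ≐) to one with Var(ψ) ⊆ Var(t), and ⊖ is computed on such representatives; otherwise the claim fails, e.g. for Q = {f(x) [x = y]} over a theory sort with at least two values. *)

theory Defs
  imports Main "HOL-Library.Countable_Set"
begin

section \<open>Terms and substitutions\<close>

datatype (funs: 'f, vars: 'v) trm = Var 'v | Fun 'f "('f, 'v) trm list"

type_synonym ('f, 'v) sub = "'v \<Rightarrow> ('f, 'v) trm"

primrec subst :: "('f, 'v) trm \<Rightarrow> ('f, 'v) sub \<Rightarrow> ('f, 'v) trm" (infixl "\<cdot>" 75) where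
  "Var x \<cdot> \<sigma> = \<sigma> x"
| "Fun f ts \<cdot> \<sigma> = Fun f (map (\<lambda>t. t \<cdot> \<sigma>) ts)"

primrec vars_list :: "('f, 'v) trm \<Rightarrow> 'v list" where
  "vars_list (Var x) = [x]"
| "vars_list (Fun f ts) = concat (map vars_list ts)"

definition linear :: "('f, 'v) trm \<Rightarrow> bool" where
  "linear t \<longleftrightarrow> distinct (vars_list t)"

abbreviation ground :: "('f, 'v) trm \<Rightarrow> bool" where
  "ground t \<equiv> vars t = {}"

fun root :: "('f, 'v) trm \<Rightarrow> 'f option" where
  "root (Var x) = None"
| "root (Fun f ts) = Some f"

definition sdom :: "('f, 'v) sub \<Rightarrow> 'v set" where
  "sdom \<sigma> = {x. \<sigma> x \<noteq> Var x}"


section \<open>Signatures with a background theory\<close>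

text \<open>
  The types \<open>'s\<close> and \<open>'f\<close> are the set of all sorts and the whole signature.  All universes
  live in one type \<open>'u\<close>; \<open>bool_elt\<close> embeds the truth values into it.
\<close>

record ('s, 'f, 'v, 'u) signature =
  theory_sorts :: "'s set"
  term_sorts :: "'s set"
  theory_syms :: "'f set"
  term_syms :: "'f set"
  defined_syms :: "'f set"
  constructors :: "'f set"
  arg_sorts :: "'f \<Rightarrow> 's list"
  res_sort :: "'f \<Rightarrow> 's"
  var_sort :: "'v \<Rightarrow> 's"
  universe :: "'s \<Rightarrow> 'u set"
  interp :: "'f \<Rightarrow> 'u list \<Rightarrow> 'u"
  values_of :: "'s \<Rightarrow> 'f set"
  bool_sort :: 's
  bool_elt :: "bool \<Rightarrow> 'u"
  true_sym :: 'f
  false_sym :: 'f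
  not_sym :: 'f
  and_sym :: 'f
  or_sym :: 'f
  imp_sym :: 'f
  eq_sym :: "'s \<Rightarrow> 'f"

definition vals :: "('s, 'f, 'v, 'u) signature \<Rightarrow> 'f set" where
  "vals L = (\<Union>\<iota>\<in>theory_sorts L. values_of L \<iota>)"

locale lc_signature =
  fixes L :: "('s, 'f, 'v, 'u) signature"
  assumes sorts_disjoint: "theory_sorts L \<inter> term_sorts L = {}"
    and sorts_all: "theory_sorts L \<union> term_sorts L = UNIV"
    and syms_all: "theory_syms L \<union> term_syms L = UNIV"
    and variables: "\<And>\<iota>. countable {x. var_sort L x = \<iota>} \<and> infinite {x. var_sort L x = \<iota>}"
    and theory_syms_sorts:
      "\<And>g. g \<in> theory_syms L \<Longrightarrow> res_sort L g \<in> theory_sorts L \<and> set (arg_sorts L g) \<subseteq> theory_sorts L"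
    and universe_nonempty: "\<And>\<iota>. \<iota> \<in> theory_sorts L \<Longrightarrow> universe L \<iota> \<noteq> {}"
    and interp_sorts:
      "\<And>g us. g \<in> theory_syms L \<Longrightarrow> list_all2 (\<lambda>u \<iota>. u \<in> universe L \<iota>) us (arg_sorts L g)
         \<Longrightarrow> interp L g us \<in> universe L (res_sort L g)"
    and values_theory: "\<And>\<iota>. \<iota> \<in> theory_sorts L \<Longrightarrow> values_of L \<iota> \<subseteq> theory_syms L"
    and values_sorts:
      "\<And>\<iota> v. \<iota> \<in> theory_sorts L \<Longrightarrow> v \<in> values_of L \<iota> \<Longrightarrow> arg_sorts L v = [] \<and> res_sort L v = \<iota>"
    and values_bij:
      "\<And>\<iota>. \<iota> \<in> theory_sorts L \<Longrightarrow> bij_betw (\<lambda>v. interp L v []) (values_of L \<iota>) (universe L \<iota>)"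
    and shared_syms: "term_syms L \<inter> theory_syms L \<subseteq> vals L"
    and bool_theory: "bool_sort L \<in> theory_sorts L"
    and bool_inj: "inj (bool_elt L)"
    and bool_universe: "universe L (bool_sort L) = range (bool_elt L)"
    and true_sym: "true_sym L \<in> values_of L (bool_sort L)" "interp L (true_sym L) [] = bool_elt L True"
    and false_sym: "false_sym L \<in> values_of L (bool_sort L)" "interp L (false_sym L) [] = bool_elt L False"
    and connectives_theory: "{not_sym L, and_sym L, or_sym L, imp_sym L} \<subseteq> theory_syms L"
    and not_sorts: "arg_sorts L (not_sym L) = [bool_sort L]" "res_sort L (not_sym L) = bool_sort L"
    and connectives_sorts:
      "\<And>g. g \<in> {and_sym L, or_sym L, imp_sym L} \<Longrightarrow>
         arg_sorts L g = [bool_sort L, bool_sort L] \<and> res_sort L g = bool_sort L"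
    and interp_not: "\<And>a. interp L (not_sym L) [bool_elt L a] = bool_elt L (\<not> a)"
    and interp_and: "\<And>a b. interp L (and_sym L) [bool_elt L a, bool_elt L b] = bool_elt L (a \<and> b)"
    and interp_or: "\<And>a b. interp L (or_sym L) [bool_elt L a, bool_elt L b] = bool_elt L (a \<or> b)"
    and interp_imp: "\<And>a b. interp L (imp_sym L) [bool_elt L a, bool_elt L b] = bool_elt L (a \<longrightarrow> b)"
    and eq_theory: "\<And>\<iota>. \<iota> \<in> theory_sorts L \<Longrightarrow> eq_sym L \<iota> \<in> theory_syms L"
    and eq_sorts:
      "\<And>\<iota>. \<iota> \<in> theory_sorts L \<Longrightarrow>
         arg_sorts L (eq_sym L \<iota>) = [\<iota>, \<iota>] \<and> res_sort L (eq_sym L \<iota>) = bool_sort L"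
    and interp_eq:
      "\<And>\<iota> a b. \<iota> \<in> theory_sorts L \<Longrightarrow> a \<in> universe L \<iota> \<Longrightarrow> b \<in> universe L \<iota>
         \<Longrightarrow> interp L (eq_sym L \<iota>) [a, b] = bool_elt L (a = b)"
    and constructors_disjoint: "defined_syms L \<inter> constructors L = {}"
    and constructors_all: "defined_syms L \<union> constructors L = UNIV"
    and values_constructors: "vals L \<subseteq> constructors L"
    and term_syms_finite: "finite (term_syms L)"
    and constructors_sorts: "\<And>c. c \<in> constructors L - vals L \<Longrightarrow> res_sort L c \<notin> theory_sorts L"

inductive has_sort :: "('s, 'f, 'v, 'u) signature \<Rightarrow> ('f, 'v) trm \<Rightarrow> 's \<Rightarrow> bool" for L where
  "has_sort L (Var x) (var_sort L x)"
| "list_all2 (has_sort L) ts (arg_sorts L g) \<Longrightarrow> has_sort L (Fun g ts) (res_sort L g)"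

definition terms_over :: "('s, 'f, 'v, 'u) signature \<Rightarrow> 'f set \<Rightarrow> ('f, 'v) trm set" where
  "terms_over L F = {t. (\<exists>\<iota>. has_sort L t \<iota>) \<and> funs t \<subseteq> F}"

definition is_subst :: "('s, 'f, 'v, 'u) signature \<Rightarrow> ('f, 'v) sub \<Rightarrow> bool" where
  "is_subst L \<sigma> \<longleftrightarrow> (\<forall>x. has_sort L (\<sigma> x) (var_sort L x))"

definition is_csubst :: "('s, 'f, 'v, 'u) signature \<Rightarrow> ('f, 'v) sub \<Rightarrow> bool" where
  "is_csubst L \<sigma> \<longleftrightarrow> is_subst L \<sigma> \<and> (\<forall>x. \<sigma> x \<in> terms_over L (constructors L))"

definition is_pattern :: "('s, 'f, 'v, 'u) signature \<Rightarrow> ('f, 'v) trm \<Rightarrow> bool" where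
  "is_pattern L t \<longleftrightarrow> t \<in> terms_over L UNIV \<and>
     (\<exists>g ts. t = Fun g ts \<and> g \<in> defined_syms L \<and> set ts \<subseteq> terms_over L (constructors L))"

definition value_free :: "('s, 'f, 'v, 'u) signature \<Rightarrow> ('f, 'v) trm \<Rightarrow> bool" where
  "value_free L t \<longleftrightarrow> funs t \<inter> vals L = {}"


section \<open>Constraints\<close>

definition is_constraint :: "('s, 'f, 'v, 'u) signature \<Rightarrow> ('f, 'v) trm \<Rightarrow> bool" where
  "is_constraint L \<phi> \<longleftrightarrow> \<phi> \<in> terms_over L (theory_syms L) \<and> has_sort L \<phi> (bool_sort L)"

primrec eval :: "('s, 'f, 'v, 'u) signature \<Rightarrow> ('v \<Rightarrow> 'u) \<Rightarrow> ('f, 'v) trm \<Rightarrow> 'u" where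
  "eval L \<alpha> (Var x) = \<alpha> x"
| "eval L \<alpha> (Fun g ts) = interp L g (map (eval L \<alpha>) ts)"

definition valuation :: "('s, 'f, 'v, 'u) signature \<Rightarrow> ('v \<Rightarrow> 'u) \<Rightarrow> bool" where
  "valuation L \<alpha> \<longleftrightarrow> (\<forall>x. var_sort L x \<in> theory_sorts L \<longrightarrow> \<alpha> x \<in> universe L (var_sort L x))"

definition value_terms :: "('s, 'f, 'v, 'u) signature \<Rightarrow> ('f, 'v) trm set" where
  "value_terms L = (\<lambda>v. Fun v []) ` vals L"

text \<open>
  The instance of \<open>\<phi>\<close> below is ground, so the assignment passed to \<open>eval\<close> is irrelevant.
\<close>

definition respects_c :: "('s, 'f, 'v, 'u) signature \<Rightarrow> ('f, 'v) sub \<Rightarrow> ('f, 'v) trm \<Rightarrow> bool" where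
  "respects_c L \<gamma> \<phi> \<longleftrightarrow> (\<forall>x\<in>vars \<phi>. \<gamma> x \<in> value_terms L) \<and>
     eval L (\<lambda>_. undefined) (\<phi> \<cdot> \<gamma>) = bool_elt L True"

definition satisfiable :: "('s, 'f, 'v, 'u) signature \<Rightarrow> ('f, 'v) trm \<Rightarrow> bool" where
  "satisfiable L \<phi> \<longleftrightarrow> (\<exists>\<gamma>. is_subst L \<gamma> \<and> respects_c L \<gamma> \<phi>)"

abbreviation true_c :: "('s, 'f, 'v, 'u) signature \<Rightarrow> ('f, 'v) trm" where
  "true_c L \<equiv> Fun (true_sym L) []"

abbreviation not_c :: "('s, 'f, 'v, 'u) signature \<Rightarrow> ('f, 'v) trm \<Rightarrow> ('f, 'v) trm" where
  "not_c L \<phi> \<equiv> Fun (not_sym L) [\<phi>]"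

abbreviation and_c :: "('s, 'f, 'v, 'u) signature \<Rightarrow> ('f, 'v) trm \<Rightarrow> ('f, 'v) trm \<Rightarrow> ('f, 'v) trm" where
  "and_c L \<phi> \<psi> \<equiv> Fun (and_sym L) [\<phi>, \<psi>]"


section \<open>Constrained terms up to renaming and equivalence of constraints\<close>

type_synonym ('f, 'v) cterm = "('f, 'v) trm \<times> ('f, 'v) trm"

definition cterms :: "('s, 'f, 'v, 'u) signature \<Rightarrow> ('f, 'v) cterm set" where
  "cterms L = {(t, \<psi>). t \<in> terms_over L UNIV \<and> is_constraint L \<psi>}"

text \<open>
  \<open>ex_closure L V \<phi> \<alpha>\<close>: the existential closure of \<open>\<phi>\<close> over the variables outside \<open>V\<close> holds
  under \<open>\<alpha>\<close>.
\<close>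

definition ex_closure ::
    "('s, 'f, 'v, 'u) signature \<Rightarrow> 'v set \<Rightarrow> ('f, 'v) trm \<Rightarrow> ('v \<Rightarrow> 'u) \<Rightarrow> bool" where
  "ex_closure L V \<phi> \<alpha> \<longleftrightarrow>
     (\<exists>\<beta>. valuation L \<beta> \<and> (\<forall>x\<in>V. \<beta> x = \<alpha> x) \<and> eval L \<beta> \<phi> = bool_elt L True)"

definition doteq :: "('s, 'f, 'v, 'u) signature \<Rightarrow> (('f, 'v) cterm \<times> ('f, 'v) cterm) set" where
  "doteq L = {((s, \<phi>), (t, \<psi>)). (s, \<phi>) \<in> cterms L \<and> (t, \<psi>) \<in> cterms L \<and>
     (\<exists>\<pi>. bij \<pi> \<and> (\<forall>x. var_sort L (\<pi> x) = var_sort L x) \<and> map_trm id \<pi> s = t \<and>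
       (\<forall>\<alpha>. valuation L \<alpha> \<longrightarrow>
          ex_closure L (vars t) (map_trm id \<pi> \<phi>) \<alpha> = ex_closure L (vars t) \<psi> \<alpha>))}"

text \<open>
  A set of constrained terms modulo \<open>doteq\<close> is a set of equivalence classes, i.e. a subset of
  \<open>cclasses L\<close>; properties of a constrained term are used on a class through its
  representatives.
\<close>

type_synonym ('f, 'v) cclass = "('f, 'v) cterm set"

definition cclasses :: "('s, 'f, 'v, 'u) signature \<Rightarrow> ('f, 'v) cclass set" where
  "cclasses L = cterms L // doteq L"

definition cls :: "('s, 'f, 'v, 'u) signature \<Rightarrow> ('f, 'v) cterm \<Rightarrow> ('f, 'v) cclass" where
  "cls L p = doteq L `` {p}"

definition GC1 :: "('s, 'f, 'v, 'u) signature \<Rightarrow> ('f, 'v) cterm \<Rightarrow> ('f, 'v) trm set" where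
  "GC1 L p = (case p of (t, \<psi>) \<Rightarrow>
     {t \<cdot> \<sigma> |\<sigma>. is_csubst L \<sigma> \<and> (\<forall>x\<in>vars t. ground (\<sigma> x)) \<and> respects_c L \<sigma> \<psi>})"

definition GC :: "('s, 'f, 'v, 'u) signature \<Rightarrow> ('f, 'v) cclass set \<Rightarrow> ('f, 'v) trm set" where
  "GC L P = (\<Union>c\<in>P. \<Union>p\<in>c. GC1 L p)"

definition pairwise_nonoverlapping :: "('s, 'f, 'v, 'u) signature \<Rightarrow> ('f, 'v) cclass set \<Rightarrow> bool" where
  "pairwise_nonoverlapping L P \<longleftrightarrow> (\<forall>c\<in>P. \<forall>d\<in>P. c \<noteq> d \<longrightarrow> GC L {c} \<inter> GC L {d} = {})"


section \<open>Unification\<close>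

definition is_mgu ::
    "('s, 'f, 'v, 'u) signature \<Rightarrow> ('f, 'v) sub \<Rightarrow> ('f, 'v) trm \<Rightarrow> ('f, 'v) trm \<Rightarrow> bool" where
  "is_mgu L \<theta> s t \<longleftrightarrow> is_subst L \<theta> \<and> s \<cdot> \<theta> = t \<cdot> \<theta> \<and>
     (\<forall>\<tau>. is_subst L \<tau> \<and> s \<cdot> \<tau> = t \<cdot> \<tau> \<longrightarrow> (\<exists>\<delta>. is_subst L \<delta> \<and> (\<forall>x. \<tau> x = \<theta> x \<cdot> \<delta>)))"

definition cunifier ::
    "('s, 'f, 'v, 'u) signature \<Rightarrow> ('f, 'v) sub \<Rightarrow> ('f, 'v) cterm \<Rightarrow> ('f, 'v) cterm \<Rightarrow> bool" where
  "cunifier L \<theta> p q \<longleftrightarrow> (case (p, q) of ((s, \<phi>), (t, \<psi>)) \<Rightarrow>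
     is_mgu L \<theta> s t \<and> sdom \<theta> \<subseteq> vars s \<union> vars t \<and>
     (\<forall>x\<in>vars \<phi> \<union> vars \<psi>. \<theta> x \<in> value_terms L \<union> range Var) \<and>
     satisfiable L (and_c L (\<phi> \<cdot> \<theta>) (\<psi> \<cdot> \<theta>)))"


section \<open>Complements\<close>

text \<open>
  \<open>co L X u u'\<close> stands for \<open>u' \<in> Co(u)\<close>, where the new variables of \<open>u'\<close> are pairwise distinct
  and avoid \<open>X\<close>.  All choices of the new variables are admitted; up to \<open>doteq\<close> the choice is
  immaterial.  \<open>X\<close> is meant to contain the variables of \<open>u\<close>.
\<close>

inductive co :: "('s, 'f, 'v, 'u) signature \<Rightarrow> 'v set \<Rightarrow> ('f, 'v) trm \<Rightarrow> ('f, 'v) trm \<Rightarrow> bool"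
  for L X where
  co_root: "\<lbrakk>c \<in> constructors L; c' \<in> constructors L; c' \<noteq> c; res_sort L c' = res_sort L c;
     distinct ys; map (var_sort L) ys = arg_sorts L c'; set ys \<inter> X = {}\<rbrakk>
   \<Longrightarrow> co L X (Fun c us) (Fun c' (map Var ys))"
| co_arg: "\<lbrakk>c \<in> constructors L; i < length us; co L X (us ! i) u';
     distinct ys; map (var_sort L) ys = drop (Suc i) (arg_sorts L c); set ys \<inter> (X \<union> vars u') = {}\<rbrakk>
   \<Longrightarrow> co L X (Fun c us) (Fun c (take i us @ u' # map Var ys))"

text \<open>
  The last conjunct says that the new variables introduced for different variables of the
  domain are different.
\<close>

definition cosub :: "('s, 'f, 'v, 'u) signature \<Rightarrow> 'v set \<Rightarrow> ('f, 'v) sub \<Rightarrow> ('f, 'v) sub set" where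
  "cosub L X \<sigma> = {\<rho>. sdom \<rho> = sdom \<sigma> \<and> \<rho> \<noteq> \<sigma> \<and>
     (\<forall>x\<in>sdom \<sigma>. co L X (\<sigma> x) (\<rho> x) \<or> \<rho> x = \<sigma> x) \<and>
     (\<forall>x\<in>sdom \<sigma>. \<forall>y\<in>sdom \<sigma>. x \<noteq> y \<longrightarrow> vars (\<rho> x) \<inter> vars (\<rho> y) \<subseteq> X)}"

definition diff_pieces ::
    "('s, 'f, 'v, 'u) signature \<Rightarrow> ('f, 'v) sub \<Rightarrow> ('f, 'v) cterm \<Rightarrow> ('f, 'v) cterm \<Rightarrow> ('f, 'v) cterm set" where
  "diff_pieces L \<sigma> p q = (case (p, q) of ((s, \<phi>), (t, \<psi>)) \<Rightarrow>
     let X = vars s \<union> vars \<phi> \<union> vars t \<union> vars \<psi> \<union> (\<Union>x\<in>sdom \<sigma>. vars (\<sigma> x)) in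
     {(s \<cdot> \<rho>, \<phi> \<cdot> \<sigma>) |\<rho>. \<rho> \<in> cosub L X \<sigma> \<and> s \<cdot> \<rho> \<noteq> s \<cdot> \<sigma>} \<union>
     {r. r = (s \<cdot> \<sigma>, and_c L (\<phi> \<cdot> \<sigma>) (not_c L (\<psi> \<cdot> \<sigma>))) \<and>
         satisfiable L (and_c L (\<phi> \<cdot> \<sigma>) (not_c L (\<psi> \<cdot> \<sigma>)))})"

text \<open>
  Constrained terms all of whose constraint variables occur in the term.  The difference below
  is computed on such representatives: for a variable \<open>y\<close> that occurs in \<open>\<psi>\<close> only, \<open>GC1\<close> reads
  both \<open>\<psi>\<close> and \<open>\<not> \<psi>\<close> existentially in \<open>y\<close>, so that \<open>\<not> \<psi>\<close> would not describe the complement.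
  (For instance \<open>f(x) [x = y]\<close> and \<open>f(x) [\<not> x = y]\<close> both denote all \<open>f(v)\<close> if the sort has at
  least two values.)
\<close>

definition cvars_closed :: "('f, 'v) cterm \<Rightarrow> bool" where
  "cvars_closed p \<longleftrightarrow> vars (snd p) \<subseteq> vars (fst p)"

text \<open>
  \<open>cdiff L c d R\<close>: \<open>R\<close> is a result of the difference of \<open>c\<close> and \<open>d\<close>, for some choice of
  variable-disjoint representatives and of the most general unifier.
\<close>

definition cdiff ::
    "('s, 'f, 'v, 'u) signature \<Rightarrow> ('f, 'v) cclass \<Rightarrow> ('f, 'v) cclass \<Rightarrow> ('f, 'v) cclass set \<Rightarrow> bool" where
  "cdiff L c d R \<longleftrightarrow> (\<exists>p\<in>c. \<exists>q\<in>d. cvars_closed p \<and> cvars_closed q \<and>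
     (vars (fst p) \<union> vars (snd p)) \<inter> (vars (fst q) \<union> vars (snd q)) = {} \<and>
     (if \<exists>\<sigma>. cunifier L \<sigma> p q
      then \<exists>\<sigma>. cunifier L \<sigma> p q \<and> R = cls L ` diff_pieces L \<sigma> p q
      else R = {c}))"

text \<open>
  \<open>set_diff L P Q R\<close>: \<open>R\<close> is a result of a terminating run of the nondeterministic procedure.
\<close>

inductive set_diff ::
    "('s, 'f, 'v, 'u) signature \<Rightarrow> ('f, 'v) cclass set \<Rightarrow> ('f, 'v) cclass set \<Rightarrow> ('f, 'v) cclass set \<Rightarrow> bool"
  for L where
  step: "\<lbrakk>c \<in> P; d \<in> Q; cdiff L c d P1; P1 \<noteq> {c}; cdiff L d c Q1;
     set_diff L (P - {c} \<union> P1) (Q - {d} \<union> Q1) R\<rbrakk> \<Longrightarrow> set_diff L P Q R"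
| stop: "(\<And>c d P1. c \<in> P \<Longrightarrow> d \<in> Q \<Longrightarrow> cdiff L c d P1 \<Longrightarrow> P1 = {c}) \<Longrightarrow> set_diff L P Q P"

definition arg_vars :: "('s, 'f, 'v, 'u) signature \<Rightarrow> 'f \<Rightarrow> 'v list \<Rightarrow> bool" where
  "arg_vars L f xs \<longleftrightarrow> distinct xs \<and> map (var_sort L) xs = arg_sorts L f"

definition full :: "('s, 'f, 'v, 'u) signature \<Rightarrow> 'f \<Rightarrow> 'v list \<Rightarrow> ('f, 'v) cclass" where
  "full L f xs = cls L (Fun f (map Var xs), true_c L)"

definition Co ::
    "('s, 'f, 'v, 'u) signature \<Rightarrow> 'f \<Rightarrow> 'v list \<Rightarrow> ('f, 'v) cclass set \<Rightarrow> ('f, 'v) cclass set \<Rightarrow> bool" where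
  "Co L f xs Q R \<longleftrightarrow> set_diff L {full L f xs} Q R"

definition is_complement ::
    "('s, 'f, 'v, 'u) signature \<Rightarrow> 'f \<Rightarrow> ('f, 'v) cclass set \<Rightarrow> ('f, 'v) cclass set \<Rightarrow> bool" where
  "is_complement L f Q P \<longleftrightarrow>
     P \<subseteq> cclasses L \<and> (\<forall>c\<in>P. \<forall>(t, \<psi>)\<in>c. is_pattern L t) \<and>
     (\<forall>xs. arg_vars L f xs \<longrightarrow> GC L P = GC L {full L f xs} - GC L Q)"

end

(*
  A step of the procedure splits c into c - d and d into d - c.  The variants s rho of the unified
  pattern s sigma are pairwise non-overlapping and cover exactly the instances of s that are not
  instances of s sigma, and the constraint decides which instances of s sigma remain; hence the
  difference is exact on ground instances.  Since P starts as a singleton and stays pairwise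
  non-overlapping, a common instance of c and d can be dropped from both sides without changing
  G(P) - G(Q).

  Termination is argued on instances that are generic up to a depth n bounding all patterns
  (the depth does not grow), with everything below depth n and all values erased: there are only
  finitely many of these, and each belongs to at most one piece of a difference.
*)

theory Submission
  imports Defs "HOL-Library.Multiset" "HOL-Combinatorics.Transposition"
begin

section \<open>Terms and substitutions\<close>

text \<open>Value-freeness keeps terms and constraints apart: a value-free constructor term of
  theory sort is a variable, and Co of a variable is empty. So a unifier sends the variables of the
  constraints to variables, the variants leave those alone, and one constraint
  \<open>\<phi> \<cdot> \<sigma>\<close> fits all \<open>s \<cdot> \<rho>\<close>. Negation is exact
  only if every variable of a constraint occurs in its term, hence the closed representatives.

  A run may pick any most general unifier, any fresh names and any such representatives. Linearity
  tames this: unifying linear terms without common variables is one parallel traversal, which keeps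
  linearity and depth, and every other most general unifier is a renaming of its result. Fresh names
  are neutralised by comparing terms in which each variable is replaced by its sort.

  The same sets of generic instances carry correctness and termination; their ground members are the
  sets in the claim.\<close>

lemma set_vars_list [simp]: "set (vars_list t) = vars t"
  by (induction t) auto

lemma subst_subst: "t \<cdot> \<sigma> \<cdot> \<tau> = t \<cdot> (\<lambda>x. \<sigma> x \<cdot> \<tau>)"
  by (induction t) auto

lemma subst_cong: "(\<And>x. x \<in> vars t \<Longrightarrow> \<sigma> x = \<tau> x) \<Longrightarrow> t \<cdot> \<sigma> = t \<cdot> \<tau>"
  by (induction t) auto

lemma subst_eqD: "t \<cdot> \<sigma> = t \<cdot> \<tau> \<Longrightarrow> x \<in> vars t \<Longrightarrow> \<sigma> x = \<tau> x"
  by (induction t) auto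

lemma subst_Var [simp]: "t \<cdot> Var = t"
  by (induction t) (auto simp: map_idI)

lemma map_trm_subst: "map_trm id \<pi> t = t \<cdot> (\<lambda>x. Var (\<pi> x))"
  by (induction t) auto

lemma map_trm_subst': "map_trm id \<pi> (t \<cdot> \<sigma>) = t \<cdot> (\<lambda>x. map_trm id \<pi> (\<sigma> x))"
  by (simp add: map_trm_subst subst_subst)

lemma vars_subst: "vars (t \<cdot> \<sigma>) = (\<Union>x\<in>vars t. vars (\<sigma> x))"
  by (induction t) auto

lemma funs_subst: "funs (t \<cdot> \<sigma>) = funs t \<union> (\<Union>x\<in>vars t. funs (\<sigma> x))"
  by (induction t) auto

lemma finite_vars [simp]: "finite (vars t)"
  by (induction t) auto

lemma vars_list_subst: "vars_list (t \<cdot> \<sigma>) = concat (map (\<lambda>x. vars_list (\<sigma> x)) (vars_list t))"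
proof (induction t)
  case (Fun g ts)
  then have "map (\<lambda>t. vars_list (t \<cdot> \<sigma>)) ts
      = map (\<lambda>t. concat (map (\<lambda>x. vars_list (\<sigma> x)) (vars_list t))) ts"
    by simp
  then show ?case
    by (simp add: o_def map_concat) (induction ts, auto)
qed simp

lemma vars_list_map_trm: "vars_list (map_trm id \<pi> t) = map \<pi> (vars_list t)"
  by (induction t) (auto simp: map_concat o_def intro!: arg_cong[where f = concat])

lemma linear_Var [simp]: "linear (Var x)"
  by (simp add: linear_def)

lemma linear_Fun_Nil [simp]: "linear (Fun g [])"
  by (simp add: linear_def)

lemma linear_Fun_Cons:
  "linear (Fun g (t # ts)) \<longleftrightarrow> linear t \<and> linear (Fun h ts) \<and> vars t \<inter> vars (Fun h ts) = {}"
  by (auto simp: linear_def)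

lemma linear_Fun_map_Var [simp]: "linear (Fun g (map Var xs)) \<longleftrightarrow> distinct xs"
  by (induction xs) (auto simp: linear_Fun_Cons[of g _ _ g])

lemma linear_FunD: "linear (Fun g ts) \<Longrightarrow> t \<in> set ts \<Longrightarrow> linear t"
  by (induction ts) (auto simp: linear_Fun_Cons[of g _ _ g])

lemma linear_Fun_append:
  "linear (Fun g (ts @ us)) \<longleftrightarrow>
     linear (Fun g ts) \<and> linear (Fun g us) \<and> vars (Fun g ts) \<inter> vars (Fun g us) = {}"
  by (induction ts) (auto simp: linear_Fun_Cons[of g _ _ g])

lemma linear_map_trm: "inj_on \<pi> (vars t) \<Longrightarrow> linear (map_trm id \<pi> t) \<longleftrightarrow> linear t"
  by (simp add: linear_def vars_list_map_trm distinct_map)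

lemma linear_substI:
  assumes "linear t"
    and "\<And>x. x \<in> vars t \<Longrightarrow> linear (\<sigma> x)"
    and "\<And>x y. x \<in> vars t \<Longrightarrow> y \<in> vars t \<Longrightarrow> x \<noteq> y \<Longrightarrow> vars (\<sigma> x) \<inter> vars (\<sigma> y) = {}"
  shows "linear (t \<cdot> \<sigma>)"
proof -
  have "distinct (concat (map (\<lambda>x. vars_list (\<sigma> x)) xs))"
    if "distinct xs" "set xs \<subseteq> vars t" for xs
    using that
  proof (induction xs)
    case (Cons x xs)
    have "vars (\<sigma> x) \<inter> vars (\<sigma> y) = {}" if "y \<in> set xs" for y
      using Cons.prems that assms(3)[of x y] by auto
    then show ?case
      using Cons assms(2)[of x] by (auto simp: linear_def)
  qed simp
  then show ?thesis
    using assms(1) by (simp add: linear_def vars_list_subst)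
qed

lemma linear_substD:
  assumes "linear (t \<cdot> \<sigma>)" "x \<in> vars t"
  shows "linear (\<sigma> x)"
  using assms by (induction t) (auto dest!: linear_FunD simp del: set_vars_list)

lemma linear_subst_disjoint:
  assumes "linear (t \<cdot> \<sigma>)" "x \<in> vars t" "y \<in> vars t" "x \<noteq> y"
  shows "vars (\<sigma> x) \<inter> vars (\<sigma> y) = {}"
proof -
  have "vars (\<sigma> x) \<inter> vars (\<sigma> y) = {}"
    if "distinct (concat (map (\<lambda>x. vars_list (\<sigma> x)) xs))" "x \<in> set xs" "y \<in> set xs" for xs
    using that assms(4) by (induction xs) auto
  then show ?thesis
    using assms by (simp add: linear_def vars_list_subst)
qed

text \<open>A term that has a variable as an instance is itself a variable, so a substitution that
  can be undone on \<open>t\<close> only renames. It is applied to two most general unifiers, which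
  are instances of each other.\<close>

lemma subst_inverse_renaming:
  assumes "t \<cdot> \<sigma> \<cdot> \<tau> = t"
  obtains \<pi> where "inj_on \<pi> (vars t)" "\<And>x. x \<in> vars t \<Longrightarrow> \<sigma> x = Var (\<pi> x)"
proof -
  have st: "\<sigma> x \<cdot> \<tau> = Var x" if "x \<in> vars t" for x
    using subst_eqD[of t "\<lambda>x. \<sigma> x \<cdot> \<tau>" Var] assms that by (simp add: subst_subst)
  define \<pi> where "\<pi> x = (SOME y. \<sigma> x = Var y)" for x
  have sv: "\<sigma> x = Var (\<pi> x)" if "x \<in> vars t" for x
  proof -
    have "\<exists>y. \<sigma> x = Var y"
      using st[OF that] by (cases "\<sigma> x") auto
    then show ?thesis
      unfolding \<pi>_def by (rule someI_ex)
  qed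
  have "inj_on \<pi> (vars t)"
  proof (rule inj_onI)
    fix x y assume *: "x \<in> vars t" "y \<in> vars t" "\<pi> x = \<pi> y"
    then have "Var x = (Var y :: ('a, 'b) trm)"
      using st[of x] st[of y] sv[of x] sv[of y] by simp
    then show "x = y" by simp
  qed
  then show ?thesis
    using sv that by blast
qed


section \<open>Matching a linear term\<close>

text \<open>The right argument of \<open>lmatch\<close> may also be a term in which the variables have been erased.\<close>

inductive lmatch :: "('f, 'v) trm \<Rightarrow> ('f, 'w) trm \<Rightarrow> bool" where
  "lmatch (Var x) w"
| "list_all2 lmatch us ws \<Longrightarrow> lmatch (Fun g us) (Fun g ws)"

lemma lmatch_Var [simp]: "lmatch (Var x) w"
  by (rule lmatch.intros)

lemma lmatch_Fun: "lmatch (Fun g us) w \<longleftrightarrow> (\<exists>ws. w = Fun g ws \<and> list_all2 lmatch us ws)"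
  by (auto elim: lmatch.cases intro: lmatch.intros)

lemma lmatch_Fun_Fun [simp]: "lmatch (Fun g us) (Fun h ws) \<longleftrightarrow> g = h \<and> list_all2 lmatch us ws"
  by (auto simp: lmatch_Fun)

lemma lmatch_Fun_Var [simp]: "\<not> lmatch (Fun g us) (Var x)"
  by (simp add: lmatch_Fun)

lemma lmatch_subst: "lmatch u (u \<cdot> \<sigma>)"
  by (induction u) (auto simp: list_all2_conv_all_nth)

text \<open>\<open>lmatch\<close> treats all occurrences of variables independently. Linearity
  allows the matchers found for the arguments to be glued together, as the arguments share no
  variables.\<close>

lemma linear_lmatch_imp_subst: "linear u \<Longrightarrow> lmatch u w \<Longrightarrow> \<exists>\<delta>. u \<cdot> \<delta> = w"
proof (induction u arbitrary: w)
  case (Var x)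
  then show ?case by (intro exI[of _ "\<lambda>_. w"]) simp
next
  case (Fun g us)
  obtain ws where w: "w = Fun g ws" "list_all2 lmatch us ws"
    using Fun.prems by (auto simp: lmatch_Fun)
  have "\<exists>\<delta>. map (\<lambda>t. t \<cdot> \<delta>) us = ws"
    using w(2) Fun.IH Fun.prems(1)
  proof (induction us ws rule: list_all2_induct)
    case (Cons u us w ws)
    have lin: "linear u" "linear (Fun g us)" "vars u \<inter> vars (Fun g us) = {}"
      using Cons.prems(2) by (simp_all add: linear_Fun_Cons[of g _ _ g])
    obtain \<delta> where 1: "u \<cdot> \<delta> = w"
      using Cons.prems(1)[of u w] lin(1) Cons.hyps(1) by auto
    obtain \<delta>' where 2: "map (\<lambda>t. t \<cdot> \<delta>') us = ws"
      using Cons.IH Cons.prems(1) lin(2) by auto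
    let ?\<delta> = "\<lambda>x. if x \<in> vars u then \<delta> x else \<delta>' x"
    have "u \<cdot> ?\<delta> = w"
      using 1 by (auto intro: subst_cong)
    moreover have "t \<cdot> ?\<delta> = t \<cdot> \<delta>'" if "t \<in> set us" for t
      using lin(3) that by (intro subst_cong) auto
    then have "map (\<lambda>t. t \<cdot> ?\<delta>) us = ws"
      using 2 by (metis (no_types, lifting) map_eq_conv)
    ultimately show ?case
      by (intro exI[of _ ?\<delta>]) simp
  qed simp
  then show ?case
    using w(1) by auto
qed


section \<open>Unification of linear terms\<close>

text \<open>
  For linear terms without common variables no occurs check and no propagation of bindings is
  needed: the bindings read off a parallel traversal form an idempotent most general unifier.
\<close>

function (sequential) bindings :: "('f, 'v) trm \<Rightarrow> ('f, 'v) trm \<Rightarrow> ('v \<times> ('f, 'v) trm) list" where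
  "bindings (Var x) t = [(x, t)]"
| "bindings (Fun g us) (Var y) = [(y, Fun g us)]"
| "bindings (Fun g us) (Fun h ws) = concat (map (\<lambda>(u, w). bindings u w) (zip us ws))"
  by pat_completeness auto
termination
  by (relation "measure (\<lambda>(s, t). size s)")
    (auto dest!: set_zip_leftD simp: less_Suc_eq_le size_list_estimation')

abbreviation solves :: "('f, 'v) sub \<Rightarrow> ('v \<times> ('f, 'v) trm) list \<Rightarrow> bool" where
  "solves \<tau> bs \<equiv> \<forall>(x, u)\<in>set bs. \<tau> x = u \<cdot> \<tau>"

lemma unifier_solves_bindings: "s \<cdot> \<tau> = t \<cdot> \<tau> \<Longrightarrow> solves \<tau> (bindings s t)"
proof (induction s t rule: bindings.induct)
  case (3 g us h ws)
  have "u \<cdot> \<tau> = w \<cdot> \<tau>" if uw: "(u, w) \<in> set (zip us ws)" for u w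
  proof -
    obtain i where i: "i < length us" "i < length ws" "u = us ! i" "w = ws ! i"
      using uw by (auto simp: set_zip)
    have "map (\<lambda>t. t \<cdot> \<tau>) us = map (\<lambda>t. t \<cdot> \<tau>) ws"
      using 3(2) by simp
    then show ?thesis
      using i by (metis nth_map)
  qed
  then show ?case
    using 3(1) by fastforce
qed auto

text \<open>
  That the two terms have a common instance of the same shape is kept in the induction by
  naming some unifier \<open>\<tau>\<close>, since \<open>bindings\<close> ignores clashes of symbols.
\<close>

lemma solves_bindings_unifies:
  "s \<cdot> \<tau> = t \<cdot> \<tau> \<Longrightarrow> solves \<mu> (bindings s t) \<Longrightarrow> s \<cdot> \<mu> = t \<cdot> \<mu>"
proof (induction s t rule: bindings.induct)
  case (3 g us h ws)
  have eq: "map (\<lambda>t. t \<cdot> \<tau>) us = map (\<lambda>t. t \<cdot> \<tau>) ws" and [simp]: "g = h"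
    using 3(2) by simp_all
  have len: "length us = length ws"
    using eq by (rule map_eq_imp_length_eq)
  have "us ! i \<cdot> \<mu> = ws ! i \<cdot> \<mu>" if "i < length us" for i
  proof (rule 3(1)[of "(us ! i, ws ! i)" "us ! i" "ws ! i"])
    show *: "(us ! i, ws ! i) \<in> set (zip us ws)"
      using that len by (auto simp: set_zip)
    show "us ! i \<cdot> \<tau> = ws ! i \<cdot> \<tau>"
      using eq that len by (metis nth_map)
    show "solves \<mu> (bindings (us ! i) (ws ! i))"
      using 3(3) * by fastforce
  qed simp
  then show ?case
    using len by (auto intro: nth_equalityI)
qed auto

text \<open>Conservation of occurrences: each occurrence of a variable in \<open>s\<close> or
  \<open>t\<close> turns up exactly once in the bindings, as a bound variable or inside a bound
  term. Multisets are used so that distinctness carries over from the terms to the bindings.\<close>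

lemma bindings_vars:
  "mset (vars_list s) + mset (vars_list t)
     = mset (concat (map (\<lambda>(x, u). x # vars_list u) (bindings s t)))"
  if "s \<cdot> \<tau> = t \<cdot> \<tau>"
  using that
proof (induction s t rule: bindings.induct)
  case (3 g us h ws)
  have eq: "map (\<lambda>t. t \<cdot> \<tau>) us = map (\<lambda>t. t \<cdot> \<tau>) ws"
    using 3(2) by simp
  then have "length us = length ws"
    by (rule map_eq_imp_length_eq)
  then show ?case
    using eq 3(1)
  proof (induction us ws rule: list_induct2)
    case (Cons u us w ws)
    have "mset (vars_list u) + mset (vars_list w)
        = mset (concat (map (\<lambda>(x, u). x # vars_list u) (bindings u w)))"
      using Cons.prems(1) by (intro Cons.prems(2)[of "(u, w)" u w]) simp_all
    moreover have "mset (vars_list (Fun g us)) + mset (vars_list (Fun h ws))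
        = mset (concat (map (\<lambda>(x, u). x # vars_list u) (bindings (Fun g us) (Fun h ws))))"
      proof (rule Cons.IH)
      show "map (\<lambda>t. t \<cdot> \<tau>) us = map (\<lambda>t. t \<cdot> \<tau>) ws"
        using Cons.prems(1) by simp
    qed (rule Cons.prems(2); simp)
    ultimately show ?case
      by (simp add: ac_simps)
  qed simp
qed auto

text \<open>Where the traversal records a binding, the common instance shows exactly the bound term.
  Linearity of the instance thus reduces to the bound terms being linear and pairwise
  variable-disjoint.\<close>

lemma subst_bindings_vars_list:
  "s \<cdot> \<tau> = t \<cdot> \<tau> \<Longrightarrow> \<forall>(x, u)\<in>set (bindings s t). \<mu> x = u \<and> u \<cdot> \<mu> = u \<Longrightarrow>
     vars_list (s \<cdot> \<mu>) = concat (map (\<lambda>(x, u). vars_list u) (bindings s t))"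
proof (induction s t rule: bindings.induct)
  case (3 g us h ws)
  have eq: "map (\<lambda>t. t \<cdot> \<tau>) us = map (\<lambda>t. t \<cdot> \<tau>) ws"
    using 3(2) by simp
  then have "length us = length ws"
    by (rule map_eq_imp_length_eq)
  then show ?case
    using eq 3(1,3)
  proof (induction us ws rule: list_induct2)
    case (Cons u us w ws)
    have "vars_list (u \<cdot> \<mu>) = concat (map (\<lambda>(x, u). vars_list u) (bindings u w))"
      using Cons.prems by auto
    moreover have "vars_list (Fun g us \<cdot> \<mu>)
        = concat (map (\<lambda>(x, u). vars_list u) (bindings (Fun g us) (Fun h ws)))"
      using Cons.prems by (intro Cons.IH) auto
    ultimately show ?case
      by simp
  qed simp
qed auto

lemma bindings_range:
  "(x, u) \<in> set (bindings s t) \<Longrightarrow> funs u \<subseteq> funs s \<union> funs t"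
proof (induction s t rule: bindings.induct)
  case (3 g us h ws)
  then obtain u' w' where *: "(u', w') \<in> set (zip us ws)" "(x, u) \<in> set (bindings u' w')"
    by auto
  then have "funs u \<subseteq> funs u' \<union> funs w'"
    using 3(1) by blast
  then show ?case
    using set_zip_leftD[OF *(1)] set_zip_rightD[OF *(1)] by auto
qed auto

text \<open>Variables may stand at any depth; only symbols at depth \<open>n\<close> or more are
  forbidden, the root having depth 0. Thus \<open>n = 0\<close> leaves variables only.\<close>

fun depth_le :: "nat \<Rightarrow> ('f, 'v) trm \<Rightarrow> bool" where
  "depth_le n (Var x) \<longleftrightarrow> True"
| "depth_le 0 (Fun g ts) \<longleftrightarrow> False"
| "depth_le (Suc n) (Fun g ts) \<longleftrightarrow> (\<forall>t\<in>set ts. depth_le n t)"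

text \<open>The traversal places a bound term at a position where one of the two terms already has
  it, and idempotence (\<open>u \<cdot> \<mu> = u\<close>) prevents anything from being inserted
  further below.\<close>

lemma depth_le_bindings_subst:
  "s \<cdot> \<tau> = t \<cdot> \<tau> \<Longrightarrow> \<forall>(x, u)\<in>set (bindings s t). \<mu> x = u \<and> u \<cdot> \<mu> = u \<Longrightarrow>
     depth_le n s \<Longrightarrow> depth_le n t \<Longrightarrow> depth_le n (s \<cdot> \<mu>)"
proof (induction s t arbitrary: n rule: bindings.induct)
  case (3 g us h ws)
  obtain m where n: "n = Suc m"
    using 3(4) by (cases n) auto
  have eq: "map (\<lambda>t. t \<cdot> \<tau>) us = map (\<lambda>t. t \<cdot> \<tau>) ws"
    using 3(2) by simp
  then have len: "length us = length ws"
    by (rule map_eq_imp_length_eq)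
  have "depth_le m (us ! i \<cdot> \<mu>)" if "i < length us" for i
  proof (rule 3(1)[of "(us ! i, ws ! i)" "us ! i" "ws ! i"])
    show *: "(us ! i, ws ! i) \<in> set (zip us ws)"
      using that len by (auto simp: set_zip)
    show "us ! i \<cdot> \<tau> = ws ! i \<cdot> \<tau>"
      using eq that len by (metis nth_map)
    show "\<forall>(x, u)\<in>set (bindings (us ! i) (ws ! i)). \<mu> x = u \<and> u \<cdot> \<mu> = u"
      using 3(3) * by fastforce
  qed (use 3(4,5) n that len in auto)
  then show ?case
    using n by (auto simp: in_set_conv_nth)
qed auto

text \<open>The equation \<open>\<mu> x \<cdot> \<tau>' = \<tau>' x\<close> is the idempotent form
  of generality: each unifier factors through \<open>\<mu>\<close> with itself as second factor, so
  its sorts and symbols are those already known.\<close>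

lemma linear_unify:
  fixes s t :: "('f, 'v) trm"
  assumes "linear s" "linear t" "vars s \<inter> vars t = {}" "s \<cdot> \<tau> = t \<cdot> \<tau>"
  obtains \<mu> where "s \<cdot> \<mu> = t \<cdot> \<mu>" "sdom \<mu> \<subseteq> vars s \<union> vars t"
    and "\<And>\<tau>' x. s \<cdot> \<tau>' = t \<cdot> \<tau>' \<Longrightarrow> \<mu> x \<cdot> \<tau>' = \<tau>' x"
    and "linear (s \<cdot> \<mu>)"
    and "\<And>n. depth_le n s \<Longrightarrow> depth_le n t \<Longrightarrow> depth_le n (s \<cdot> \<mu>)"
    and "\<And>x. \<mu> x = Var x \<or> (\<exists>u. (x, u) \<in> set (bindings s t) \<and> \<mu> x = u)"
proof -
  let ?bs = "bindings s t"
  have "distinct (vars_list s @ vars_list t)"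
    using assms(1-3) by (simp add: linear_def)
  moreover have "mset (vars_list s @ vars_list t)
      = mset (concat (map (\<lambda>(x, u). x # vars_list u) ?bs))"
    using bindings_vars[OF assms(4)] by simp
  ultimately have dist: "distinct (concat (map (\<lambda>(x, u). x # vars_list u) ?bs))"
    by (metis mset_eq_imp_distinct_iff)
  have sub: "x \<in> vars s \<union> vars t" if "(x, u) \<in> set ?bs" for x u
    using bindings_vars[OF assms(4), THEN arg_cong, of set_mset] that by force
  \<comment> \<open>Each variable is bound once, so the bindings form a map; the bound terms are
    linear and share no variables, which gives linearity of the instance; no bound variable occurs
    in a bound term, which gives idempotence.\<close>
  have fst: "distinct (map fst bs)" and snd: "distinct (concat (map (\<lambda>(x, u). vars_list u) bs))"
    and dis: "set (map fst bs) \<inter> (\<Union>(x, u)\<in>set bs. vars u) = {}"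
    if "distinct (concat (map (\<lambda>(x, u). x # vars_list u) bs))"
    for bs :: "('v \<times> ('f, 'v) trm) list"
  proof -
    show "distinct (map fst bs)"
      using that
    proof (induction bs)
      case (Cons b bs)
      have "fst b \<notin> fst ` set bs"
        using Cons.prems by (cases b) auto
      moreover have "distinct (concat (map (\<lambda>(x, u). x # vars_list u) bs))"
        using Cons.prems by simp
      ultimately show ?case
        using Cons.IH by simp
    qed simp
    show "distinct (concat (map (\<lambda>(x, u). vars_list u) bs))"
      using that
    proof (induction bs)
      case (Cons b bs)
      have "vars (snd b) \<inter> vars (snd c) = {}" if "c \<in> set bs" for c
        using Cons.prems that by (cases b; cases c) fastforce
      then show ?case
        using Cons by (fastforce simp: case_prod_unfold)
    qed simp
    show "set (map fst bs) \<inter> (\<Union>(x, u)\<in>set bs. vars u) = {}"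
      using that
    proof (induction bs)
      case (Cons b bs)
      have "set (map fst bs) \<inter> (\<Union>(x, u)\<in>set bs. vars u) = {}"
        using Cons by simp
      moreover have "(insert (fst b) (vars (snd b))) \<inter> (insert (fst c) (vars (snd c))) = {}"
        if "c \<in> set bs" for c
        using Cons.prems that by (cases b; cases c) fastforce
      moreover have "fst b \<notin> vars (snd b)"
        using Cons.prems by (cases b) simp
      ultimately show ?case
        by (fastforce simp: case_prod_unfold)
    qed simp
  qed
  note fst = fst[OF dist] and snd = snd[OF dist] and dis = dis[OF dist]
  define \<mu> where "\<mu> x = (case map_of ?bs x of None \<Rightarrow> Var x | Some u \<Rightarrow> u)" for x
  have mu: "\<mu> x = u" if "(x, u) \<in> set ?bs" for x u
    using that fst by (simp add: \<mu>_def)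
  have mu': "\<mu> x = Var x" if "x \<notin> fst ` set ?bs" for x
  proof -
    have "map_of ?bs x = None"
      using that by (simp add: map_of_eq_None_iff)
    then show ?thesis
      by (simp add: \<mu>_def)
  qed
  have idem: "u \<cdot> \<mu> = u" if "(x, u) \<in> set ?bs" for x u
  proof -
    have "u \<cdot> \<mu> = u \<cdot> Var"
    proof (rule subst_cong)
      fix y
      assume "y \<in> vars u"
      then have "y \<in> (\<Union>(x, u)\<in>set ?bs. vars u)"
        using that by blast
      then have "y \<notin> fst ` set ?bs"
        using dis by auto
      then show "\<mu> y = Var y"
        by (rule mu')
    qed
    then show ?thesis by simp
  qed
  have cases: "\<mu> x = Var x \<or> (\<exists>u. (x, u) \<in> set ?bs \<and> \<mu> x = u)" for x
  proof (cases "x \<in> fst ` set ?bs")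
    case True
    then obtain u where "(x, u) \<in> set ?bs"
      by auto
    then show ?thesis
      using mu by blast
  qed (simp add: mu')
  have uni: "s \<cdot> \<mu> = t \<cdot> \<mu>"
    by (rule solves_bindings_unifies[OF assms(4)]) (auto simp: mu idem)
  show ?thesis
  proof
    show "sdom \<mu> \<subseteq> vars s \<union> vars t"
    proof
      fix x
      assume "x \<in> sdom \<mu>"
      then obtain u where "(x, u) \<in> set ?bs"
        using cases[of x] by (auto simp: sdom_def)
      then show "x \<in> vars s \<union> vars t"
        by (rule sub)
    qed
    show "\<mu> x \<cdot> \<tau>' = \<tau>' x" if "s \<cdot> \<tau>' = t \<cdot> \<tau>'" for \<tau>' x
      using cases[of x]
    proof
      assume "\<exists>u. (x, u) \<in> set ?bs \<and> \<mu> x = u"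
      then show ?thesis
        using unifier_solves_bindings[OF that] by auto
    qed simp
    show "linear (s \<cdot> \<mu>)"
      unfolding linear_def
      by (subst subst_bindings_vars_list[OF assms(4)]) (auto simp: mu idem snd)
    show "depth_le n (s \<cdot> \<mu>)" if "depth_le n s" "depth_le n t" for n
      by (rule depth_le_bindings_subst[OF assms(4) _ that]) (auto simp: mu idem)
  qed (use uni cases in auto)
qed

text \<open>A term is its shape plus the left-to-right list of its variables. The maps
  \<open>a\<close> and \<open>b\<close> are arbitrary because the first premise serves only to
  compare shapes.\<close>

lemma trm_eqI: "map_trm id a s = map_trm id b t \<Longrightarrow> vars_list s = vars_list t \<Longrightarrow> s = t"
proof (induction s arbitrary: t)
  case (Var x)
  then show ?case by (cases t) auto
next
  case (Fun g ss)
  then obtain ts where t: "t = Fun g ts"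
    by (cases t) auto
  have eq: "map (map_trm id a) ss = map (map_trm id b) ts"
    using Fun.prems(1) t by (simp add: id_def)
  then have len: "length ss = length ts"
    by (rule map_eq_imp_length_eq)
  have nth: "map_trm id a (ss ! i) = map_trm id b (ts ! i)" if "i < length ss" for i
    using eq len that by (metis nth_map)
  \<comment> \<open>Arguments of equal shape contain equally many variables, so both concatenations
    are cut at the same places.\<close>
  have "map vars_list ss = map vars_list ts"
  proof (rule concat_injective)
    have "length (vars_list (ss ! i)) = length (vars_list (ts ! i))" if "i < length ss" for i
      using arg_cong[OF nth[OF that], of "\<lambda>t. length (vars_list t)"]
      by (simp add: vars_list_map_trm)
    then show "\<forall>(x, y)\<in>set (zip (map vars_list ss) (map vars_list ts)). length x = length y"
      using len by (auto simp: set_zip)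
  qed (use Fun.prems(2) t len in simp_all)
  then have "vars_list (ss ! i) = vars_list (ts ! i)" if "i < length ss" for i
    using len that by (metis nth_map)
  then have "ss ! i = ts ! i" if "i < length ss" for i
    using Fun.IH[OF nth_mem[OF that] nth[OF that]] that by blast
  then show ?case
    using t len by (auto intro: nth_equalityI)
qed

text \<open>
  \<open>safe u w\<close> says that \<open>u\<close> can fail to match \<open>w\<close> only because of a clash of symbols, never
  because a variable of \<open>w\<close> meets a symbol of \<open>u\<close>.
\<close>

inductive safe :: "('f, 'v) trm \<Rightarrow> ('f, 'w) trm \<Rightarrow> bool" where
  "safe (Var x) w"
| "g \<noteq> h \<Longrightarrow> safe (Fun g us) (Fun h ws)"
| "list_all2 safe us ws \<Longrightarrow> safe (Fun g us) (Fun g ws)"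

lemma safe_Var [simp]: "safe (Var x) w"
  by (rule safe.intros)

lemma safe_Fun_Fun [simp]: "safe (Fun g us) (Fun h ws) \<longleftrightarrow> (g = h \<longrightarrow> list_all2 safe us ws)"
  by (auto elim: safe.cases intro: safe.intros)

lemma safe_Fun_Var [simp]: "\<not> safe (Fun g us) (Var x)"
  by (auto elim: safe.cases)

lemma safe_substD: "safe (t \<cdot> \<sigma>) (t \<cdot> \<tau>) \<Longrightarrow> x \<in> vars t \<Longrightarrow> safe (\<sigma> x) (\<tau> x)"
proof (induction t)
  case (Fun g ts)
  then show ?case
    by (fastforce simp: list_all2_conv_all_nth in_set_conv_nth)
qed simp

lemma lmatch_subst_subst:
  "(\<And>x. x \<in> vars t \<Longrightarrow> lmatch (\<rho> x) (\<tau> x)) \<Longrightarrow> lmatch (t \<cdot> \<rho>) (t \<cdot> \<tau>)"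
proof (induction t)
  case (Fun g ts)
  then show ?case
    by (fastforce simp: list_all2_conv_all_nth in_set_conv_nth)
qed simp

lemma depth_le_subst:
  "(\<And>x n. x \<in> vars t \<Longrightarrow> depth_le n (\<sigma> x) \<Longrightarrow> depth_le n (\<rho> x)) \<Longrightarrow> depth_le n (t \<cdot> \<sigma>) \<Longrightarrow>
     depth_le n (t \<cdot> \<rho>)"
proof (induction t arbitrary: n)
  case (Fun g ts)
  obtain m where n: "n = Suc m"
    using Fun.prems(2) by (cases n) auto
  have "depth_le m (t \<cdot> \<rho>)" if "t \<in> set ts" for t
    using Fun.prems n that by (intro Fun.IH[OF that]) auto
  then show ?case
    using n by simp
qed simp

text \<open>Two instances of the same \<open>t\<close> that match \<open>w\<close> can be compared
  separately at each occurrence of a variable of \<open>t\<close>. The map \<open>a\<close> sets the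
  precision: the identity for equality, the sorts for equality up to fresh names.\<close>

lemma lmatch_subst_relate:
  fixes w :: "('f, 'w) trm"
  assumes "\<And>x (w :: ('f, 'w) trm). x \<in> vars t \<Longrightarrow> lmatch (\<rho> x) w \<Longrightarrow> lmatch (\<rho>' x) w \<Longrightarrow>
      map_trm id a (\<rho> x) = map_trm id a (\<rho>' x)"
    and "lmatch (t \<cdot> \<rho>) w" "lmatch (t \<cdot> \<rho>') w"
  shows "map_trm id a (t \<cdot> \<rho>) = map_trm id a (t \<cdot> \<rho>')"
  using assms
proof (induction t arbitrary: w)
  case (Fun g ts)
  obtain ws where w: "w = Fun g ws" "list_all2 lmatch (map (\<lambda>t. t \<cdot> \<rho>) ts) ws"
      "list_all2 lmatch (map (\<lambda>t. t \<cdot> \<rho>') ts) ws"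
    using Fun.prems(2,3) by (auto simp: lmatch_Fun)
  have "map_trm id a (t \<cdot> \<rho>) = map_trm id a (t \<cdot> \<rho>')" if t: "t \<in> set ts" for t
  proof -
    obtain i where i: "i < length ts" "t = ts ! i"
      using t by (auto simp: in_set_conv_nth)
    show ?thesis
    proof (rule Fun.IH[OF t])
      show "map_trm id a (\<rho> x) = map_trm id a (\<rho>' x)"
        if "x \<in> vars t" "lmatch (\<rho> x) w" "lmatch (\<rho>' x) w" for x and w :: "('f, 'w) trm"
        using Fun.prems(1)[of x w] that t by (auto simp: id_def)
      show "lmatch (t \<cdot> \<rho>) (ws ! i)" "lmatch (t \<cdot> \<rho>') (ws ! i)"
        using w i by (simp_all add: list_all2_conv_all_nth)
    qed
  qed
  then show ?case
    by (simp add: id_def)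
qed simp

lemma lmatch_subst_unique:
  fixes w :: "('f, 'w) trm"
  assumes "\<And>x (w :: ('f, 'w) trm). x \<in> vars t \<Longrightarrow> lmatch (\<rho> x) w \<Longrightarrow> lmatch (\<rho>' x) w \<Longrightarrow> \<rho> x = \<rho>' x"
    and "lmatch (t \<cdot> \<rho>) w" "lmatch (t \<cdot> \<rho>') w"
  shows "t \<cdot> \<rho> = t \<cdot> \<rho>'"
proof -
  have "map_trm id id (t \<cdot> \<rho>) = map_trm id id (t \<cdot> \<rho>')"
  proof (rule lmatch_subst_relate[OF _ assms(2,3)])
    show "map_trm id id (\<rho> x) = map_trm id id (\<rho>' x)"
      if "x \<in> vars t" "lmatch (\<rho> x) w" "lmatch (\<rho>' x) w" for x and w :: "('f, 'w) trm"
      using assms(1)[OF that] by simp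
  qed
  then show ?thesis
    by (simp add: trm.map_id)
qed


section \<open>Sorted terms and their complements\<close>

context lc_signature
begin

lemma has_sort_Var [simp]: "has_sort L (Var x) \<iota> \<longleftrightarrow> \<iota> = var_sort L x"
  by (auto elim: has_sort.cases intro: has_sort.intros)

lemma has_sort_Fun [simp]:
  "has_sort L (Fun g ts) \<iota> \<longleftrightarrow> \<iota> = res_sort L g \<and> list_all2 (has_sort L) ts (arg_sorts L g)"
  by (auto elim: has_sort.cases intro: has_sort.intros)

lemma has_sort_subst:
  "has_sort L t \<iota> \<Longrightarrow> (\<And>x. x \<in> vars t \<Longrightarrow> has_sort L (\<sigma> x) (var_sort L x)) \<Longrightarrow> has_sort L (t \<cdot> \<sigma>) \<iota>"
proof (induction t arbitrary: \<iota>)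
  case (Fun g ts)
  have "has_sort L (ts ! i \<cdot> \<sigma>) (arg_sorts L g ! i)" if "i < length ts" for i
  proof (rule Fun.IH)
    show "ts ! i \<in> set ts"
      using that by simp
    then show "has_sort L (\<sigma> x) (var_sort L x)" if "x \<in> vars (ts ! i)" for x
      using Fun.prems(2)[of x] that by auto
  qed (use Fun.prems(1) that in \<open>simp add: list_all2_conv_all_nth\<close>)
  then show ?case
    using Fun.prems(1) by (simp add: list_all2_conv_all_nth)
qed simp

lemma has_sort_substD:
  "has_sort L (t \<cdot> \<sigma>) \<iota> \<Longrightarrow> has_sort L t \<iota> \<Longrightarrow> x \<in> vars t \<Longrightarrow> has_sort L (\<sigma> x) (var_sort L x)"
proof (induction t arbitrary: \<iota>)
  case (Fun g ts)
  obtain i where "i < length ts" "x \<in> vars (ts ! i)"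
    using Fun.prems(3) by (auto simp: in_set_conv_nth)
  then show ?case
    using Fun.prems(1,2) by (intro Fun.IH[of "ts ! i"]) (auto simp: list_all2_conv_all_nth)
qed simp

lemma vals_symbol:
  assumes "v \<in> vals L"
  shows "arg_sorts L v = []" "res_sort L v \<in> theory_sorts L" "v \<in> theory_syms L"
    "v \<in> constructors L"
  using assms values_sorts values_theory values_constructors unfolding vals_def by blast+

text \<open>By the standing assumption on constructors, a constructor whose result sort is a theory
  sort is a value, and values are constants.\<close>

lemma theory_sort_cterm:
  assumes "has_sort L t \<iota>" "\<iota> \<in> theory_sorts L" "funs t \<subseteq> constructors L"
  shows "(\<exists>x. t = Var x) \<or> t \<in> value_terms L"
proof (cases t)
  case (Fun g ts)
  then have "g \<in> vals L"
    using assms constructors_sorts[of g] by auto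
  then show ?thesis
    using Fun assms(1) vals_symbol(1)[of g] by (auto simp: value_terms_def)
qed simp

lemma fresh_variables:
  assumes "finite X"
  obtains ys where "distinct ys" "map (var_sort L) ys = \<iota>s" "set ys \<inter> X = {}"
proof -
  have "\<exists>ys. distinct ys \<and> map (var_sort L) ys = \<iota>s \<and> set ys \<inter> X = {}"
  proof (induction \<iota>s)
    case (Cons \<iota> \<iota>s)
    then obtain ys where ys: "distinct ys" "map (var_sort L) ys = \<iota>s" "set ys \<inter> X = {}"
      by blast
    have "infinite ({x. var_sort L x = \<iota>} - (X \<union> set ys))"
      using variables[of \<iota>] assms by (auto intro: Diff_infinite_finite)
    then obtain y where "var_sort L y = \<iota>" "y \<notin> X \<union> set ys"
      using infinite_imp_nonempty by blast
    then show ?case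
      using ys by (intro exI[of _ "y # ys"]) auto
  qed simp
  then show ?thesis
    using that by blast
qed

section \<open>The members of Co(u): invariants, disjointness and covering\<close>

lemma co_mono: "co L Y u u' \<Longrightarrow> X \<subseteq> Y \<Longrightarrow> co L X u u'"
proof (induction rule: co.induct)
  case (co_root c c' ys us)
  then show ?case by (intro co.co_root) auto
next
  case (co_arg c i us u' ys)
  then show ?case by (intro co.co_arg) auto
qed

lemma co_vars: "co L X u u' \<Longrightarrow> vars u' \<subseteq> vars u \<union> - X"
proof (induction rule: co.induct)
  case (co_arg c i us u' ys)
  then show ?case
    using nth_mem[of i us] by (fastforce dest: in_set_takeD)
qed auto

text \<open>Variables have no complement. Elements of \<open>cosub\<close> therefore agree with the
  unifier wherever it yields a variable, in particular on the variables of the constraints.\<close>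

lemma co_is_Fun: "co L X u u' \<Longrightarrow> (\<exists>g us. u = Fun g us) \<and> (\<exists>g us. u' = Fun g us)"
  by (induction rule: co.induct) auto

lemma co_has_sort: "co L X u u' \<Longrightarrow> has_sort L u \<iota> \<Longrightarrow> has_sort L u' \<iota>"
proof (induction arbitrary: \<iota> rule: co.induct)
  case (co_root c c' ys us)
  have "list_all2 (has_sort L) (map Var ys) (map (var_sort L) ys)"
    by (simp add: list_all2_conv_all_nth)
  then show ?case
    using co_root by simp
next
  case (co_arg c i us u' ys)
  have sorts: "list_all2 (has_sort L) us (arg_sorts L c)"
    using co_arg.prems by simp
  then have i: "i < length (arg_sorts L c)"
    using co_arg.hyps(2) by (simp add: list_all2_lengthD)
  have "has_sort L (us ! i) (arg_sorts L c ! i)"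
    using sorts co_arg.hyps(2) by (rule list_all2_nthD)
  then have "has_sort L u' (arg_sorts L c ! i)"
    by (rule co_arg.IH)
  moreover have "list_all2 (has_sort L) (map Var ys) (drop (Suc i) (arg_sorts L c))"
    unfolding co_arg.hyps(5)[symmetric] by (simp add: list_all2_conv_all_nth)
  moreover have "list_all2 (has_sort L) (take i us) (take i (arg_sorts L c))"
    using sorts by (rule list_all2_takeI)
  ultimately have "list_all2 (has_sort L) (take i us @ u' # map Var ys)
      (take i (arg_sorts L c) @ arg_sorts L c ! i # drop (Suc i) (arg_sorts L c))"
    by (intro list_all2_appendI) simp_all
  then show ?case
    using co_arg.prems i by (simp add: id_take_nth_drop[symmetric])
qed

text \<open>A new symbol \<open>c'\<close> shares its result sort with a constructor that is not a
  value. Such a sort lies outside the theory, so \<open>c'\<close> is no value either.\<close>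

lemma co_funs:
  "co L X u u' \<Longrightarrow> funs u \<subseteq> constructors L - vals L \<Longrightarrow> funs u' \<subseteq> constructors L - vals L"
proof (induction rule: co.induct)
  case (co_root c c' ys us)
  then have "c' \<notin> vals L"
    using constructors_sorts[of c] vals_symbol(2)[of c'] by auto
  then show ?case
    using co_root by auto
next
  case (co_arg c i us u' ys)
  then show ?case
    using nth_mem[of i us] by (fastforce dest: in_set_takeD)
qed

lemma co_depth_le: "co L X u u' \<Longrightarrow> depth_le n u \<Longrightarrow> depth_le n u'"
proof (induction arbitrary: n rule: co.induct)
  case (co_root c c' ys us)
  then show ?case by (cases n) auto
next
  case (co_arg c i us u' ys)
  then show ?case by (cases n) (auto dest: in_set_takeD)
qed

lemma co_linear: "co L X u u' \<Longrightarrow> linear u \<Longrightarrow> vars u \<subseteq> X \<Longrightarrow> linear u'"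
proof (induction rule: co.induct)
  case (co_arg c i us u' ys)
  have us: "us = take i us @ us ! i # drop (Suc i) us"
    using co_arg.hyps(2) by (rule id_take_nth_drop)
  have lin: "linear (Fun c (take i us))" "linear (us ! i)"
    "vars (Fun c (take i us)) \<inter> vars (us ! i) = {}"
    using co_arg.prems(1) by (subst (asm) us; auto simp: linear_Fun_append linear_Fun_Cons[of c _ _ c])+
  have sub: "vars (Fun c (take i us)) \<subseteq> X" "vars (us ! i) \<subseteq> X"
    using co_arg.prems(2) co_arg.hyps(2) by (fastforce dest: in_set_takeD)+
  have "vars u' \<subseteq> vars (us ! i) \<union> - X"
    using co_arg.hyps(3) by (rule co_vars)
  moreover have "linear u'"
    using co_arg.IH lin(2) sub(2) by simp
  ultimately show ?case
    using lin sub co_arg.hyps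
    by (auto simp: linear_Fun_append linear_Fun_Cons[of c _ _ c])
qed simp

lemma co_lmatch_disjoint: "co L X u u' \<Longrightarrow> lmatch u w \<Longrightarrow> \<not> lmatch u' w"
proof (induction arbitrary: w rule: co.induct)
  case (co_root c c' ys us)
  then show ?case by (auto simp: lmatch_Fun)
next
  case (co_arg c i us u' ys)
  then obtain ws where w: "w = Fun c ws" "list_all2 lmatch us ws"
    by (auto simp: lmatch_Fun)
  then have "\<not> lmatch u' (ws ! i)"
    using co_arg.hyps(2) by (intro co_arg.IH) (rule list_all2_nthD)
  moreover have "lmatch u' (ws ! i)" if "list_all2 lmatch (take i us @ u' # map Var ys) ws"
    using list_all2_nthD[OF that, of i] co_arg.hyps(2) by (simp add: nth_append)
  ultimately show ?case
    using w by auto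
qed

text \<open>For linear terms a complete invariant of sorted renaming. It serves as equality for
  members of Co, which are determined only up to the choice of fresh names.\<close>

abbreviation skel :: "('f, 'v) trm \<Rightarrow> ('f, 's) trm" where
  "skel \<equiv> map_trm id (var_sort L)"

text \<open>\<open>w\<close> determines the changed argument: the arguments before it are kept from
  \<open>u\<close> and match, while the changed one excludes a match of \<open>u\<close>, so its
  index is the first at which \<open>u\<close> fails. The later arguments are variables with sorts
  prescribed by \<open>c\<close>.\<close>

lemma co_lmatch_skel:
  "co L X u u1 \<Longrightarrow> co L X u u2 \<Longrightarrow> lmatch u1 w \<Longrightarrow> lmatch u2 w \<Longrightarrow> skel u1 = skel u2"
proof (induction arbitrary: w u2 rule: co.induct)
  case (co_root c c' ys us)
  from co_root.prems(1) show ?case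
  proof cases
    case (co_root c'' zs)
    then have "c'' = c'"
      using co_root.prems by (auto simp: lmatch_Fun)
    moreover have "map skel (map Var xs) = map Var (map (var_sort L) xs)"
      for xs :: "'v list"
      by (simp add: id_def)
    ultimately show ?thesis
      using co_root \<open>map (var_sort L) ys = arg_sorts L c'\<close> by (simp add: id_def del: map_map)
  next
    case (co_arg i u' zs)
    then show ?thesis
      using co_root.prems co_root.hyps by (auto simp: lmatch_Fun)
  qed
next
  case (co_arg c i us u' ys)
  obtain ws where w: "w = Fun c ws" and m1: "list_all2 lmatch (take i us @ u' # map Var ys) ws"
    using co_arg.prems(2) by (auto simp: lmatch_Fun)
  from co_arg.prems(1) show ?case
  proof cases
    case (co_root c'' zs)
    then show ?thesis
      using co_arg.prems by (auto simp: lmatch_Fun)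
  next
    case A: (co_arg j u'' zs)
    have m2: "list_all2 lmatch (take j us @ u'' # map Var zs) ws"
      using co_arg.prems(3) A(1) w by simp
    have i: "i < length us" "lmatch u' (ws ! i)"
      using list_all2_nthD[OF m1, of i] co_arg.hyps(2) by (simp_all add: nth_append)
    have j: "j < length us" "lmatch u'' (ws ! j)"
      using list_all2_nthD[OF m2, of j] A by (simp_all add: nth_append)
    have "\<not> i < j"
    proof
      assume "i < j"
      then have "lmatch (us ! i) (ws ! i)"
        using list_all2_nthD[OF m2, of i] i j by (simp add: nth_append)
      then show False
        using co_lmatch_disjoint[OF co_arg.hyps(3)] i by blast
    qed
    moreover have "\<not> j < i"
    proof
      assume "j < i"
      then have "lmatch (us ! j) (ws ! j)"
        using list_all2_nthD[OF m1, of j] i j by (simp add: nth_append)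
      then show False
        using co_lmatch_disjoint[of X "us ! j" u''] A j by blast
    qed
    ultimately have "i = j" by simp
    then have "skel u' = skel u''"
      using co_arg.IH[of u'' "ws ! i"] A i j by blast
    moreover have "map skel (map Var xs) = map Var (map (var_sort L) xs)"
      for xs :: "'v list"
      by (simp add: id_def)
    ultimately show ?thesis
      using A \<open>i = j\<close> co_arg.hyps(5) by (simp add: id_def del: map_map)
  qed
qed

text \<open>Descending along the first argument that does not match ends at two different root
  symbols, because \<open>safe\<close> rules out a variable of \<open>w\<close> there. The symbol of
  \<open>w\<close> has the same result sort and becomes the new symbol.\<close>

lemma co_cover:
  assumes "safe u w" "has_sort L u \<iota>" "has_sort L w \<iota>"
    and "funs u \<subseteq> constructors L" "funs w \<subseteq> constructors L" "finite X" "\<not> lmatch u w"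
  shows "\<exists>u'. co L X u u' \<and> lmatch u' w"
  using assms
proof (induction u arbitrary: w \<iota>)
  case (Fun g us)
  then obtain h ws where w: "w = Fun h ws"
    by (cases w) auto
  show ?case
  proof (cases "g = h")
    case False
    obtain ys where ys: "distinct ys" "map (var_sort L) ys = arg_sorts L h" "set ys \<inter> X = {}"
      using fresh_variables[OF Fun.prems(6)] .
    have "co L X (Fun g us) (Fun h (map Var ys))"
      by (rule co.co_root) (use Fun.prems w False ys in auto)
    moreover have "length ys = length ws"
      using Fun.prems(3) ys(2) w by (metis has_sort_Fun length_map list_all2_lengthD)
    then have "lmatch (Fun h (map Var ys)) w"
      using w by (simp add: list_all2_conv_all_nth)
    ultimately show ?thesis by blast
  next
    case True
    have len: "length us = length (arg_sorts L g)" "length ws = length (arg_sorts L g)"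
      using Fun.prems(2,3) w True by (auto dest: list_all2_lengthD)
    have "\<exists>i. i < length us \<and> \<not> lmatch (us ! i) (ws ! i)"
      using Fun.prems(7) w True len by (auto simp: list_all2_conv_all_nth)
    \<comment> \<open>The least such index is needed: \<open>co_arg\<close> keeps the arguments to
      the left, which have to match, and frees those to the right.\<close>
    then obtain i where i: "i < length us" "\<not> lmatch (us ! i) (ws ! i)"
        and least: "\<And>j. j < i \<Longrightarrow> j < length us \<Longrightarrow> lmatch (us ! j) (ws ! j)"
      using exists_least_iff[of "\<lambda>i. i < length us \<and> \<not> lmatch (us ! i) (ws ! i)"] by blast
    have mem: "us ! i \<in> set us" "ws ! i \<in> set ws"
      using i len by auto
    have "\<exists>u'. co L X (us ! i) u' \<and> lmatch u' (ws ! i)"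
    proof (rule Fun.IH[OF mem(1)])
      show "safe (us ! i) (ws ! i)"
        using Fun.prems(1) w True i by (simp add: list_all2_nthD)
      show "has_sort L (us ! i) (arg_sorts L g ! i)" "has_sort L (ws ! i) (arg_sorts L g ! i)"
        using Fun.prems(2,3) w True i len by (simp_all add: list_all2_conv_all_nth)
      show "funs (us ! i) \<subseteq> constructors L" "funs (ws ! i) \<subseteq> constructors L"
        using Fun.prems(4,5) mem w by auto
    qed (use Fun.prems(6) i in auto)
    then obtain u' where u': "co L X (us ! i) u'" "lmatch u' (ws ! i)"
      by blast
    have "finite (X \<union> vars u')"
      using Fun.prems(6) by simp
    then obtain ys where ys: "distinct ys" "map (var_sort L) ys = drop (Suc i) (arg_sorts L g)"
        "set ys \<inter> (X \<union> vars u') = {}"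
      by (rule fresh_variables)
    have "co L X (Fun g us) (Fun g (take i us @ u' # map Var ys))"
      by (rule co.co_arg) (use Fun.prems i u' ys in auto)
    moreover have leny: "length ys = length us - Suc i"
      using ys(2) len by (metis length_drop length_map)
    have "lmatch ((take i us @ u' # map Var ys) ! j) (ws ! j)" if "j < length us" for j
    proof (cases j i rule: linorder_cases)
      case greater
      then have "j - Suc i < length ys"
        using that leny by simp
      then show ?thesis
        using greater i by (simp add: nth_append nth_Cons')
    qed (use least that u' i in \<open>simp_all add: nth_append\<close>)
    then have "list_all2 lmatch (take i us @ u' # map Var ys) ws"
      using i len leny by (simp add: list_all2_conv_all_nth)
    ultimately show ?thesis
      using w True by (intro exI[of _ "Fun g (take i us @ u' # map Var ys)"]) simp
  qed
qed simp


section \<open>Terms with variables at large depth only\<close>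

text \<open>
  Sorts without ground constructor terms make ground instances useless for termination: there
  unifiable patterns need not have a common ground instance.  Terms that are generic up to
  depth \<open>n\<close> take the place of ground terms: their variables are invisible for patterns of depth at
  most \<open>n\<close>.
\<close>

fun deep :: "nat \<Rightarrow> ('f, 'v) trm \<Rightarrow> bool" where
  "deep n (Var x) \<longleftrightarrow> var_sort L x \<notin> theory_sorts L \<and>
     (n = 0 \<or> (\<forall>c\<in>constructors L. res_sort L c \<noteq> var_sort L x))"
| "deep n (Fun g ts) \<longleftrightarrow> (\<forall>t\<in>set ts. deep (n - 1) t)"

lemma deep_mono: "deep n t \<Longrightarrow> m \<le> n \<Longrightarrow> deep m t"
proof (induction t arbitrary: m n)
  case (Fun g ts)
  have "deep (m - 1) t" if "t \<in> set ts" for t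
    by (rule Fun.IH[OF that, of "n - 1"]) (use Fun.prems that in auto)
  then show ?case by simp
qed auto

lemma ground_deep: "ground t \<Longrightarrow> deep n t"
  by (induction t arbitrary: n) auto

lemma deep_var_sort: "deep n t \<Longrightarrow> x \<in> vars t \<Longrightarrow> var_sort L x \<notin> theory_sorts L"
  by (induction t arbitrary: n) auto

lemma deep_subst: "(\<And>x. x \<in> vars t \<Longrightarrow> deep n (\<delta> x)) \<Longrightarrow> deep n (t \<cdot> \<delta>)"
proof (induction t arbitrary: n)
  case (Fun g ts)
  have "deep (n - 1) (t \<cdot> \<delta>)" if "t \<in> set ts" for t
  proof (rule Fun.IH[OF that])
    show "deep (n - 1) (\<delta> x)" if "x \<in> vars t" for x
    proof (rule deep_mono)
      show "deep n (\<delta> x)"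
        by (rule Fun.prems) (use that \<open>t \<in> set ts\<close> in auto)
    qed simp
  qed
  then show ?case by simp
qed simp

text \<open>The symbols of \<open>u\<close> stand at depth less than \<open>n\<close>, where
  \<open>w\<close> has a variable only if its sort has no constructor. A symbol of \<open>u\<close>
  meeting that variable would be such a constructor.\<close>

lemma deep_safe:
  assumes "depth_le n u" "deep n w" "has_sort L u \<iota>" "has_sort L w \<iota>" "funs u \<subseteq> constructors L"
  shows "safe u w"
  using assms
proof (induction u arbitrary: n w \<iota>)
  case (Fun g us)
  obtain m where n: "n = Suc m"
    using Fun.prems(1) by (cases n) auto
  obtain h ws where w: "w = Fun h ws"
    using Fun.prems n by (cases w) auto
  have "list_all2 safe us ws" if "g = h"
  proof -
    have len: "length us = length ws"
      using Fun.prems(3,4) w that by (auto dest!: list_all2_lengthD)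
    have "safe (us ! i) (ws ! i)" if i: "i < length us" for i
    proof (rule Fun.IH)
      show "us ! i \<in> set us"
        using i by simp
      then show "depth_le m (us ! i)" "funs (us ! i) \<subseteq> constructors L"
        using Fun.prems(1,5) n by auto
      show "deep m (ws ! i)"
        using Fun.prems(2) n w i len by simp
      show "has_sort L (us ! i) (arg_sorts L g ! i)" "has_sort L (ws ! i) (arg_sorts L g ! i)"
        using Fun.prems(3,4) w i len \<open>g = h\<close> by (simp_all add: list_all2_conv_all_nth)
    qed
    then show ?thesis
      using len by (simp add: list_all2_conv_all_nth)
  qed
  then show ?case
    using w by simp
qed simp

lemma value_exists:
  assumes "\<iota> \<in> theory_sorts L" "e \<in> universe L \<iota>"
  shows "\<exists>v\<in>vals L. res_sort L v = \<iota> \<and> interp L v [] = e"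
proof -
  have "e \<in> (\<lambda>v. interp L v []) ` values_of L \<iota>"
    using values_bij[OF assms(1)] assms(2) by (simp add: bij_betw_def)
  then show ?thesis
    using values_sorts[OF assms(1)] assms(1) by (auto simp: vals_def)
qed

text \<open>Covers also sorts without ground constructor terms: constructors are stacked
  \<open>n\<close> times and variables put below, or earlier where a sort has no constructor. Theory
  sorts always have a value, since universes are nonempty.\<close>

lemma deep_term_exists: "\<exists>t. has_sort L t \<iota> \<and> funs t \<subseteq> constructors L \<and> deep n t"
proof (induction n arbitrary: \<iota>)
  case 0
  show ?case
  proof (cases "\<iota> \<in> theory_sorts L")
    case True
    then obtain v where "v \<in> vals L" "res_sort L v = \<iota>"
      using universe_nonempty value_exists by blast
    then show ?thesis
      using vals_symbol[of v] by (intro exI[of _ "Fun v []"]) auto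
  next
    case False
    obtain x where "var_sort L x = \<iota>"
      using variables[of \<iota>] infinite_imp_nonempty by blast
    then show ?thesis
      using False by (intro exI[of _ "Var x"]) auto
  qed
next
  case (Suc n)
  show ?case
  proof (cases "\<exists>c\<in>constructors L. res_sort L c = \<iota>")
    case True
    then obtain c where c: "c \<in> constructors L" "res_sort L c = \<iota>"
      by blast
    obtain f where f: "\<And>\<kappa>. has_sort L (f \<kappa>) \<kappa> \<and> funs (f \<kappa>) \<subseteq> constructors L \<and> deep n (f \<kappa>)"
      using Suc.IH by metis
    have "has_sort L (Fun c (map f (arg_sorts L c))) \<iota>"
      using c f by (simp add: list_all2_conv_all_nth)
    then show ?thesis
      using c f by (intro exI[of _ "Fun c (map f (arg_sorts L c))"]) auto
  next
    case False
    then have "\<iota> \<notin> theory_sorts L"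
      using universe_nonempty[of \<iota>] value_exists[of \<iota>] vals_symbol(4) by blast
    obtain x where "var_sort L x = \<iota>"
      using variables[of \<iota>] infinite_imp_nonempty by blast
    then show ?thesis
      using False \<open>\<iota> \<notin> theory_sorts L\<close> by (intro exI[of _ "Var x"]) auto
  qed
qed

text \<open>
  Values are erased because there may be infinitely many of them; value-free patterns of depth at
  most \<open>n\<close> cannot tell \<open>w\<close> from \<open>cut n w\<close>.
\<close>

fun cut :: "nat \<Rightarrow> ('f, 'v) trm \<Rightarrow> ('f, unit) trm" where
  "cut n (Var x) = Var ()"
| "cut 0 (Fun g ts) = Var ()"
| "cut (Suc n) (Fun g ts) = (if g \<in> vals L then Var () else Fun g (map (cut n) ts))"

lemma lmatch_cut: "lmatch u w \<Longrightarrow> depth_le n u \<Longrightarrow> value_free L u \<Longrightarrow> lmatch u (cut n w)"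
proof (induction u arbitrary: n w)
  case (Fun g us)
  obtain m where n: "n = Suc m"
    using Fun.prems(2) by (cases n) auto
  obtain ws where w: "w = Fun g ws" "list_all2 lmatch us ws"
    using Fun.prems(1) by (auto simp: lmatch_Fun)
  have "lmatch (us ! i) (cut m (ws ! i))" if "i < length us" for i
  proof (rule Fun.IH)
    show "us ! i \<in> set us"
      using that by simp
    then show "depth_le m (us ! i)" "value_free L (us ! i)"
      using Fun.prems(2,3) n by (auto simp: value_free_def)
    show "lmatch (us ! i) (ws ! i)"
      using w(2) that by (rule list_all2_nthD)
  qed
  then show ?case
    using w n Fun.prems(3) by (auto simp: list_all2_conv_all_nth value_free_def)
qed simp

lemma finite_cuts:
  assumes "finite F"
  shows "finite {cut n t |t. (\<exists>\<iota>. has_sort L t \<iota>) \<and> funs t - vals L \<subseteq> F}" (is "finite (?S n)")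
proof (induction n)
  case 0
  have "cut 0 t = Var ()" for t
    by (cases t) simp_all
  then have "?S 0 \<subseteq> {Var ()}"
    by auto
  then show ?case
    by (rule finite_subset) simp
next
  case (Suc n)
  let ?T = "insert (Var ()) (\<Union>g\<in>F. Fun g ` {hs. set hs \<subseteq> ?S n \<and> length hs = length (arg_sorts L g)})"
  have "cut (Suc n) t \<in> ?T" if t: "has_sort L t \<iota>" "funs t - vals L \<subseteq> F" for t \<iota>
  proof (cases t)
    case (Fun g ts)
    have "cut n t' \<in> ?S n" if "t' \<in> set ts" for t'
    proof -
      have "\<exists>\<kappa>. has_sort L t' \<kappa>"
        using t(1) Fun that by (auto simp: list_all2_conv_all_nth in_set_conv_nth)
      moreover have "funs t' - vals L \<subseteq> F"
        using t(2) Fun that by auto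
      ultimately show ?thesis by blast
    qed
    then have args: "map (cut n) ts \<in> {hs. set hs \<subseteq> ?S n \<and> length hs = length (arg_sorts L g)}"
      using t(1) Fun by (auto dest: list_all2_lengthD)
    show ?thesis
    proof (cases "g \<in> vals L")
      case False
      then have "g \<in> F"
        using t(2) Fun by auto
      moreover have "cut (Suc n) t = Fun g (map (cut n) ts)"
        using Fun False by simp
      ultimately show ?thesis
        using args by blast
    qed (use Fun in simp)
  qed simp
  then have "?S (Suc n) \<subseteq> ?T"
    by blast
  moreover have "finite ?T"
    using assms Suc.IH by (auto intro!: finite_lists_length_eq)
  ultimately show ?case
    by (rule finite_subset)
qed


section \<open>Renamings\<close>

definition renaming :: "('v \<Rightarrow> 'v) \<Rightarrow> bool" where
  "renaming \<pi> \<longleftrightarrow> bij \<pi> \<and> (\<forall>x. var_sort L (\<pi> x) = var_sort L x)"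

text \<open>\<open>doteq\<close> asks for a bijection on all variables, so the finite map from
  \<open>xs\<close> to \<open>ys\<close> has to be extended. Transpositions do this one entry at a
  time.\<close>

lemma renaming_lists:
  assumes "distinct xs" "distinct ys" "map (var_sort L) xs = map (var_sort L) ys"
  obtains \<pi> where "renaming \<pi>" "map \<pi> xs = ys"
proof -
  have "length xs = length ys"
    using assms(3) by (rule map_eq_imp_length_eq)
  then have "\<exists>\<pi>. renaming \<pi> \<and> map \<pi> xs = ys"
    using assms
  proof (induction xs ys rule: list_induct2)
    case Nil
    show ?case
      by (intro exI[of _ id]) (simp add: renaming_def bij_def)
  next
    case (Cons x xs y ys)
    then obtain \<pi> where \<pi>: "renaming \<pi>" "map \<pi> xs = ys"
      by auto
    \<comment> \<open>The swap corrects the image of \<open>x\<close> to \<open>y\<close> and fixes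
      the entries of \<open>ys\<close>: \<open>\<pi> x\<close> is not among them by injectivity,
      \<open>y\<close> is not by distinctness.\<close>
    let ?\<pi> = "transpose (\<pi> x) y \<circ> \<pi>"
    have "inj \<pi>"
      using \<pi>(1) by (simp add: renaming_def bij_is_inj)
    have "\<pi> x \<notin> set ys"
      unfolding \<pi>(2)[symmetric] set_map
      using Cons.prems(1) by (simp add: inj_image_mem_iff[OF \<open>inj \<pi>\<close>])
    then have "transpose (\<pi> x) y z = z" if "z \<in> set ys" for z
      using that Cons.prems(2) by (auto simp: transpose_def)
    then have "map ?\<pi> xs = ys"
      using \<pi>(2) by (metis map_idI map_map)
    moreover have "renaming ?\<pi>"
      unfolding renaming_def
    proof
      show "bij ?\<pi>"
        using \<pi>(1) by (intro bij_comp) (simp_all add: renaming_def)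
      have "var_sort L (\<pi> x) = var_sort L y"
        using \<pi>(1) Cons.prems(3) by (simp add: renaming_def)
      then have "var_sort L (transpose (\<pi> x) y z) = var_sort L z" for z
        by (simp add: transpose_def)
      then show "\<forall>z. var_sort L (?\<pi> z) = var_sort L z"
        using \<pi>(1) by (simp add: renaming_def)
    qed
    ultimately show ?case
      by (intro exI[of _ ?\<pi>]) (simp add: o_def)
  qed
  then show ?thesis
    using that by blast
qed

lemma renaming_linear:
  assumes "linear s" "linear t" "skel s = skel t"
  obtains \<pi> where "renaming \<pi>" "map_trm id \<pi> s = t"
proof -
  have "map (var_sort L) (vars_list s) = map (var_sort L) (vars_list t)"
    using arg_cong[OF assms(3), of vars_list] by (simp add: vars_list_map_trm)
  then obtain \<pi> where \<pi>: "renaming \<pi>" "map \<pi> (vars_list s) = vars_list t"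
    using renaming_lists assms(1,2) unfolding linear_def by blast
  have "skel (map_trm id \<pi> s) = skel s"
    using \<pi>(1) by (simp add: trm.map_comp renaming_def o_def id_def)
  then have "map_trm id \<pi> s = t"
    using \<pi>(2) assms(3) by (intro trm_eqI[of "var_sort L" _ "var_sort L"]) (simp_all add: vars_list_map_trm)
  then show ?thesis
    using \<pi>(1) that by blast
qed

lemma renaming_comp: "renaming \<pi> \<Longrightarrow> renaming \<pi>' \<Longrightarrow> renaming (\<pi> \<circ> \<pi>')"
  by (auto simp: renaming_def bij_comp)

lemma renaming_inv: "renaming \<pi> \<Longrightarrow> renaming (inv \<pi>)"
  by (metis bij_imp_bij_inv bij_inv_eq_iff renaming_def)

lemma renaming_inv_simps [simp]:
  assumes "renaming \<pi>"
  shows "inv \<pi> (\<pi> x) = x" "\<pi> (inv \<pi> x) = x"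
  using assms by (simp_all add: renaming_def bij_is_inj bij_is_surj surj_f_inv_f)

lemma has_sort_rename: "renaming \<pi> \<Longrightarrow> has_sort L t \<iota> \<Longrightarrow> has_sort L (map_trm id \<pi> t) \<iota>"
  unfolding map_trm_subst by (rule has_sort_subst) (simp_all add: renaming_def)

lemma funs_rename [simp]: "funs (map_trm id \<pi> t) = funs t"
  by (induction t) auto

lemma depth_le_rename: "depth_le n t \<Longrightarrow> depth_le n (map_trm id \<pi> t)"
  by (induction n t rule: depth_le.induct) auto

lemma is_pattern_rename:
  assumes "renaming \<pi>" "is_pattern L t"
  shows "is_pattern L (map_trm id \<pi> t)"
proof -
  obtain g ts where t: "t = Fun g ts" "g \<in> defined_syms L"
      "set ts \<subseteq> terms_over L (constructors L)" "t \<in> terms_over L UNIV"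
    using assms(2) by (auto simp: is_pattern_def)
  have "map_trm id \<pi> t \<in> terms_over L UNIV"
    using t(4) has_sort_rename[OF assms(1)] by (auto simp: terms_over_def)
  moreover have "map_trm id \<pi> u \<in> terms_over L (constructors L)" if "u \<in> set ts" for u
    using t(3) has_sort_rename[OF assms(1)] that by (fastforce simp: terms_over_def)
  then have "set (map (map_trm id \<pi>) ts) \<subseteq> terms_over L (constructors L)"
    by auto
  ultimately show ?thesis
    using t by (auto simp: is_pattern_def)
qed


section \<open>Evaluation of constraints\<close>

lemma eval_subst: "eval L \<alpha> (t \<cdot> \<sigma>) = eval L (\<lambda>x. eval L \<alpha> (\<sigma> x)) t"
  by (induction t) (auto intro!: arg_cong[where f = "interp L _"])

lemma eval_cong: "(\<And>x. x \<in> vars t \<Longrightarrow> \<alpha> x = \<beta> x) \<Longrightarrow> eval L \<alpha> t = eval L \<beta> t"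
proof (induction t)
  case (Fun g ts)
  have "eval L \<alpha> t = eval L \<beta> t" if "t \<in> set ts" for t
    by (rule Fun.IH[OF that], rule Fun.prems) (use that in auto)
  then show ?case
    by (simp cong: map_cong)
qed simp

lemma theory_term_arg:
  assumes "has_sort L (Fun g ts) \<iota>" "funs (Fun g ts) \<subseteq> theory_syms L" "i < length ts"
  shows "has_sort L (ts ! i) (arg_sorts L g ! i)" "arg_sorts L g ! i \<in> theory_sorts L"
    "funs (ts ! i) \<subseteq> theory_syms L"
proof -
  show "has_sort L (ts ! i) (arg_sorts L g ! i)"
    using assms(1,3) by (simp add: list_all2_conv_all_nth)
  have "arg_sorts L g ! i \<in> set (arg_sorts L g)"
    using assms(1,3) by (auto dest: list_all2_lengthD)
  then show "arg_sorts L g ! i \<in> theory_sorts L"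
    using theory_syms_sorts[of g] assms(2) by auto
  show "funs (ts ! i) \<subseteq> theory_syms L"
    using assms(2) nth_mem[OF assms(3)] by auto
qed

lemma theory_term_var_sort:
  "has_sort L t \<iota> \<Longrightarrow> \<iota> \<in> theory_sorts L \<Longrightarrow> funs t \<subseteq> theory_syms L \<Longrightarrow> x \<in> vars t \<Longrightarrow>
     var_sort L x \<in> theory_sorts L"
proof (induction t arbitrary: \<iota>)
  case (Fun g ts)
  obtain i where i: "i < length ts" "x \<in> vars (ts ! i)"
    using Fun.prems(4) by (auto simp: in_set_conv_nth)
  then show ?case
    using Fun.IH[OF nth_mem[OF i(1)]] theory_term_arg[OF Fun.prems(1,3) i(1)] by blast
qed simp

lemma eval_universe:
  "has_sort L t \<iota> \<Longrightarrow> \<iota> \<in> theory_sorts L \<Longrightarrow> funs t \<subseteq> theory_syms L \<Longrightarrow> valuation L \<alpha> \<Longrightarrow>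
     eval L \<alpha> t \<in> universe L \<iota>"
proof (induction t arbitrary: \<iota>)
  case (Fun g ts)
  have "eval L \<alpha> (ts ! i) \<in> universe L (arg_sorts L g ! i)" if i: "i < length ts" for i
    using Fun.IH[OF nth_mem[OF i]] theory_term_arg[OF Fun.prems(1,3) i] Fun.prems(4) by blast
  then have "list_all2 (\<lambda>u \<iota>. u \<in> universe L \<iota>) (map (eval L \<alpha>) ts) (arg_sorts L g)"
    using Fun.prems(1) by (simp add: list_all2_conv_all_nth)
  then show ?case
    using interp_sorts[of g] Fun.prems by simp
qed (simp add: valuation_def)

text \<open>An arbitrary valuation. It stands in for the \<open>undefined\<close> assignment of
  \<open>respects_c\<close>, under which a term with variables need not evaluate into the
  universes.\<close>

definition dflt :: "'v \<Rightarrow> 'u" where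
  "dflt x = (SOME e. e \<in> universe L (var_sort L x))"

lemma valuation_dflt: "valuation L dflt"
  using universe_nonempty by (auto simp: valuation_def dflt_def some_in_eq)

text \<open>The argument \<open>dflt\<close> matters only for variables that \<open>\<sigma>\<close> does not map to ground terms.\<close>

definition valn :: "('f, 'v) sub \<Rightarrow> 'v \<Rightarrow> 'u" where
  "valn \<sigma> x = eval L dflt (\<sigma> x)"

text \<open>The truth half of \<open>respects_c\<close>. The other half, that constraint variables
  become values, is automatic for deep instances when these variables occur in the term.\<close>

definition holds :: "('f, 'v) sub \<Rightarrow> ('f, 'v) trm \<Rightarrow> bool" where
  "holds \<sigma> \<psi> \<longleftrightarrow> eval L (valn \<sigma>) \<psi> = bool_elt L True"

lemma holds_cong: "(\<And>x. x \<in> vars \<psi> \<Longrightarrow> \<sigma> x = \<tau> x) \<Longrightarrow> holds \<sigma> \<psi> \<longleftrightarrow> holds \<tau> \<psi>"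
  unfolding holds_def valn_def by (subst eval_cong) auto

lemma holds_subst: "holds \<delta> (\<psi> \<cdot> \<sigma>) \<longleftrightarrow> holds (\<lambda>x. \<sigma> x \<cdot> \<delta>) \<psi>"
  by (simp add: holds_def valn_def[abs_def] eval_subst)

lemma is_constraint_iff:
  "is_constraint L \<phi> \<longleftrightarrow> has_sort L \<phi> (bool_sort L) \<and> funs \<phi> \<subseteq> theory_syms L"
  by (auto simp: is_constraint_def terms_over_def)

lemma constraint_var_sort: "is_constraint L \<psi> \<Longrightarrow> x \<in> vars \<psi> \<Longrightarrow> var_sort L x \<in> theory_sorts L"
  using theory_term_var_sort bool_theory by (auto simp: is_constraint_iff)

lemma respects_iff:
  "respects_c L \<sigma> \<psi> \<longleftrightarrow> (\<forall>x\<in>vars \<psi>. \<sigma> x \<in> value_terms L) \<and> holds \<sigma> \<psi>"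
proof -
  have "eval L (\<lambda>_. undefined) (\<psi> \<cdot> \<sigma>) = eval L (valn \<sigma>) \<psi>"
    if "\<forall>x\<in>vars \<psi>. \<sigma> x \<in> value_terms L"
    unfolding eval_subst using that by (intro eval_cong) (auto simp: value_terms_def valn_def)
  then show ?thesis
    by (auto simp: respects_c_def holds_def)
qed

text \<open>The notion of constructor substitution localised to \<open>V\<close>: instances depend
  only on the variables of the term, and factors obtained from unifiers or matchers may use other
  symbols elsewhere.\<close>

definition csub :: "'v set \<Rightarrow> ('f, 'v) sub \<Rightarrow> bool" where
  "csub V \<sigma> \<longleftrightarrow> (\<forall>x\<in>V. has_sort L (\<sigma> x) (var_sort L x) \<and> funs (\<sigma> x) \<subseteq> constructors L)"

lemma csubD:
  assumes "csub V \<sigma>" "x \<in> V"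
  shows "has_sort L (\<sigma> x) (var_sort L x)" "funs (\<sigma> x) \<subseteq> constructors L"
  using assms by (simp_all add: csub_def)

lemma is_csubst_iff: "is_csubst L \<sigma> \<longleftrightarrow> csub UNIV \<sigma>"
  by (auto simp: is_csubst_def is_subst_def csub_def terms_over_def)

lemma csub_mono: "csub V \<sigma> \<Longrightarrow> W \<subseteq> V \<Longrightarrow> csub W \<sigma>"
  by (auto simp: csub_def)

lemma value_term_universe: "t \<in> value_terms L \<Longrightarrow> has_sort L t \<iota> \<Longrightarrow> eval L \<alpha> t \<in> universe L \<iota>"
  using interp_sorts vals_symbol by (fastforce simp: value_terms_def)

lemma csub_valn_universe:
  assumes "csub V \<sigma>" "x \<in> V" "var_sort L x \<in> theory_sorts L"
  shows "valn \<sigma> x \<in> universe L (var_sort L x)"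
proof -
  consider z where "\<sigma> x = Var z" | "\<sigma> x \<in> value_terms L"
    using theory_sort_cterm csubD[OF assms(1,2)] assms(3) by blast
  then show ?thesis
  proof cases
    case 1
    then show ?thesis
      using csubD(1)[OF assms(1,2)] assms(3) valuation_dflt by (simp add: valn_def valuation_def)
  next
    case 2
    then show ?thesis
      using value_term_universe csubD(1)[OF assms(1,2)] by (simp add: valn_def)
  qed
qed

text \<open>Evaluation stays in the universe of \<open>bool_sort\<close>, which consists of the two
  truth values, so a constraint that is not true is false. Exactness of negation rests on
  this.\<close>

lemma constraint_false:
  assumes "is_constraint L \<psi>" "csub (vars \<psi>) \<sigma>" "\<not> holds \<sigma> \<psi>"
  shows "eval L (valn \<sigma>) \<psi> = bool_elt L False"
proof -
  \<comment> \<open>Sorts are known only on the variables of \<open>\<psi>\<close>; elsewhere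
    \<open>dflt\<close> completes the assignment to a valuation without changing the result.\<close>
  let ?\<alpha> = "\<lambda>x. if x \<in> vars \<psi> then valn \<sigma> x else dflt x"
  have "valuation L ?\<alpha>"
    using csub_valn_universe[OF assms(2)] valuation_dflt by (auto simp: valuation_def)
  then have "eval L ?\<alpha> \<psi> \<in> universe L (bool_sort L)"
    using assms(1) bool_theory by (intro eval_universe) (auto simp: is_constraint_iff)
  moreover have "eval L ?\<alpha> \<psi> = eval L (valn \<sigma>) \<psi>"
    by (rule eval_cong) simp
  ultimately obtain b where "eval L (valn \<sigma>) \<psi> = bool_elt L b"
    using bool_universe by auto
  then show ?thesis
    using assms(3) by (cases b) (auto simp: holds_def)
qed

lemma holds_not:
  assumes "is_constraint L \<psi>" "csub (vars \<psi>) \<sigma>"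
  shows "holds \<sigma> (not_c L \<psi>) \<longleftrightarrow> \<not> holds \<sigma> \<psi>"
proof (cases "holds \<sigma> \<psi>")
  case True
  then show ?thesis
    using interp_not[of True] bool_inj by (auto simp: holds_def dest: injD)
next
  case False
  then show ?thesis
    using interp_not[of False] constraint_false[OF assms] by (auto simp: holds_def)
qed

lemma holds_and:
  assumes "is_constraint L \<phi>" "is_constraint L \<psi>" "csub (vars \<phi> \<union> vars \<psi>) \<sigma>"
  shows "holds \<sigma> (and_c L \<phi> \<psi>) \<longleftrightarrow> holds \<sigma> \<phi> \<and> holds \<sigma> \<psi>"
proof -
  have "eval L (valn \<sigma>) \<chi> = bool_elt L (holds \<sigma> \<chi>)" if "\<chi> \<in> {\<phi>, \<psi>}" for \<chi>
  proof (cases "holds \<sigma> \<chi>")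
    case True
    then show ?thesis by (simp add: holds_def)
  next
    case False
    have "csub (vars \<chi>) \<sigma>"
      using assms(3) that by (auto intro: csub_mono)
    then show ?thesis
      using constraint_false[of \<chi> \<sigma>] False assms(1,2) that by auto
  qed
  from this[of \<phi>] this[of \<psi>]
  have "eval L (valn \<sigma>) (and_c L \<phi> \<psi>) = bool_elt L (holds \<sigma> \<phi> \<and> holds \<sigma> \<psi>)"
    by (simp add: interp_and)
  then show ?thesis
    by (simp only: holds_def[of \<sigma> "and_c L \<phi> \<psi>"] inj_eq[OF bool_inj] eq_True)
qed

lemma is_constraint_connectives:
  "is_constraint L (true_c L)"
  "is_constraint L \<phi> \<Longrightarrow> is_constraint L (not_c L \<phi>)"
  "is_constraint L \<phi> \<Longrightarrow> is_constraint L \<psi> \<Longrightarrow> is_constraint L (and_c L \<phi> \<psi>)"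
  using not_sorts connectives_sorts[of "and_sym L"] connectives_theory true_sym
    values_sorts[OF bool_theory] values_theory[OF bool_theory]
  by (auto simp: is_constraint_iff)


section \<open>Instances of constrained terms\<close>

text \<open>\<open>GC1\<close> with groundness weakened to \<open>deep n\<close>. Exactness of
  differences and the termination count are both phrased with these sets.\<close>

definition inst :: "nat \<Rightarrow> ('f, 'v) cterm \<Rightarrow> ('f, 'v) trm set" where
  "inst n p = (case p of (t, \<psi>) \<Rightarrow>
     {t \<cdot> \<sigma> |\<sigma>. is_csubst L \<sigma> \<and> respects_c L \<sigma> \<psi> \<and> deep n (t \<cdot> \<sigma>)})"

text \<open>True for every \<open>n\<close>, as a ground term has no variables for
  \<open>deep\<close> to restrict. Hence the depth fixed for termination also serves to read off the
  ground instances.\<close>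

lemma GC1_inst: "GC1 L p = {u \<in> inst n p. ground u}"
  by (cases p) (auto simp: GC1_def inst_def vars_subst ground_deep)

lemma csub_deep_value:
  assumes "csub V \<sigma>" "x \<in> V" "var_sort L x \<in> theory_sorts L" "deep n (t \<cdot> \<sigma>)" "x \<in> vars t"
  shows "\<sigma> x \<in> value_terms L"
proof -
  have "\<sigma> x \<noteq> Var z" for z
  proof
    assume z: "\<sigma> x = Var z"
    then have "z \<in> vars (t \<cdot> \<sigma>)"
      using assms(5) by (force simp: vars_subst)
    then have "var_sort L z \<notin> theory_sorts L"
      using assms(4) by (intro deep_var_sort)
    then show False
      using csubD(1)[OF assms(1,2)] z assms(3) by simp
  qed
  then show ?thesis
    using theory_sort_cterm csubD[OF assms(1,2)] assms(3) by blast
qed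

text \<open>
  Only the values of \<open>\<sigma>\<close> at the variables of \<open>t\<close> matter in this description, which makes it
  invariant under \<open>doteq\<close>.
\<close>

lemma in_inst:
  assumes "is_constraint L \<psi>"
  shows "u \<in> inst n (t, \<psi>) \<longleftrightarrow>
    (\<exists>\<sigma>. u = t \<cdot> \<sigma> \<and> csub (vars t) \<sigma> \<and> deep n u \<and> ex_closure L (vars t) \<psi> (valn \<sigma>))"
proof
  assume "u \<in> inst n (t, \<psi>)"
  then obtain \<sigma> where \<sigma>: "u = t \<cdot> \<sigma>" "csub UNIV \<sigma>" "holds \<sigma> \<psi>" "deep n u"
    by (auto simp: inst_def is_csubst_iff respects_iff)
  have "valuation L (valn \<sigma>)"
    using csub_valn_universe[OF \<sigma>(2)] by (simp add: valuation_def)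
  then have "ex_closure L (vars t) \<psi> (valn \<sigma>)"
    using \<sigma>(3) by (auto simp: ex_closure_def holds_def)
  then show "\<exists>\<sigma>. u = t \<cdot> \<sigma> \<and> csub (vars t) \<sigma> \<and> deep n u \<and> ex_closure L (vars t) \<psi> (valn \<sigma>)"
    using \<sigma> csub_mono by blast
next
  assume "\<exists>\<sigma>. u = t \<cdot> \<sigma> \<and> csub (vars t) \<sigma> \<and> deep n u \<and> ex_closure L (vars t) \<psi> (valn \<sigma>)"
  then obtain \<sigma> \<beta> where \<sigma>: "u = t \<cdot> \<sigma>" "csub (vars t) \<sigma>" "deep n u"
      and \<beta>: "valuation L \<beta>" "\<And>x. x \<in> vars t \<Longrightarrow> \<beta> x = valn \<sigma> x" "eval L \<beta> \<psi> = bool_elt L True"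
    by (auto simp: ex_closure_def)
  \<comment> \<open>The assignment \<open>\<beta>\<close> yields elements, which have to be realised
    by terms: value constants for theory sorts, and any constructor term for the other sorts, whose
    variables occur in no constraint.\<close>
  have "\<exists>w. has_sort L w (var_sort L x) \<and> funs w \<subseteq> constructors L \<and>
      (var_sort L x \<in> theory_sorts L \<longrightarrow> w \<in> value_terms L \<and> eval L dflt w = \<beta> x)" for x
  proof (cases "var_sort L x \<in> theory_sorts L")
    case True
    then obtain v where "v \<in> vals L" "res_sort L v = var_sort L x" "interp L v [] = \<beta> x"
      using value_exists \<beta>(1) unfolding valuation_def by blast
    then show ?thesis
      using vals_symbol[of v] by (intro exI[of _ "Fun v []"]) (auto simp: value_terms_def)
  next
    case False
    then show ?thesis
      using deep_term_exists by blast
  qed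
  then obtain \<omega> where \<omega>: "\<And>x. has_sort L (\<omega> x) (var_sort L x)" "\<And>x. funs (\<omega> x) \<subseteq> constructors L"
      "\<And>x. var_sort L x \<in> theory_sorts L \<Longrightarrow> \<omega> x \<in> value_terms L \<and> eval L dflt (\<omega> x) = \<beta> x"
    by metis
  let ?\<sigma> = "\<lambda>x. if x \<in> vars t then \<sigma> x else \<omega> x"
  have "csub UNIV ?\<sigma>"
    using \<sigma>(2) \<omega> by (simp add: csub_def)
  moreover have "u = t \<cdot> ?\<sigma>"
    unfolding \<sigma>(1) by (rule subst_cong) simp
  moreover have "?\<sigma> x \<in> value_terms L" if "x \<in> vars \<psi>" for x
    using csub_deep_value[OF \<sigma>(2)] \<omega>(3) \<sigma> constraint_var_sort[OF assms that] by auto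
  moreover have "eval L (valn ?\<sigma>) \<psi> = eval L \<beta> \<psi>"
    using \<beta>(2) \<omega>(3) constraint_var_sort[OF assms] by (intro eval_cong) (auto simp: valn_def)
  ultimately show "u \<in> inst n (t, \<psi>)"
    using \<sigma>(3) \<beta>(3) by (auto simp: inst_def is_csubst_iff respects_iff holds_def)
qed

lemma ex_closure_cong:
  "(\<And>x. x \<in> V \<Longrightarrow> \<alpha> x = \<beta> x) \<Longrightarrow> ex_closure L V \<psi> \<alpha> \<longleftrightarrow> ex_closure L V \<psi> \<beta>"
  by (simp add: ex_closure_def)

text \<open>When all constraint variables occur in the term, the existential closure has nothing
  left to quantify. Only in this form does negating the constraint describe the remaining
  instances.\<close>

lemma in_inst_closed:
  assumes "is_constraint L \<psi>" "vars \<psi> \<subseteq> vars t"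
  shows "u \<in> inst n (t, \<psi>) \<longleftrightarrow> (\<exists>\<sigma>. u = t \<cdot> \<sigma> \<and> csub (vars t) \<sigma> \<and> deep n u \<and> holds \<sigma> \<psi>)"
proof -
  have "ex_closure L (vars t) \<psi> (valn \<sigma>) \<longleftrightarrow> holds \<sigma> \<psi>" if "csub (vars t) \<sigma>" for \<sigma>
  proof
    assume "ex_closure L (vars t) \<psi> (valn \<sigma>)"
    then obtain \<beta> where "\<forall>x\<in>vars t. \<beta> x = valn \<sigma> x" "eval L \<beta> \<psi> = bool_elt L True"
      by (auto simp: ex_closure_def)
    moreover from this(1) have "eval L \<beta> \<psi> = eval L (valn \<sigma>) \<psi>"
      using assms(2) by (intro eval_cong) blast
    ultimately show "holds \<sigma> \<psi>"
      by (simp add: holds_def)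
  next
    assume h: "holds \<sigma> \<psi>"
    let ?\<beta> = "\<lambda>x. if x \<in> vars t then valn \<sigma> x else dflt x"
    have "valuation L ?\<beta>"
      using csub_valn_universe[OF that] valuation_dflt by (simp add: valuation_def)
    moreover have "eval L ?\<beta> \<psi> = eval L (valn \<sigma>) \<psi>"
      using assms(2) by (intro eval_cong) auto
    ultimately show "ex_closure L (vars t) \<psi> (valn \<sigma>)"
      using h by (auto simp: ex_closure_def holds_def intro!: exI[of _ ?\<beta>])
  qed
  then show ?thesis
    by (auto simp: in_inst[OF assms(1)])
qed


section \<open>Classes of constrained terms\<close>

lemma ex_closure_rename:
  assumes "renaming \<pi>"
  shows "ex_closure L (\<pi> ` V) (map_trm id \<pi> \<phi>) \<alpha> \<longleftrightarrow> ex_closure L V \<phi> (\<alpha> \<circ> \<pi>)"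
proof
  assume "ex_closure L (\<pi> ` V) (map_trm id \<pi> \<phi>) \<alpha>"
  then obtain \<beta> where "valuation L \<beta>" "\<forall>x\<in>V. \<beta> (\<pi> x) = \<alpha> (\<pi> x)"
      "eval L \<beta> (map_trm id \<pi> \<phi>) = bool_elt L True"
    by (auto simp: ex_closure_def)
  then show "ex_closure L V \<phi> (\<alpha> \<circ> \<pi>)"
    using assms unfolding ex_closure_def
    by (intro exI[of _ "\<beta> \<circ> \<pi>"])
      (simp add: map_trm_subst eval_subst valuation_def renaming_def o_def, metis)
next
  assume "ex_closure L V \<phi> (\<alpha> \<circ> \<pi>)"
  then obtain \<beta> where \<beta>: "valuation L \<beta>" "\<forall>x\<in>V. \<beta> x = \<alpha> (\<pi> x)" "eval L \<beta> \<phi> = bool_elt L True"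
    by (auto simp: ex_closure_def)
  have "valuation L (\<beta> \<circ> inv \<pi>)"
    using \<beta>(1) renaming_inv[OF assms] unfolding valuation_def renaming_def o_def by metis
  then show "ex_closure L (\<pi> ` V) (map_trm id \<pi> \<phi>) \<alpha>"
    using \<beta>(2,3) assms unfolding ex_closure_def
    by (intro exI[of _ "\<beta> \<circ> inv \<pi>"]) (simp add: map_trm_subst eval_subst)
qed

text \<open>The quantifier may range over all assignments: one that agrees with no valuation on the
  variables of the term makes both closures false, and any other can be replaced by a valuation that
  agrees with it there.\<close>

lemma doteq_iff:
  "((s, \<phi>), (t, \<psi>)) \<in> doteq L \<longleftrightarrow> (s, \<phi>) \<in> cterms L \<and> (t, \<psi>) \<in> cterms L \<and>
     (\<exists>\<pi>. renaming \<pi> \<and> map_trm id \<pi> s = t \<and>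
       (\<forall>\<alpha>. ex_closure L (vars t) \<psi> \<alpha> = ex_closure L (vars s) \<phi> (\<alpha> \<circ> \<pi>)))"
proof -
  have "(\<forall>\<alpha>. valuation L \<alpha> \<longrightarrow> ex_closure L V \<phi>' \<alpha> = ex_closure L V \<psi> \<alpha>) \<longleftrightarrow>
      (\<forall>\<alpha>. ex_closure L V \<psi> \<alpha> = ex_closure L V \<phi>' \<alpha>)" for V \<phi>'
  proof (rule iffI, rule allI)
    fix \<alpha>
    assume *: "\<forall>\<alpha>. valuation L \<alpha> \<longrightarrow> ex_closure L V \<phi>' \<alpha> = ex_closure L V \<psi> \<alpha>"
    have "\<exists>\<beta>. valuation L \<beta> \<and> (\<forall>x\<in>V. \<alpha> x = \<beta> x)" if "ex_closure L V \<chi> \<alpha>" for \<chi>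
      using that by (force simp: ex_closure_def)
    then show "ex_closure L V \<psi> \<alpha> = ex_closure L V \<phi>' \<alpha>"
      using * ex_closure_cong[of V \<alpha>] by metis
  qed simp
  note * = this
  have eq: "(\<forall>\<alpha>. valuation L \<alpha> \<longrightarrow>
        ex_closure L (vars t) (map_trm id \<pi> \<phi>) \<alpha> = ex_closure L (vars t) \<psi> \<alpha>) \<longleftrightarrow>
      (\<forall>\<alpha>. ex_closure L (vars t) \<psi> \<alpha> = ex_closure L (vars s) \<phi> (\<alpha> \<circ> \<pi>))"
    if "renaming \<pi>" "map_trm id \<pi> s = t" for \<pi>
  proof -
    have "vars t = \<pi> ` vars s"
      using that(2) by (auto simp: trm.set_map)
    then show ?thesis
      using *[of "vars t" "map_trm id \<pi> \<phi>"] ex_closure_rename[OF that(1), of "vars s" \<phi>]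
      by (simp only:)
  qed
  have "((s, \<phi>), (t, \<psi>)) \<in> doteq L \<longleftrightarrow> (s, \<phi>) \<in> cterms L \<and> (t, \<psi>) \<in> cterms L \<and>
     (\<exists>\<pi>. renaming \<pi> \<and> map_trm id \<pi> s = t \<and> (\<forall>\<alpha>. valuation L \<alpha> \<longrightarrow>
        ex_closure L (vars t) (map_trm id \<pi> \<phi>) \<alpha> = ex_closure L (vars t) \<psi> \<alpha>))"
    by (simp only: doteq_def renaming_def mem_Collect_eq case_prod_conv conj_assoc)
  then show ?thesis
    using eq by blast
qed

lemma equiv_doteq: "equiv (cterms L) (doteq L)"
proof (rule equivI)
  show "refl_on (cterms L) (doteq L)"
  proof (rule refl_onI)
    fix p :: "('f, 'v) cterm"
    assume "p \<in> cterms L"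
    moreover obtain t \<psi> where "p = (t, \<psi>)"
      by fastforce
    moreover have "renaming id"
      by (simp add: renaming_def bij_def)
    ultimately show "(p, p) \<in> doteq L"
      by (auto simp: doteq_iff trm.map_id intro!: exI[of _ id])
  qed
  show "doteq L \<subseteq> cterms L \<times> cterms L"
    by (auto simp: doteq_iff)
  show "sym (doteq L)"
  proof (rule symI)
    fix p q :: "('f, 'v) cterm"
    assume *: "(p, q) \<in> doteq L"
    obtain s \<phi> t \<psi> where pq: "p = (s, \<phi>)" "q = (t, \<psi>)"
      by fastforce
    then obtain \<pi> where \<pi>: "renaming \<pi>" "map_trm id \<pi> s = t"
        "\<And>\<alpha>. ex_closure L (vars t) \<psi> \<alpha> = ex_closure L (vars s) \<phi> (\<alpha> \<circ> \<pi>)"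
      using * by (auto simp: doteq_iff)
    have "map_trm id (inv \<pi>) t = s"
      using \<pi>(1) by (simp add: \<pi>(2)[symmetric] map_trm_subst subst_subst)
    moreover have "\<alpha> \<circ> inv \<pi> \<circ> \<pi> = \<alpha>" for \<alpha> :: "'v \<Rightarrow> 'u"
      using \<pi>(1) by (simp add: fun_eq_iff)
    ultimately show "(q, p) \<in> doteq L"
      using * pq renaming_inv[OF \<pi>(1)] \<pi>(3) by (auto simp: doteq_iff)
  qed
  show "trans (doteq L)"
  proof (rule transI)
    fix p q r :: "('f, 'v) cterm"
    assume *: "(p, q) \<in> doteq L" "(q, r) \<in> doteq L"
    obtain s \<phi> t \<psi> u \<chi> where pqr: "p = (s, \<phi>)" "q = (t, \<psi>)" "r = (u, \<chi>)"
      by (metis prod.exhaust)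
    then obtain \<pi> \<rho> where \<pi>: "renaming \<pi>" "map_trm id \<pi> s = t"
          "\<And>\<alpha>. ex_closure L (vars t) \<psi> \<alpha> = ex_closure L (vars s) \<phi> (\<alpha> \<circ> \<pi>)"
        and \<rho>: "renaming \<rho>" "map_trm id \<rho> t = u"
          "\<And>\<alpha>. ex_closure L (vars u) \<chi> \<alpha> = ex_closure L (vars t) \<psi> (\<alpha> \<circ> \<rho>)"
      using * by (auto simp: doteq_iff)
    have "map_trm id (\<rho> \<circ> \<pi>) s = u"
      by (simp add: \<pi>(2)[symmetric] \<rho>(2)[symmetric] map_trm_subst subst_subst)
    moreover have "\<forall>\<alpha>. ex_closure L (vars u) \<chi> \<alpha> = ex_closure L (vars s) \<phi> (\<alpha> \<circ> (\<rho> \<circ> \<pi>))"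
      by (simp add: \<pi>(3) \<rho>(3) comp_assoc)
    ultimately show "(p, r) \<in> doteq L"
      using * pqr renaming_comp[OF \<rho>(1) \<pi>(1)] unfolding doteq_iff pqr by blast
  qed
qed

lemma doteq_inst_subset:
  assumes "(p, q) \<in> doteq L"
  shows "inst n p \<subseteq> inst n q"
proof -
  obtain s \<phi> t \<psi> where pq: "p = (s, \<phi>)" "q = (t, \<psi>)"
    by fastforce
  then obtain \<pi> where \<pi>: "renaming \<pi>" "map_trm id \<pi> s = t"
      "\<And>\<alpha>. ex_closure L (vars t) \<psi> \<alpha> = ex_closure L (vars s) \<phi> (\<alpha> \<circ> \<pi>)"
    using assms by (auto simp: doteq_iff)
  have con: "is_constraint L \<phi>" "is_constraint L \<psi>"
    using assms pq by (auto simp: doteq_iff cterms_def)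
  show ?thesis
  proof
    fix u
    assume "u \<in> inst n p"
    then obtain \<sigma> where \<sigma>: "u = s \<cdot> \<sigma>" "csub (vars s) \<sigma>" "deep n u"
        "ex_closure L (vars s) \<phi> (valn \<sigma>)"
      using pq con by (auto simp: in_inst)
    let ?\<tau> = "\<sigma> \<circ> inv \<pi>"
    have "u = t \<cdot> ?\<tau>"
      using \<sigma>(1) \<pi>(1) by (simp add: \<pi>(2)[symmetric] map_trm_subst subst_subst)
    moreover have "vars t = \<pi> ` vars s"
      by (auto simp: \<pi>(2)[symmetric] trm.set_map)
    then have "csub (vars t) ?\<tau>"
      using \<sigma>(2) \<pi>(1) by (auto simp: csub_def renaming_def[of \<pi>] bij_is_inj)
    moreover have "valn ?\<tau> \<circ> \<pi> = valn \<sigma>"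
      using \<pi>(1) by (simp add: fun_eq_iff valn_def)
    ultimately show "u \<in> inst n q"
      unfolding pq(2) in_inst[OF con(2)] using \<sigma>(3,4) \<pi>(3)[of "valn ?\<tau>"] by auto
  qed
qed

lemma doteq_inst: "(p, q) \<in> doteq L \<Longrightarrow> inst n p = inst n q"
  using doteq_inst_subset equiv_doteq by (meson equivE subset_antisym symD)

definition ok :: "nat \<Rightarrow> ('f, 'v) cterm \<Rightarrow> bool" where
  "ok n p \<longleftrightarrow> p \<in> cterms L \<and> is_pattern L (fst p) \<and> linear (fst p) \<and> value_free L (fst p) \<and>
     depth_le n (fst p)"

lemma doteq_ok:
  assumes "(p, q) \<in> doteq L" "ok n p"
  shows "ok n q"
proof -
  obtain s \<phi> t \<psi> where pq: "p = (s, \<phi>)" "q = (t, \<psi>)"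
    by fastforce
  then obtain \<pi> where \<pi>: "renaming \<pi>" "map_trm id \<pi> s = t"
    using assms(1) by (auto simp: doteq_iff)
  have "inj_on \<pi> (vars s)"
    using \<pi>(1) by (auto simp: renaming_def bij_def intro: inj_on_subset)
  then have "linear t"
    using assms(2) pq by (simp add: ok_def \<pi>(2)[symmetric] linear_map_trm)
  moreover have "funs t = funs s"
    by (simp add: \<pi>(2)[symmetric])
  ultimately show ?thesis
    using assms pq \<pi>(2) is_pattern_rename[OF \<pi>(1), of s] depth_le_rename[of n s \<pi>]
    by (auto simp: ok_def doteq_iff value_free_def)
qed

text \<open>\<open>ok\<close> is invariant under \<open>doteq\<close> and so is demanded of every
  representative. Closedness is not, since an equivalent constraint may mention further variables;
  one closed representative is demanded.\<close>

definition okc :: "nat \<Rightarrow> ('f, 'v) cclass \<Rightarrow> bool" where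
  "okc n c \<longleftrightarrow> c \<in> cclasses L \<and> (\<forall>p\<in>c. ok n p) \<and> (\<exists>p\<in>c. cvars_closed p)"

definition cinst :: "nat \<Rightarrow> ('f, 'v) cclass \<Rightarrow> ('f, 'v) trm set" where
  "cinst n c = (\<Union>p\<in>c. inst n p)"

lemma cclass_doteq:
  assumes "c \<in> cclasses L" "p \<in> c" "q \<in> c"
  shows "(p, q) \<in> doteq L"
  using assms equiv_doteq unfolding cclasses_def by (meson quotient_eq_iff)

lemma cclass_eq_cls:
  assumes "c \<in> cclasses L" "p \<in> c"
  shows "c = cls L p"
proof -
  obtain p0 where "c = doteq L `` {p0}"
    using assms(1) by (auto simp: cclasses_def elim: quotientE)
  then show ?thesis
    using assms(2) equiv_class_eq[OF equiv_doteq, of p0 p] by (simp add: cls_def)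
qed

lemma cinst_eq:
  assumes "c \<in> cclasses L" "p \<in> c"
  shows "cinst n c = inst n p"
proof -
  have "inst n q = inst n p" if "q \<in> c" for q
    by (rule doteq_inst, rule cclass_doteq[OF assms(1) that assms(2)])
  then show ?thesis
    unfolding cinst_def using assms(2) by blast
qed

lemma cls_cclass: "p \<in> cterms L \<Longrightarrow> cls L p \<in> cclasses L"
  unfolding cclasses_def cls_def by (rule quotientI)

lemma in_cls: "p \<in> cterms L \<Longrightarrow> p \<in> cls L p"
  unfolding cls_def using equiv_doteq by (rule equiv_class_self)

lemma cinst_cls: "p \<in> cterms L \<Longrightarrow> cinst n (cls L p) = inst n p"
  by (rule cinst_eq[OF cls_cclass in_cls])

lemma okc_cls: "ok n p \<Longrightarrow> cvars_closed p \<Longrightarrow> okc n (cls L p)"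
proof -
  assume p: "ok n p" "cvars_closed p"
  then have "p \<in> cterms L"
    by (simp add: ok_def)
  moreover have "ok n q" if "q \<in> cls L p" for q
    using that by (intro doteq_ok[OF _ p(1)]) (simp add: cls_def)
  ultimately show "okc n (cls L p)"
    using p(2) cls_cclass in_cls unfolding okc_def by blast
qed

lemma GC_cinst: "GC L P = {u \<in> (\<Union>c\<in>P. cinst n c). ground u}"
  by (auto simp: GC_def cinst_def GC1_inst[where n = n])

text \<open>Renaming the variables of one linear term away from the other representative moves its
  constraint along, because a closed constraint has no further variables.\<close>

lemma disjoint_representatives:
  assumes "okc n c" "okc n d"
  obtains p q where "p \<in> c" "q \<in> d" "cvars_closed p" "cvars_closed q"
    "(vars (fst p) \<union> vars (snd p)) \<inter> (vars (fst q) \<union> vars (snd q)) = {}"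
proof -
  obtain p where p: "p \<in> c" "cvars_closed p"
    using assms(1) by (auto simp: okc_def)
  obtain q where q: "q \<in> d" "cvars_closed q"
    using assms(2) by (auto simp: okc_def)
  obtain t \<psi> where t: "q = (t, \<psi>)"
    by fastforce
  have "ok n q"
    using assms(2) q(1) by (simp add: okc_def)
  then have "linear t" "q \<in> cterms L"
    by (simp_all add: ok_def t)
  obtain ys where ys: "distinct ys" "map (var_sort L) ys = map (var_sort L) (vars_list t)"
      "set ys \<inter> (vars (fst p) \<union> vars (snd p)) = {}"
    using fresh_variables[of "vars (fst p) \<union> vars (snd p)"] by auto
  obtain \<pi> where \<pi>: "renaming \<pi>" "map \<pi> (vars_list t) = ys"
    using renaming_lists[OF _ ys(1) ys(2)[symmetric]] \<open>linear t\<close> unfolding linear_def by blast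
  let ?q = "(map_trm id \<pi> t, map_trm id \<pi> \<psi>)"
  have "\<pi> ` vars t = set ys"
    using \<pi>(2)[symmetric] by simp
  then have vars: "vars (map_trm id \<pi> t) = set ys" "vars (map_trm id \<pi> \<psi>) \<subseteq> set ys"
    using q(2) t by (auto simp: trm.set_map cvars_closed_def)
  have "?q \<in> cterms L"
    using \<open>q \<in> cterms L\<close> has_sort_rename[OF \<pi>(1)]
    by (auto simp: t cterms_def terms_over_def is_constraint_iff)
  then have "(q, ?q) \<in> doteq L"
    using \<open>q \<in> cterms L\<close> \<pi>(1) ex_closure_rename[OF \<pi>(1), of "vars t" \<psi>]
    unfolding t doteq_iff by (auto simp: trm.set_map)
  then have "?q \<in> d"
    using cclass_eq_cls[of d q] assms(2) q(1) by (auto simp: okc_def cls_def)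
  moreover have "cvars_closed ?q"
    using vars by (simp add: cvars_closed_def)
  ultimately show ?thesis
    using p vars ys(3) that[of p ?q] by auto
qed

lemma cdiff_exists:
  assumes "okc n c" "okc n d"
  shows "\<exists>R. cdiff L c d R"
proof -
  obtain p q where "p \<in> c" "q \<in> d" "cvars_closed p" "cvars_closed q"
      "(vars (fst p) \<union> vars (snd p)) \<inter> (vars (fst q) \<union> vars (snd q)) = {}"
    using disjoint_representatives[OF assms] .
  moreover have "\<exists>R. if \<exists>\<sigma>. cunifier L \<sigma> p q
      then \<exists>\<sigma>. cunifier L \<sigma> p q \<and> R = cls L ` diff_pieces L \<sigma> p q else R = {c}"
    by (cases "\<exists>\<sigma>. cunifier L \<sigma> p q") auto
  ultimately show ?thesis
    unfolding cdiff_def by blast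
qed


section \<open>The difference of two patterns\<close>

lemma bindings_has_sort:
  "s \<cdot> \<tau> = t \<cdot> \<tau> \<Longrightarrow> has_sort L s \<iota> \<Longrightarrow> has_sort L t \<iota> \<Longrightarrow> (x, u) \<in> set (bindings s t) \<Longrightarrow>
     has_sort L u (var_sort L x)"
proof (induction s t arbitrary: \<iota> rule: bindings.induct)
  case (3 g us h ws)
  obtain u' w' where *: "(u', w') \<in> set (zip us ws)" "(x, u) \<in> set (bindings u' w')"
    using 3(5) by auto
  then obtain i where i: "i < length us" "i < length ws" "u' = us ! i" "w' = ws ! i"
    by (auto simp: set_zip)
  have gh: "g = h" and eq: "map (\<lambda>t. t \<cdot> \<tau>) us = map (\<lambda>t. t \<cdot> \<tau>) ws"
    using 3(2) by simp_all
  have "u' \<cdot> \<tau> = w' \<cdot> \<tau>"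
    using arg_cong[OF eq, of "\<lambda>ts. ts ! i"] i by simp
  moreover have "has_sort L u' (arg_sorts L g ! i)" "has_sort L w' (arg_sorts L g ! i)"
    using 3(3,4) i gh by (simp_all add: list_all2_conv_all_nth)
  ultimately show ?case
    using 3(1)[OF *(1) refl _ _ _ *(2)] by blast
qed auto

lemma okD:
  assumes "ok n (t, \<psi>)"
  obtains g ts where "t = Fun g ts" "g \<in> defined_syms L" "has_sort L t (res_sort L g)"
    "\<And>u. u \<in> set ts \<Longrightarrow> funs u \<subseteq> constructors L - vals L"
proof -
  obtain g ts where g: "t = Fun g ts" "g \<in> defined_syms L" "set ts \<subseteq> terms_over L (constructors L)"
    using assms by (auto simp: ok_def is_pattern_def)
  have "has_sort L t (res_sort L g)"
    using assms g(1) by (auto simp: ok_def is_pattern_def terms_over_def)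
  moreover have "funs u \<subseteq> constructors L - vals L" if "u \<in> set ts" for u
    using assms g that by (auto simp: ok_def value_free_def terms_over_def)
  ultimately show ?thesis
    using g that by blast
qed

lemma ok_constraint: "ok n (t, \<psi>) \<Longrightarrow> is_constraint L \<psi>"
  by (simp add: ok_def cterms_def)

lemma okI:
  assumes "is_constraint L \<psi>" "has_sort L (Fun g ts) (res_sort L g)" "g \<in> defined_syms L"
    and "\<And>u. u \<in> set ts \<Longrightarrow> funs u \<subseteq> constructors L - vals L"
    and "linear (Fun g ts)" "depth_le n (Fun g ts)"
  shows "ok n (Fun g ts, \<psi>)"
proof -
  have "\<exists>\<kappa>. has_sort L u \<kappa>" if "u \<in> set ts" for u
    using assms(2) that by (auto simp: in_set_conv_nth list_all2_conv_all_nth)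
  then have "set ts \<subseteq> terms_over L (constructors L)"
    using assms(4) by (auto simp: terms_over_def)
  moreover have "g \<notin> vals L"
    using assms(3) constructors_disjoint vals_symbol(4) by blast
  then have "value_free L (Fun g ts)"
    using assms(4) by (auto simp: value_free_def)
  moreover have "Fun g ts \<in> terms_over L UNIV"
    using assms(2) unfolding terms_over_def by blast
  ultimately show ?thesis
    using assms(1,3,5,6) unfolding ok_def is_pattern_def cterms_def by auto
qed

text \<open>Of the two forms of a constructor term of theory sort, value-freeness excludes the
  values. Applied to unifiers: constraint variables are sent to variables.\<close>

lemma theory_sort_value_free:
  assumes "has_sort L t \<iota>" "\<iota> \<in> theory_sorts L" "funs t \<subseteq> constructors L - vals L"
  obtains x where "t = Var x"
proof -
  have "t \<notin> value_terms L" "funs t \<subseteq> constructors L"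
    using assms(3) by (auto simp: value_terms_def)
  then show ?thesis
    using theory_sort_cterm[OF assms(1,2)] that by blast
qed

text \<open>Bindings relate subterms at the same position of both patterns, hence of the same sort,
  and take their symbols from below the defined root, hence value-free constructors.\<close>

lemma unify_patterns:
  assumes "ok n (s, \<phi>)" "ok n (t, \<psi>)" "vars s \<inter> vars t = {}" "s \<cdot> \<tau> = t \<cdot> \<tau>"
  obtains \<mu> where "is_mgu L \<mu> s t" "sdom \<mu> \<subseteq> vars s \<union> vars t"
    and "\<And>\<tau>' x. s \<cdot> \<tau>' = t \<cdot> \<tau>' \<Longrightarrow> \<mu> x \<cdot> \<tau>' = \<tau>' x"
    and "linear (s \<cdot> \<mu>)" "depth_le n (s \<cdot> \<mu>)"
    and "\<And>x. funs (\<mu> x) \<subseteq> constructors L - vals L"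
proof -
  have lin: "linear s" "linear t" "depth_le n s" "depth_le n t"
    using assms(1,2) by (simp_all add: ok_def)
  obtain g ss where s: "s = Fun g ss" "has_sort L s (res_sort L g)"
      "\<And>u. u \<in> set ss \<Longrightarrow> funs u \<subseteq> constructors L - vals L"
    using okD[OF assms(1)] by metis
  obtain h ts where t: "t = Fun h ts" "has_sort L t (res_sort L h)"
      "\<And>u. u \<in> set ts \<Longrightarrow> funs u \<subseteq> constructors L - vals L"
    using okD[OF assms(2)] by metis
  have "g = h"
    using assms(4) s(1) t(1) by simp
  obtain \<mu> where \<mu>: "s \<cdot> \<mu> = t \<cdot> \<mu>" "sdom \<mu> \<subseteq> vars s \<union> vars t"
      "\<And>\<tau>' x. s \<cdot> \<tau>' = t \<cdot> \<tau>' \<Longrightarrow> \<mu> x \<cdot> \<tau>' = \<tau>' x"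
      "linear (s \<cdot> \<mu>)" "\<And>n. depth_le n s \<Longrightarrow> depth_le n t \<Longrightarrow> depth_le n (s \<cdot> \<mu>)"
      "\<And>x. \<mu> x = Var x \<or> (\<exists>u. (x, u) \<in> set (bindings s t) \<and> \<mu> x = u)"
    using linear_unify[OF lin(1,2) assms(3,4)] by metis
  have "has_sort L (\<mu> x) (var_sort L x)" for x
    using \<mu>(6)[of x] bindings_has_sort[OF assms(4) s(2), of x] t(2) \<open>g = h\<close> by auto
  then have "is_subst L \<mu>"
    by (simp add: is_subst_def)
  then have "is_mgu L \<mu> s t"
    unfolding is_mgu_def using \<mu>(1,3) by metis
  moreover have "funs (\<mu> x) \<subseteq> constructors L - vals L" for x
    using \<mu>(6)[of x]
  proof
    assume "\<exists>u. (x, u) \<in> set (bindings s t) \<and> \<mu> x = u"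
    then obtain a b where ab: "(a, b) \<in> set (zip ss ts)" "(x, \<mu> x) \<in> set (bindings a b)"
      using s(1) t(1) by auto
    have "funs (\<mu> x) \<subseteq> funs a \<union> funs b"
      using ab(2) by (rule bindings_range)
    then show ?thesis
      using s(3) t(3) set_zip_leftD[OF ab(1)] set_zip_rightD[OF ab(1)] by blast
  qed simp
  ultimately show ?thesis
    by - (rule that[OF _ \<mu>(2) \<mu>(3) \<mu>(4) \<mu>(5)[OF lin(3,4)]])
qed

text \<open>Covers the elements of \<open>cosub\<close> and \<open>\<sigma>\<close> itself, seen on
  the variables of \<open>s\<close> only. By the second clause variables may be shared only if they
  are old.\<close>

definition variant :: "'v set \<Rightarrow> ('f, 'v) sub \<Rightarrow> ('f, 'v) trm \<Rightarrow> ('f, 'v) sub \<Rightarrow> bool" where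
  "variant X \<sigma> s \<rho> \<longleftrightarrow> (\<forall>x\<in>vars s. \<rho> x = \<sigma> x \<or> co L X (\<sigma> x) (\<rho> x)) \<and>
     (\<forall>x\<in>vars s. \<forall>y\<in>vars s. x \<noteq> y \<longrightarrow> vars (\<rho> x) \<inter> vars (\<rho> y) \<subseteq> X)"

lemma variantD: "variant X \<sigma> s \<rho> \<Longrightarrow> x \<in> vars s \<Longrightarrow> \<rho> x = \<sigma> x \<or> co L X (\<sigma> x) (\<rho> x)"
  by (simp add: variant_def)

lemma variant_cases:
  assumes "variant X \<sigma> s \<rho>" "x \<in> vars s"
  obtains "\<rho> x = \<sigma> x" | "co L X (\<sigma> x) (\<rho> x)"
  using assms by (auto simp: variant_def)

text \<open>A variable shared by \<open>\<rho> x\<close> and \<open>\<rho> y\<close> lies in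
  \<open>X\<close>, and of \<open>X\<close> these terms contain only variables of
  \<open>\<sigma> x\<close> and \<open>\<sigma> y\<close>, which are disjoint as
  \<open>s \<cdot> \<sigma>\<close> is linear.\<close>

lemma variant_linear:
  assumes "variant X \<sigma> s \<rho>" "linear s" "linear (s \<cdot> \<sigma>)" "\<And>x. x \<in> vars s \<Longrightarrow> vars (\<sigma> x) \<subseteq> X"
  shows "linear (s \<cdot> \<rho>)"
proof (rule linear_substI)
  have X: "vars (\<rho> x) \<inter> X \<subseteq> vars (\<sigma> x)" if "x \<in> vars s" for x
    using variantD[OF assms(1) that] co_vars[of X "\<sigma> x" "\<rho> x"] by auto
  show "linear (\<rho> x)" if "x \<in> vars s" for x
    using variant_cases[OF assms(1) that]
  proof cases
    case 1
    then show ?thesis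
      using linear_substD[OF assms(3) that] by simp
  next
    case 2
    then show ?thesis
      using linear_substD[OF assms(3) that] assms(4)[OF that] by (rule co_linear)
  qed
  show "vars (\<rho> x) \<inter> vars (\<rho> y) = {}" if xy: "x \<in> vars s" "y \<in> vars s" "x \<noteq> y" for x y
  proof -
    have "vars (\<rho> x) \<inter> vars (\<rho> y) \<subseteq> X"
      using assms(1) xy unfolding variant_def by blast
    then have "vars (\<rho> x) \<inter> vars (\<rho> y) \<subseteq> vars (\<sigma> x) \<inter> vars (\<sigma> y)"
      using X[OF xy(1)] X[OF xy(2)] by blast
    then show ?thesis
      using linear_subst_disjoint[OF assms(3) xy] by blast
  qed
qed (rule assms(2))

lemma variant_depth_le: "variant X \<sigma> s \<rho> \<Longrightarrow> depth_le n (s \<cdot> \<sigma>) \<Longrightarrow> depth_le n (s \<cdot> \<rho>)"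
  by (rule depth_le_subst[of s \<sigma>]) (auto dest!: variantD intro: co_depth_le)

lemma variant_has_sort:
  assumes "variant X \<sigma> s \<rho>" "x \<in> vars s" "has_sort L (\<sigma> x) (var_sort L x)"
  shows "has_sort L (\<rho> x) (var_sort L x)"
  using variantD[OF assms(1,2)] assms(3) by (auto intro: co_has_sort)

lemma variant_funs:
  assumes "variant X \<sigma> s \<rho>" "x \<in> vars s" "funs (\<sigma> x) \<subseteq> constructors L - vals L"
  shows "funs (\<rho> x) \<subseteq> constructors L - vals L"
  using variantD[OF assms(1,2)] assms(3) co_funs[of X "\<sigma> x" "\<rho> x"] by auto

lemma variant_lmatch_unique:
  assumes "variant X \<sigma> s \<rho>" "lmatch (s \<cdot> \<sigma>) w" "lmatch (s \<cdot> \<rho>) w"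
  shows "s \<cdot> \<rho> = s \<cdot> \<sigma>"
proof (rule lmatch_subst_unique[OF _ assms(3,2)])
  fix x and w :: "('f, 'a) trm"
  assume "x \<in> vars s" "lmatch (\<rho> x) w" "lmatch (\<sigma> x) w"
  then show "\<rho> x = \<sigma> x"
    using variantD[OF assms(1), of x] co_lmatch_disjoint by blast
qed

text \<open>At each variable of \<open>s\<close>, either both variants keep the image under
  \<open>\<sigma>\<close> or both take a member of Co, as a mixed choice cannot match one term. In
  the second case the two members differ in fresh names only.\<close>

lemma variant_lmatch_skel:
  assumes "variant X \<sigma> s \<rho>" "variant X \<sigma> s \<rho>'" "lmatch (s \<cdot> \<rho>) w" "lmatch (s \<cdot> \<rho>') w"
  shows "skel (s \<cdot> \<rho>) = skel (s \<cdot> \<rho>')"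
proof (rule lmatch_subst_relate[OF _ assms(3,4)])
  fix x and w :: "('f, 'a) trm"
  assume x: "x \<in> vars s" and m: "lmatch (\<rho> x) w" "lmatch (\<rho>' x) w"
  show "skel (\<rho> x) = skel (\<rho>' x)"
    using variant_cases[OF assms(1) x]
  proof cases
    case 1
    then have "\<rho>' x = \<rho> x"
      using variantD[OF assms(2) x] m co_lmatch_disjoint[of X "\<sigma> x" "\<rho>' x" w] by auto
    then show ?thesis by simp
  next
    case 2
    then have "co L X (\<sigma> x) (\<rho>' x)"
      using variantD[OF assms(2) x] m co_lmatch_disjoint[of X "\<sigma> x" "\<rho> x" w] by auto
    then show ?thesis
      using 2 co_lmatch_skel m by blast
  qed
qed

text \<open>Members of Co are chosen one variable after the other, since the freshness condition
  relates different variables. Outside \<open>s\<close> the result keeps \<open>\<sigma>\<close>, so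
  that the domain stays the same.\<close>

lemma variant_cover:
  assumes "finite X" "\<And>x. x \<in> vars s \<Longrightarrow> vars (\<sigma> x) \<subseteq> X"
    and "\<And>x. x \<in> vars s \<Longrightarrow> has_sort L (\<sigma> x) (var_sort L x) \<and> funs (\<sigma> x) \<subseteq> constructors L"
    and "csub (vars s) \<tau>" "safe (s \<cdot> \<sigma>) (s \<cdot> \<tau>)"
  obtains \<rho> where "variant X \<sigma> s \<rho>" "lmatch (s \<cdot> \<rho>) (s \<cdot> \<tau>)" "\<And>x. x \<notin> vars s \<Longrightarrow> \<rho> x = \<sigma> x"
proof -
  have "\<exists>\<rho>. (\<forall>x\<in>A. (\<rho> x = \<sigma> x \<or> co L X (\<sigma> x) (\<rho> x)) \<and> lmatch (\<rho> x) (\<tau> x)) \<and>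
      (\<forall>x\<in>A. \<forall>y\<in>A. x \<noteq> y \<longrightarrow> vars (\<rho> x) \<inter> vars (\<rho> y) \<subseteq> X) \<and> (\<forall>x. x \<notin> A \<longrightarrow> \<rho> x = \<sigma> x)"
    if "A \<subseteq> vars s" for A
    using finite_subset[OF that finite_vars] that
  proof (induction A rule: finite_induct)
    case empty
    show ?case by (intro exI[of _ \<sigma>]) simp
  next
    case (insert a A)
    then obtain \<rho> where \<rho>: "\<forall>x\<in>A. (\<rho> x = \<sigma> x \<or> co L X (\<sigma> x) (\<rho> x)) \<and> lmatch (\<rho> x) (\<tau> x)"
        "\<forall>x\<in>A. \<forall>y\<in>A. x \<noteq> y \<longrightarrow> vars (\<rho> x) \<inter> vars (\<rho> y) \<subseteq> X" "\<forall>x. x \<notin> A \<longrightarrow> \<rho> x = \<sigma> x"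
      by auto
    have a: "a \<in> vars s"
      using insert.prems by simp
    \<comment> \<open>New variables must also avoid those of the earlier choices. Freshness for the
      larger set implies freshness for \<open>X\<close> by \<open>co_mono\<close>.\<close>
    let ?Y = "X \<union> (\<Union>x\<in>A. vars (\<rho> x))"
    have "\<exists>w. (w = \<sigma> a \<or> co L ?Y (\<sigma> a) w) \<and> lmatch w (\<tau> a)"
    proof (cases "lmatch (\<sigma> a) (\<tau> a)")
      case False
      have "\<exists>w. co L ?Y (\<sigma> a) w \<and> lmatch w (\<tau> a)"
      proof (rule co_cover)
        show "safe (\<sigma> a) (\<tau> a)"
          using assms(5) a by (rule safe_substD)
        show "finite ?Y"
          using assms(1) insert.hyps(1) by simp
        show "has_sort L (\<tau> a) (var_sort L a)" "funs (\<tau> a) \<subseteq> constructors L"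
          using csubD[OF assms(4) a] .
      qed (use assms(3)[OF a] False in auto)
      then show ?thesis by blast
    qed blast
    then obtain w where w: "w = \<sigma> a \<or> co L ?Y (\<sigma> a) w" "lmatch w (\<tau> a)"
      by blast
    have wX: "vars w \<inter> ?Y \<subseteq> X"
      using w(1) co_vars[of ?Y "\<sigma> a" w] assms(2)[OF a] by blast
    have "w = \<sigma> a \<or> co L X (\<sigma> a) w"
      using w(1) co_mono[of ?Y "\<sigma> a" w X] by blast
    moreover have "vars w \<inter> vars (\<rho> x) \<subseteq> X" if "x \<in> A" for x
      using wX that by blast
    ultimately show ?case
      using \<rho> w(2) insert.hyps(2)
      by (intro exI[of _ "\<rho>(a := w)"]) (auto simp: Int_commute)
  qed
  from this[of "vars s"] obtain \<rho> where \<rho>: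
      "\<forall>x\<in>vars s. (\<rho> x = \<sigma> x \<or> co L X (\<sigma> x) (\<rho> x)) \<and> lmatch (\<rho> x) (\<tau> x)"
      "\<forall>x\<in>vars s. \<forall>y\<in>vars s. x \<noteq> y \<longrightarrow> vars (\<rho> x) \<inter> vars (\<rho> y) \<subseteq> X"
      "\<forall>x. x \<notin> vars s \<longrightarrow> \<rho> x = \<sigma> x"
    by blast
  show ?thesis
  proof
    show "variant X \<sigma> s \<rho>"
      using \<rho>(1,2) by (auto simp: variant_def)
    show "lmatch (s \<cdot> \<rho>) (s \<cdot> \<tau>)"
      using \<rho>(1) by (intro lmatch_subst_subst) simp
  qed (use \<rho>(3) in simp)
qed

end

section \<open>A single difference, for fixed closed representatives and an arbitrary
  unifier\<close>

locale difference = lc_signature L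
  for L :: "('s, 'f, 'v, 'u) signature" +
  fixes n :: nat and s \<phi> t \<psi> :: "('f, 'v) trm" and \<sigma> :: "('f, 'v) sub"
  assumes ok_s: "ok n (s, \<phi>)" and ok_t: "ok n (t, \<psi>)"
    and closed: "vars \<phi> \<subseteq> vars s" "vars \<psi> \<subseteq> vars t"
    and disjoint: "vars s \<inter> vars t = {}"
    and cunifier: "cunifier L \<sigma> (s, \<phi>) (t, \<psi>)"
begin

definition X :: "'v set" where
  "X = vars s \<union> vars \<phi> \<union> vars t \<union> vars \<psi> \<union> (\<Union>x\<in>sdom \<sigma>. vars (\<sigma> x))"

lemma mgu: "is_mgu L \<sigma> s t" and sdom: "sdom \<sigma> \<subseteq> vars s \<union> vars t"
  and sat: "satisfiable L (and_c L (\<phi> \<cdot> \<sigma>) (\<psi> \<cdot> \<sigma>))"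
  using cunifier by (simp_all add: cunifier_def)

lemma unifies: "s \<cdot> \<sigma> = t \<cdot> \<sigma>" and subst_sort: "has_sort L (\<sigma> x) (var_sort L x)"
  using mgu by (simp_all add: is_mgu_def is_subst_def)

lemma constraints: "is_constraint L \<phi>" "is_constraint L \<psi>"
  using ok_s ok_t by (simp_all add: ok_constraint)

lemma finite_X: "finite X"
  using finite_subset[OF sdom] by (simp add: X_def)

lemma vars_X: "x \<in> vars s \<union> vars t \<Longrightarrow> vars (\<sigma> x) \<subseteq> X"
  by (cases "x \<in> sdom \<sigma>") (auto simp: X_def sdom_def)

text \<open>All most general unifiers are renamings of the idempotent one obtained from \<open>bindings\<close>.\<close>

lemma unifier_shape:
  "linear (s \<cdot> \<sigma>)" "depth_le n (s \<cdot> \<sigma>)"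
  "x \<in> vars s \<union> vars t \<Longrightarrow> funs (\<sigma> x) \<subseteq> constructors L - vals L"
proof -
  obtain \<mu> where \<mu>: "is_mgu L \<mu> s t" "\<And>x. \<mu> x \<cdot> \<sigma> = \<sigma> x" "linear (s \<cdot> \<mu>)" "depth_le n (s \<cdot> \<mu>)"
      "\<And>x. funs (\<mu> x) \<subseteq> constructors L - vals L"
    using unify_patterns[OF ok_s ok_t disjoint unifies] unifies by metis
  have sub: "is_subst L \<mu>" "s \<cdot> \<mu> = t \<cdot> \<mu>"
    using \<mu>(1) by (simp_all add: is_mgu_def)
  then obtain \<delta> where \<delta>: "\<And>x. \<mu> x = \<sigma> x \<cdot> \<delta>"
    using mgu unfolding is_mgu_def by blast
  \<comment> \<open>Applying \<open>\<sigma>\<close> after \<open>\<mu>\<close> gives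
    \<open>\<sigma>\<close>, and \<open>\<delta>\<close> leads from there back to
    \<open>\<mu>\<close>. So \<open>\<sigma>\<close> can be undone on \<open>s \<cdot> \<mu>\<close>
    and merely renames its variables.\<close>
  have "s \<cdot> \<mu> \<cdot> \<sigma> \<cdot> \<delta> = s \<cdot> \<mu>"
    by (simp add: subst_subst \<mu>(2) \<delta>[symmetric])
  then obtain \<pi> where \<pi>: "inj_on \<pi> (vars (s \<cdot> \<mu>))" "\<And>x. x \<in> vars (s \<cdot> \<mu>) \<Longrightarrow> \<sigma> x = Var (\<pi> x)"
    using subst_inverse_renaming by blast
  have "s \<cdot> \<sigma> = s \<cdot> \<mu> \<cdot> \<sigma>"
    by (simp add: subst_subst \<mu>(2))
  also have "\<dots> = map_trm id \<pi> (s \<cdot> \<mu>)"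
    unfolding map_trm_subst using \<pi>(2) by (rule subst_cong)
  finally have eq: "s \<cdot> \<sigma> = map_trm id \<pi> (s \<cdot> \<mu>)" .
  show "linear (s \<cdot> \<sigma>)" "depth_le n (s \<cdot> \<sigma>)"
    unfolding eq using \<mu>(3,4) \<pi>(1) by (simp_all add: linear_map_trm depth_le_rename)
  show "funs (\<sigma> x) \<subseteq> constructors L - vals L" if "x \<in> vars s \<union> vars t"
  proof -
    have "vars (\<mu> x) \<subseteq> vars (s \<cdot> \<mu>)"
      using that sub(2) vars_subst[of s \<mu>] vars_subst[of t \<mu>] by auto
    then have "\<mu> x \<cdot> \<sigma> = map_trm id \<pi> (\<mu> x)"
      unfolding map_trm_subst by (intro subst_cong \<pi>(2)) blast
    then show ?thesis
      using \<mu>(2)[of x] \<mu>(5)[of x] by simp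
  qed
qed

lemma theory_var:
  assumes "x \<in> vars \<phi> \<union> vars \<psi>"
  obtains z where "\<sigma> x = Var z"
proof -
  have "x \<in> vars s \<union> vars t" "var_sort L x \<in> theory_sorts L"
    using assms closed constraint_var_sort constraints by auto
  then show ?thesis
    using theory_sort_value_free[OF subst_sort] unifier_shape(3) that by blast
qed

lemma constraints_subst: "is_constraint L (\<phi> \<cdot> \<sigma>)" "is_constraint L (\<psi> \<cdot> \<sigma>)"
proof -
  have "is_constraint L (\<chi> \<cdot> \<sigma>)" if "is_constraint L \<chi>" "vars \<chi> \<subseteq> vars \<phi> \<union> vars \<psi>" for \<chi>
  proof -
    have "funs (\<sigma> x) = {}" if "x \<in> vars \<chi>" for x
    proof -
      obtain z where "\<sigma> x = Var z"
        using theory_var \<open>x \<in> vars \<chi>\<close> \<open>vars \<chi> \<subseteq> _\<close> by blast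
      then show ?thesis by simp
    qed
    then have "funs (\<chi> \<cdot> \<sigma>) = funs \<chi>"
      by (auto simp: funs_subst)
    then show ?thesis
      using that(1) has_sort_subst[of \<chi> "bool_sort L" \<sigma>] subst_sort by (simp add: is_constraint_iff)
  qed
  then show "is_constraint L (\<phi> \<cdot> \<sigma>)" "is_constraint L (\<psi> \<cdot> \<sigma>)"
    using constraints by blast+
qed

lemma variant_self: "variant X \<sigma> s \<sigma>"
  using vars_X by (auto simp: variant_def)

lemma cosub_variant:
  assumes "\<rho> \<in> cosub L X \<sigma>"
  shows "variant X \<sigma> s \<rho>"
proof -
  have \<rho>: "sdom \<rho> = sdom \<sigma>" "\<And>x. x \<in> sdom \<sigma> \<Longrightarrow> co L X (\<sigma> x) (\<rho> x) \<or> \<rho> x = \<sigma> x"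
    "\<And>x y. x \<in> sdom \<sigma> \<Longrightarrow> y \<in> sdom \<sigma> \<Longrightarrow> x \<noteq> y \<Longrightarrow> vars (\<rho> x) \<inter> vars (\<rho> y) \<subseteq> X"
    using assms by (auto simp: cosub_def)
  have out: "\<rho> x = Var x \<and> \<sigma> x = Var x" if "x \<notin> sdom \<sigma>" for x
    using that \<rho>(1) by (auto simp: sdom_def)
  have "\<rho> x = \<sigma> x \<or> co L X (\<sigma> x) (\<rho> x)" for x
    using \<rho>(2)[of x] out[of x] by (cases "x \<in> sdom \<sigma>") auto
  moreover have "vars (\<rho> x) \<inter> vars (\<rho> y) \<subseteq> X" if xy: "x \<in> vars s" "y \<in> vars s" "x \<noteq> y" for x y
  proof (cases "x \<in> sdom \<sigma> \<and> y \<in> sdom \<sigma>")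
    case True
    then show ?thesis
      using \<rho>(3) xy(3) by blast
  next
    case False
    then have "vars (\<rho> x) \<subseteq> {x} \<or> vars (\<rho> y) \<subseteq> {y}"
      using out by auto
    moreover have "x \<in> X" "y \<in> X"
      using xy by (auto simp: X_def)
    ultimately show ?thesis
      by blast
  qed
  ultimately show ?thesis
    unfolding variant_def by blast
qed

text \<open>\<open>\<sigma>\<close> sends constraint variables to variables, which have no
  complement. Hence \<open>\<phi> \<cdot> \<sigma>\<close> equals
  \<open>\<phi> \<cdot> \<rho>\<close> for every variant, and all pieces may carry it.\<close>

lemma variant_theory_var:
  assumes "variant X \<sigma> s \<rho>" "x \<in> vars \<phi>"
  shows "\<rho> x = \<sigma> x"
proof -
  obtain z where "\<sigma> x = Var z"
    using theory_var assms(2) by blast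
  then show ?thesis
    using variantD[OF assms(1), of x] closed(1) assms(2) co_is_Fun[of X "\<sigma> x" "\<rho> x"] by auto
qed

lemma variant_csub:
  assumes "variant X \<sigma> s \<rho>" "x \<in> vars s"
  shows "has_sort L (\<rho> x) (var_sort L x)" "funs (\<rho> x) \<subseteq> constructors L - vals L"
  using variant_has_sort[OF assms subst_sort] variant_funs[OF assms] unifier_shape(3) assms(2) by auto

lemma variant_subst_linear:
  assumes "variant X \<sigma> s \<rho>"
  shows "linear (s \<cdot> \<rho>)"
proof (rule variant_linear[OF assms])
  show "linear s"
    using ok_s by (simp add: ok_def)
qed (use vars_X unifier_shape(1) in auto)

lemma variant_ok:
  assumes "variant X \<sigma> s \<rho>" "is_constraint L \<chi>"
  shows "ok n (s \<cdot> \<rho>, \<chi>)"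
proof -
  obtain g ss where s: "s = Fun g ss" "g \<in> defined_syms L" "has_sort L s (res_sort L g)"
      "\<And>u. u \<in> set ss \<Longrightarrow> funs u \<subseteq> constructors L - vals L"
    using okD[OF ok_s] by metis
  have "has_sort L (s \<cdot> \<rho>) (res_sort L g)"
    using s(3) variant_csub(1)[OF assms(1)] by (rule has_sort_subst)
  moreover have "funs (u \<cdot> \<rho>) \<subseteq> constructors L - vals L" if "u \<in> set ss" for u
    using s(1) s(4)[OF that] variant_csub(2)[OF assms(1)] that unfolding funs_subst by fastforce
  moreover have "depth_le n (s \<cdot> \<rho>)"
    using assms(1) unifier_shape(2) by (rule variant_depth_le)
  ultimately show ?thesis
    using variant_subst_linear[OF assms(1)] s(1,2) assms(2)
    by (simp only: subst.simps) (rule okI, auto)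
qed

lemma variant_closed:
  assumes "variant X \<sigma> s \<rho>"
  shows "vars (\<phi> \<cdot> \<sigma>) \<subseteq> vars (s \<cdot> \<rho>)"
proof -
  have "vars (\<sigma> x) \<subseteq> vars (s \<cdot> \<rho>)" if "x \<in> vars \<phi>" for x
    using variant_theory_var[OF assms that] closed(1) that by (force simp: vars_subst)
  then show ?thesis
    by (auto simp: vars_subst)
qed

abbreviation rest :: "('f, 'v) trm" where
  "rest \<equiv> and_c L (\<phi> \<cdot> \<sigma>) (not_c L (\<psi> \<cdot> \<sigma>))"

lemma rest_closed: "vars rest \<subseteq> vars (s \<cdot> \<sigma>)"
proof -
  have "vars (\<psi> \<cdot> \<sigma>) \<subseteq> vars (t \<cdot> \<sigma>)"
    using closed(2) by (auto simp: vars_subst)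
  then show ?thesis
    using variant_closed[OF variant_self] unifies by simp
qed

lemma rest_constraint: "is_constraint L rest"
  using constraints_subst by (simp add: is_constraint_connectives)

abbreviation pieces :: "('f, 'v) cterm set" where
  "pieces \<equiv> diff_pieces L \<sigma> (s, \<phi>) (t, \<psi>)"

lemma pieces_eq:
  "pieces = {(s \<cdot> \<rho>, \<phi> \<cdot> \<sigma>) |\<rho>. \<rho> \<in> cosub L X \<sigma> \<and> s \<cdot> \<rho> \<noteq> s \<cdot> \<sigma>} \<union>
     {r. r = (s \<cdot> \<sigma>, rest) \<and> satisfiable L rest}"
  by (simp add: diff_pieces_def X_def Let_def)

lemma pieces_cases:
  assumes "r \<in> pieces"
  obtains \<rho> where "r = (s \<cdot> \<rho>, \<phi> \<cdot> \<sigma>)" "variant X \<sigma> s \<rho>" "s \<cdot> \<rho> \<noteq> s \<cdot> \<sigma>"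
    | "r = (s \<cdot> \<sigma>, rest)"
  using assms cosub_variant unfolding pieces_eq by blast

lemma pieces_ok:
  assumes "r \<in> pieces"
  shows "ok n r" "cvars_closed r"
proof -
  have "ok n r \<and> cvars_closed r"
    using assms
  proof (cases rule: pieces_cases)
    case (1 \<rho>)
    then show ?thesis
      using variant_ok constraints_subst(1) variant_closed by (simp add: cvars_closed_def)
  next
    case 2
    then show ?thesis
      using variant_ok[OF variant_self] rest_constraint rest_closed by (simp add: cvars_closed_def)
  qed
  then show "ok n r" "cvars_closed r" by auto
qed

lemma common_instance:
  assumes "s \<cdot> \<tau>1 = t \<cdot> \<tau>2" "csub (vars s) \<tau>1" "csub (vars t) \<tau>2"
  obtains \<delta> where "s \<cdot> \<tau>1 = s \<cdot> \<sigma> \<cdot> \<delta>" "csub (vars (s \<cdot> \<sigma>)) \<delta>"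
proof -
  define \<tau> where "\<tau> x = (if x \<in> vars s then \<tau>1 x else if x \<in> vars t then \<tau>2 x else Var x)" for x
  have s: "s \<cdot> \<tau> = s \<cdot> \<tau>1"
    by (rule subst_cong) (simp add: \<tau>_def)
  have t: "t \<cdot> \<tau> = t \<cdot> \<tau>2"
    using disjoint by (intro subst_cong) (auto simp: \<tau>_def)
  have "is_subst L \<tau>"
    using assms(2,3) by (simp add: is_subst_def csub_def \<tau>_def)
  then obtain \<delta> where \<delta>: "is_subst L \<delta>" "\<And>x. \<tau> x = \<sigma> x \<cdot> \<delta>"
    using mgu s t assms(1) unfolding is_mgu_def by auto
  have "s \<cdot> \<tau>1 = s \<cdot> \<sigma> \<cdot> \<delta>"
    unfolding s[symmetric] subst_subst \<delta>(2)[symmetric] ..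
  moreover have "csub (vars (s \<cdot> \<sigma>)) \<delta>"
    unfolding csub_def
  proof (intro ballI conjI)
    fix z
    assume "z \<in> vars (s \<cdot> \<sigma>)"
    then obtain x where x: "x \<in> vars s" "z \<in> vars (\<sigma> x)"
      by (auto simp: vars_subst)
    \<comment> \<open>Generality of \<open>\<sigma>\<close> makes \<open>\<delta>\<close>
      well-sorted only; that it uses constructors is seen from \<open>\<tau> x\<close>, of which
      \<open>\<delta> z\<close> is a subterm.\<close>
    have "funs (\<delta> z) \<subseteq> funs (\<tau> x)"
      unfolding \<delta>(2)[of x] funs_subst using x(2) by blast
    then show "funs (\<delta> z) \<subseteq> constructors L"
      using csubD(2)[OF assms(2) x(1)] x(1) by (auto simp: \<tau>_def)
    show "has_sort L (\<delta> z) (var_sort L z)"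
      using \<delta>(1) by (simp add: is_subst_def)
  qed
  ultimately show ?thesis
    by (rule that)
qed

lemma variant_inst:
  assumes "variant X \<sigma> s \<rho>" "is_constraint L \<chi>" "vars \<chi> \<subseteq> vars (s \<cdot> \<rho>)"
  shows "u \<in> inst n (s \<cdot> \<rho>, \<chi>) \<longleftrightarrow>
    (\<exists>\<delta>. u = s \<cdot> \<rho> \<cdot> \<delta> \<and> csub (vars (s \<cdot> \<rho>)) \<delta> \<and> deep n u \<and> holds \<delta> \<chi>)"
  using in_inst_closed[OF assms(2,3)] .

lemma variant_comp_csub:
  assumes "variant X \<sigma> s \<rho>" "csub (vars (s \<cdot> \<rho>)) \<delta>"
  shows "csub (vars s) (\<lambda>x. \<rho> x \<cdot> \<delta>)"
  unfolding csub_def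
proof (intro ballI conjI)
  fix x
  assume x: "x \<in> vars s"
  have sub: "vars (\<rho> x) \<subseteq> vars (s \<cdot> \<rho>)"
    using x by (auto simp: vars_subst)
  show "has_sort L (\<rho> x \<cdot> \<delta>) (var_sort L x)"
    using variant_csub(1)[OF assms(1) x]
    by (rule has_sort_subst) (use csubD(1)[OF assms(2)] sub in blast)
  show "funs (\<rho> x \<cdot> \<delta>) \<subseteq> constructors L"
    unfolding funs_subst using csubD(2)[OF assms(2)] sub variant_csub(2)[OF assms(1) x] by blast
qed

lemma inst_subset:
  assumes "variant X \<sigma> s \<rho>" "u = s \<cdot> \<rho> \<cdot> \<delta>" "csub (vars (s \<cdot> \<rho>)) \<delta>" "deep n u" "holds \<delta> (\<phi> \<cdot> \<sigma>)"
  shows "u \<in> inst n (s, \<phi>)"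
proof -
  have "holds (\<lambda>x. \<rho> x \<cdot> \<delta>) \<phi> \<longleftrightarrow> holds (\<lambda>x. \<sigma> x \<cdot> \<delta>) \<phi>"
    using variant_theory_var[OF assms(1)] by (intro holds_cong) simp
  then have "holds (\<lambda>x. \<rho> x \<cdot> \<delta>) \<phi>"
    using assms(5) by (simp add: holds_subst)
  then show ?thesis
    using assms(2,4) variant_comp_csub[OF assms(1,3)]
    unfolding in_inst_closed[OF constraints(1) closed(1)] by (auto simp: subst_subst)
qed

lemma common_inst_lmatch:
  assumes "u \<in> inst n (s, \<phi>)" "u \<in> inst n (t, \<psi>)"
  obtains \<delta> where "u = s \<cdot> \<sigma> \<cdot> \<delta>" "csub (vars (s \<cdot> \<sigma>)) \<delta>"
  using assms common_instance unfolding in_inst_closed[OF constraints(1) closed(1)]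
    in_inst_closed[OF constraints(2) closed(2)] by metis

lemma holds_rest:
  assumes "csub (vars (s \<cdot> \<sigma>)) \<delta>"
  shows "holds \<delta> rest \<longleftrightarrow> holds \<delta> (\<phi> \<cdot> \<sigma>) \<and> \<not> holds \<delta> (\<psi> \<cdot> \<sigma>)"
proof -
  have "csub (vars (\<phi> \<cdot> \<sigma>) \<union> vars (not_c L (\<psi> \<cdot> \<sigma>))) \<delta>" "csub (vars (\<psi> \<cdot> \<sigma>)) \<delta>"
    using rest_closed by (auto intro!: csub_mono[OF assms])
  then show ?thesis
    using constraints_subst by (simp add: holds_and holds_not is_constraint_connectives)
qed

lemma pieces_inst_subset:
  assumes "r \<in> pieces" "u \<in> inst n r"
  shows "u \<in> inst n (s, \<phi>) - inst n (t, \<psi>)"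
  using assms(1)
proof (cases rule: pieces_cases)
  case (1 \<rho>)
  have "u \<in> inst n (s \<cdot> \<rho>, \<phi> \<cdot> \<sigma>)"
    using assms(2) 1(1) by simp
  then obtain \<delta> where \<delta>: "u = s \<cdot> \<rho> \<cdot> \<delta>" "csub (vars (s \<cdot> \<rho>)) \<delta>" "deep n u" "holds \<delta> (\<phi> \<cdot> \<sigma>)"
    using variant_inst[OF 1(2) constraints_subst(1) variant_closed[OF 1(2)]] by blast
  have u: "u \<in> inst n (s, \<phi>)"
    using 1(2) \<delta> by (rule inst_subset)
  moreover have "u \<notin> inst n (t, \<psi>)"
  proof
    assume "u \<in> inst n (t, \<psi>)"
    with u obtain \<delta>' where "u = s \<cdot> \<sigma> \<cdot> \<delta>'"
      by (rule common_inst_lmatch)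
    then have "lmatch (s \<cdot> \<sigma>) u" "lmatch (s \<cdot> \<rho>) u"
      using \<delta>(1) lmatch_subst by metis+
    then show False
      using variant_lmatch_unique[OF 1(2)] 1(3) by blast
  qed
  ultimately show ?thesis by blast
next
  case 2
  have "u \<in> inst n (s \<cdot> \<sigma>, rest)"
    using assms(2) 2 by simp
  then obtain \<delta> where \<delta>: "u = s \<cdot> \<sigma> \<cdot> \<delta>" "csub (vars (s \<cdot> \<sigma>)) \<delta>" "deep n u" "holds \<delta> rest"
    using variant_inst[OF variant_self rest_constraint rest_closed] by blast
  have h: "holds \<delta> (\<phi> \<cdot> \<sigma>)" "\<not> holds \<delta> (\<psi> \<cdot> \<sigma>)"
    using \<delta>(4) holds_rest[OF \<delta>(2)] by simp_all
  have "u \<in> inst n (s, \<phi>)"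
    using variant_self \<delta>(1,2,3) h(1) by (rule inst_subset)
  moreover have "u \<notin> inst n (t, \<psi>)"
  proof
    assume "u \<in> inst n (t, \<psi>)"
    then obtain \<tau> where \<tau>: "u = t \<cdot> \<tau>" "holds \<tau> \<psi>"
      unfolding in_inst_closed[OF constraints(2) closed(2)] by blast
    have "t \<cdot> \<tau> = t \<cdot> (\<lambda>x. \<sigma> x \<cdot> \<delta>)"
      using \<tau>(1) \<delta>(1) unifies by (simp add: subst_subst[symmetric])
    then have "holds \<tau> \<psi> \<longleftrightarrow> holds (\<lambda>x. \<sigma> x \<cdot> \<delta>) \<psi>"
      using closed(2) by (intro holds_cong) (blast dest: subst_eqD)
    then show False
      using \<tau>(2) h(2) by (simp add: holds_subst)
  qed
  ultimately show ?thesis by blast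
qed

text \<open>\<open>deep_safe\<close> is about constructor terms, so it is applied to the arguments
  below the defined root, with both bounds lowered by one.\<close>

lemma safe_instance:
  assumes "s \<cdot> \<tau> = u" "csub (vars s) \<tau>" "deep n u"
  shows "safe (s \<cdot> \<sigma>) u"
proof -
  obtain g ss where s: "s = Fun g ss" "has_sort L s (res_sort L g)"
      "\<And>a. a \<in> set ss \<Longrightarrow> funs a \<subseteq> constructors L - vals L"
    using okD[OF ok_s] by metis
  obtain m where n: "n = Suc m"
    using unifier_shape(2) s(1) by (cases n) auto
  have "safe (ss ! i \<cdot> \<sigma>) (ss ! i \<cdot> \<tau>)" if i: "i < length ss" for i
  proof (rule deep_safe)
    have mem: "ss ! i \<in> set ss"
      using i by simp
    have vars: "vars (ss ! i) \<subseteq> vars s"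
      using mem s(1) by auto
    have sort: "has_sort L (ss ! i) (arg_sorts L g ! i)"
      using s(1,2) i by (simp add: list_all2_conv_all_nth)
    show "depth_le m (ss ! i \<cdot> \<sigma>)"
      using unifier_shape(2) s(1) n mem by simp
    show "deep m (ss ! i \<cdot> \<tau>)"
      using assms(1,3) s(1) n mem by auto
    show "has_sort L (ss ! i \<cdot> \<sigma>) (arg_sorts L g ! i)"
      using sort subst_sort by (rule has_sort_subst)
    show "has_sort L (ss ! i \<cdot> \<tau>) (arg_sorts L g ! i)"
      using sort by (rule has_sort_subst) (use csubD(1)[OF assms(2)] vars in blast)
    show "funs (ss ! i \<cdot> \<sigma>) \<subseteq> constructors L"
      unfolding funs_subst using s(3)[OF mem] unifier_shape(3) vars by blast
  qed
  then show ?thesis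
    using s(1) assms(1) by (auto simp: list_all2_conv_all_nth)
qed

lemma linear_lmatch_csub:
  assumes "variant X \<sigma> s \<rho>" "lmatch (s \<cdot> \<rho>) (s \<cdot> \<tau>)" "csub (vars s) \<tau>"
  obtains \<delta> where "s \<cdot> \<tau> = s \<cdot> \<rho> \<cdot> \<delta>" "csub (vars (s \<cdot> \<rho>)) \<delta>"
    "\<And>x. x \<in> vars s \<Longrightarrow> \<tau> x = \<rho> x \<cdot> \<delta>"
proof -
  obtain \<delta> where \<delta>: "s \<cdot> \<rho> \<cdot> \<delta> = s \<cdot> \<tau>"
    using linear_lmatch_imp_subst[OF variant_subst_linear[OF assms(1)] assms(2)] by blast
  have eq: "\<tau> x = \<rho> x \<cdot> \<delta>" if "x \<in> vars s" for x
    using subst_eqD[OF \<delta>[unfolded subst_subst, symmetric] that] .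
  have "csub (vars (s \<cdot> \<rho>)) \<delta>"
    unfolding csub_def
  proof (intro ballI conjI)
    fix z
    assume "z \<in> vars (s \<cdot> \<rho>)"
    then obtain x where x: "x \<in> vars s" "z \<in> vars (\<rho> x)"
      by (auto simp: vars_subst)
    have "has_sort L (\<rho> x \<cdot> \<delta>) (var_sort L x)"
      using csubD(1)[OF assms(3) x(1)] eq[OF x(1)] by simp
    then show "has_sort L (\<delta> z) (var_sort L z)"
      using variant_csub(1)[OF assms(1) x(1)] x(2) by (rule has_sort_substD)
    have "funs (\<delta> z) \<subseteq> funs (\<tau> x)"
      unfolding eq[OF x(1)] funs_subst using x(2) by blast
    then show "funs (\<delta> z) \<subseteq> constructors L"
      using csubD(2)[OF assms(3) x(1)] by blast
  qed
  then show ?thesis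
    using \<delta>[symmetric] eq by (intro that)
qed

lemma cosubI:
  assumes "variant X \<sigma> s \<rho>" "\<And>x. x \<notin> vars s \<Longrightarrow> \<rho> x = \<sigma> x" "s \<cdot> \<rho> \<noteq> s \<cdot> \<sigma>"
  shows "\<rho> \<in> cosub L X \<sigma>"
proof -
  have cases: "\<rho> x = \<sigma> x \<or> co L X (\<sigma> x) (\<rho> x)" for x
    using variantD[OF assms(1), of x] assms(2)[of x] by blast
  have "x \<in> sdom \<rho> \<longleftrightarrow> x \<in> sdom \<sigma>" for x
    using cases[of x] co_is_Fun[of X "\<sigma> x" "\<rho> x"] by (auto simp: sdom_def)
  moreover have "\<rho> \<noteq> \<sigma>"
    using assms(3) by blast
  moreover have "vars (\<rho> x) \<inter> vars (\<rho> y) \<subseteq> X" if xy: "x \<in> sdom \<sigma>" "y \<in> sdom \<sigma>" "x \<noteq> y" for x y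
  proof (cases "x \<in> vars s \<and> y \<in> vars s")
    case True
    then show ?thesis
      using assms(1) xy(3) unfolding variant_def by blast
  next
    case False
    then have "\<rho> x = \<sigma> x \<or> \<rho> y = \<sigma> y"
      using assms(2) by blast
    moreover have "vars (\<sigma> x) \<subseteq> X" "vars (\<sigma> y) \<subseteq> X"
      using xy(1,2) by (auto simp: X_def)
    ultimately show ?thesis
      by auto
  qed
  ultimately show ?thesis
    unfolding cosub_def using cases by blast
qed

text \<open>For an instance that matches \<open>s \<cdot> \<sigma>\<close> the constraint alone
  decides, and it falls to the piece with the negation; any other instance fails to match by a clash
  of symbols and is caught by a variant.\<close>

lemma pieces_inst_cover:
  assumes "u \<in> inst n (s, \<phi>)" "u \<notin> inst n (t, \<psi>)"
  obtains r where "r \<in> pieces" "u \<in> inst n r"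
proof -
  obtain \<tau> where \<tau>: "u = s \<cdot> \<tau>" "csub (vars s) \<tau>" "deep n u" "holds \<tau> \<phi>"
    using assms(1) unfolding in_inst_closed[OF constraints(1) closed(1)] by blast
  have phi: "holds \<delta> (\<phi> \<cdot> \<sigma>)"
    if "variant X \<sigma> s \<rho>" "\<And>x. x \<in> vars s \<Longrightarrow> \<tau> x = \<rho> x \<cdot> \<delta>" for \<rho> \<delta>
  proof -
    have "holds (\<lambda>x. \<sigma> x \<cdot> \<delta>) \<phi> \<longleftrightarrow> holds \<tau> \<phi>"
      using that(2) variant_theory_var[OF that(1)] closed(1) by (intro holds_cong) auto
    then show ?thesis
      using \<tau>(4) by (simp add: holds_subst)
  qed
  show ?thesis
  proof (cases "lmatch (s \<cdot> \<sigma>) u")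
    case True
    then obtain \<delta> where \<delta>: "u = s \<cdot> \<sigma> \<cdot> \<delta>" "csub (vars (s \<cdot> \<sigma>)) \<delta>"
        "\<And>x. x \<in> vars s \<Longrightarrow> \<tau> x = \<sigma> x \<cdot> \<delta>"
      using linear_lmatch_csub[OF variant_self _ \<tau>(2)] \<tau>(1) by metis
    have "\<not> holds \<delta> (\<psi> \<cdot> \<sigma>)"
    proof
      assume "holds \<delta> (\<psi> \<cdot> \<sigma>)"
      then have "holds (\<lambda>x. \<sigma> x \<cdot> \<delta>) \<psi>"
        by (simp add: holds_subst)
      moreover have "u = t \<cdot> (\<lambda>x. \<sigma> x \<cdot> \<delta>)"
        using \<delta>(1) unifies by (simp add: subst_subst[symmetric])
      moreover have "csub (vars t) (\<lambda>x. \<sigma> x \<cdot> \<delta>)"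
        unfolding csub_def
      proof (intro ballI conjI)
        fix x
        assume x: "x \<in> vars t"
        have sub: "vars (\<sigma> x) \<subseteq> vars (s \<cdot> \<sigma>)"
          unfolding unifies using x by (auto simp: vars_subst)
        show "has_sort L (\<sigma> x \<cdot> \<delta>) (var_sort L x)"
          using subst_sort by (rule has_sort_subst) (use csubD(1)[OF \<delta>(2)] sub in blast)
        show "funs (\<sigma> x \<cdot> \<delta>) \<subseteq> constructors L"
          unfolding funs_subst using csubD(2)[OF \<delta>(2)] sub unifier_shape(3)[of x] x by blast
      qed
      ultimately have "u \<in> inst n (t, \<psi>)"
        using \<tau>(3) unfolding in_inst_closed[OF constraints(2) closed(2)] by blast
      then show False
        using assms(2) by blast
    qed
    then have rest: "holds \<delta> rest"
      using phi[OF variant_self \<delta>(3)] holds_rest[OF \<delta>(2)] by blast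
    then have u: "u \<in> inst n (s \<cdot> \<sigma>, rest)"
      using \<delta>(1,2) \<tau>(3) variant_inst[OF variant_self rest_constraint rest_closed] by blast
    \<comment> \<open>The instance \<open>u\<close> itself witnesses that this piece has not been
      discarded as unsatisfiable.\<close>
    then have "satisfiable L rest"
      by (auto simp: inst_def satisfiable_def is_csubst_def)
    then have "(s \<cdot> \<sigma>, rest) \<in> pieces"
      unfolding pieces_eq by blast
    then show ?thesis
      using u that by blast
  next
    case False
    have "safe (s \<cdot> \<sigma>) (s \<cdot> \<tau>)"
      using safe_instance \<tau> by blast
    moreover have "vars (\<sigma> x) \<subseteq> X" if "x \<in> vars s" for x
      using that by (intro vars_X) simp
    moreover have "has_sort L (\<sigma> x) (var_sort L x) \<and> funs (\<sigma> x) \<subseteq> constructors L" if "x \<in> vars s" for x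
      using subst_sort unifier_shape(3)[of x] that by auto
    ultimately obtain \<rho> where \<rho>: "variant X \<sigma> s \<rho>" "lmatch (s \<cdot> \<rho>) (s \<cdot> \<tau>)"
        "\<And>x. x \<notin> vars s \<Longrightarrow> \<rho> x = \<sigma> x"
      using variant_cover[OF finite_X _ _ \<tau>(2)] by metis
    have ne: "s \<cdot> \<rho> \<noteq> s \<cdot> \<sigma>"
      using False \<rho>(2) \<tau>(1) by auto
    have piece: "(s \<cdot> \<rho>, \<phi> \<cdot> \<sigma>) \<in> pieces"
      using cosubI[OF \<rho>(1,3) ne] ne unfolding pieces_eq by blast
    obtain \<delta> where \<delta>: "s \<cdot> \<tau> = s \<cdot> \<rho> \<cdot> \<delta>" "csub (vars (s \<cdot> \<rho>)) \<delta>"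
        "\<And>x. x \<in> vars s \<Longrightarrow> \<tau> x = \<rho> x \<cdot> \<delta>"
      using linear_lmatch_csub[OF \<rho>(1,2) \<tau>(2)] by metis
    have "u \<in> inst n (s \<cdot> \<rho>, \<phi> \<cdot> \<sigma>)"
      unfolding variant_inst[OF \<rho>(1) constraints_subst(1) variant_closed[OF \<rho>(1)]]
      using \<delta>(1,2) \<tau>(1,3) phi[OF \<rho>(1) \<delta>(3)] by (intro exI[of _ \<delta>]) simp
    then show ?thesis
      using piece that by blast
  qed
qed

lemma pieces_inst: "(\<Union>r\<in>pieces. inst n r) = inst n (s, \<phi>) - inst n (t, \<psi>)"
proof
  show "(\<Union>r\<in>pieces. inst n r) \<subseteq> inst n (s, \<phi>) - inst n (t, \<psi>)"
    using pieces_inst_subset by (intro UN_least subsetI)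
  show "inst n (s, \<phi>) - inst n (t, \<psi>) \<subseteq> (\<Union>r\<in>pieces. inst n r)"
  proof
    fix u
    assume "u \<in> inst n (s, \<phi>) - inst n (t, \<psi>)"
    then obtain r where "r \<in> pieces" "u \<in> inst n r"
      by (auto elim: pieces_inst_cover)
    then show "u \<in> (\<Union>r\<in>pieces. inst n r)"
      by (rule UN_I)
  qed
qed

lemma piece_lmatch_cut:
  assumes "variant X \<sigma> s \<rho>" "u \<in> inst n (s \<cdot> \<rho>, \<chi>)"
  shows "lmatch (s \<cdot> \<rho>) (cut n u)"
proof -
  have "ok n (s \<cdot> \<rho>, \<phi> \<cdot> \<sigma>)"
    using assms(1) constraints_subst(1) by (rule variant_ok)
  then show ?thesis
    using assms(2) by (intro lmatch_cut) (auto simp: inst_def ok_def lmatch_subst)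
qed

text \<open>A cut keeps everything that the term of a piece can test, so it selects one skeleton and
  thereby one class.\<close>

lemma pieces_same_cut:
  assumes "r1 \<in> pieces" "r2 \<in> pieces" "u1 \<in> inst n r1" "u2 \<in> inst n r2" "cut n u1 = cut n u2"
  shows "cls L r1 = cls L r2"
  using assms(1)
proof (cases rule: pieces_cases)
  case 1: (1 \<rho>1)
  then have m1: "lmatch (s \<cdot> \<rho>1) (cut n u1)"
    using piece_lmatch_cut assms(3) by blast
  from assms(2) show ?thesis
  proof (cases rule: pieces_cases)
    case 2: (1 \<rho>2)
    then have m2: "lmatch (s \<cdot> \<rho>2) (cut n u1)"
      using piece_lmatch_cut assms(4,5) by metis
    have "skel (s \<cdot> \<rho>1) = skel (s \<cdot> \<rho>2)"
      using 1(2) 2(2) m1 m2 by (rule variant_lmatch_skel)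
    then obtain \<pi> where \<pi>: "renaming \<pi>" "map_trm id \<pi> (s \<cdot> \<rho>1) = s \<cdot> \<rho>2"
      using renaming_linear variant_subst_linear 1(2) 2(2) by metis
    have "map_trm id \<pi> (\<rho>1 x) = \<rho>2 x" if "x \<in> vars s" for x
      using subst_eqD[OF \<pi>(2)[unfolded map_trm_subst'] that] .
    \<comment> \<open>Both variants agree with \<open>\<sigma>\<close> on the constraint variables,
      so the renaming between them fixes these images and with them the constraint.\<close>
    then have "map_trm id \<pi> (\<sigma> x) = \<sigma> x" if "x \<in> vars \<phi>" for x
      using variant_theory_var[OF 1(2) that] variant_theory_var[OF 2(2) that] closed(1) that by force
    then have "map_trm id \<pi> (\<phi> \<cdot> \<sigma>) = \<phi> \<cdot> \<sigma>"
      unfolding map_trm_subst' by (rule subst_cong)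
    moreover have "vars (s \<cdot> \<rho>2) = \<pi> ` vars (s \<cdot> \<rho>1)"
      unfolding \<pi>(2)[symmetric] by (simp add: trm.set_map)
    ultimately have "\<forall>\<alpha>. ex_closure L (vars (s \<cdot> \<rho>2)) (\<phi> \<cdot> \<sigma>) \<alpha>
        = ex_closure L (vars (s \<cdot> \<rho>1)) (\<phi> \<cdot> \<sigma>) (\<alpha> \<circ> \<pi>)"
      using ex_closure_rename[OF \<pi>(1), of "vars (s \<cdot> \<rho>1)" "\<phi> \<cdot> \<sigma>"] by simp
    moreover have "r1 \<in> cterms L" "r2 \<in> cterms L"
      using pieces_ok(1) assms(1,2) by (simp_all add: ok_def)
    ultimately have "(r1, r2) \<in> doteq L"
      unfolding 1(1) 2(1) doteq_iff using \<pi> by blast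
    then show ?thesis
      unfolding cls_def by (rule equiv_class_eq[OF equiv_doteq])
  next
    case 2
    then have "lmatch (s \<cdot> \<sigma>) (cut n u1)"
      using piece_lmatch_cut[OF variant_self] assms(4,5) by metis
    then show ?thesis
      using variant_lmatch_unique[OF 1(2) _ m1] 1(3) by blast
  qed
next
  case 1: 2
  then have m1: "lmatch (s \<cdot> \<sigma>) (cut n u2)"
    using piece_lmatch_cut[OF variant_self] assms(3,5) by metis
  from assms(2) show ?thesis
  proof (cases rule: pieces_cases)
    case 2: (1 \<rho>2)
    then have "lmatch (s \<cdot> \<rho>2) (cut n u2)"
      using piece_lmatch_cut assms(4) by blast
    then show ?thesis
      using variant_lmatch_unique[OF 2(2) m1] 2(3) by blast
  next
    case 2
    then show ?thesis
      using 1 by simp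
  qed
qed

lemma common_inst_exists: "inst n (s, \<phi>) \<inter> inst n (t, \<psi>) \<noteq> {}"
proof -
  obtain \<gamma> where \<gamma>: "is_subst L \<gamma>" "respects_c L \<gamma> (and_c L (\<phi> \<cdot> \<sigma>) (\<psi> \<cdot> \<sigma>))"
    using sat by (auto simp: satisfiable_def)
  obtain \<omega> where \<omega>: "\<And>\<iota>. has_sort L (\<omega> \<iota>) \<iota> \<and> funs (\<omega> \<iota>) \<subseteq> constructors L \<and> deep n (\<omega> \<iota>)"
    using deep_term_exists[where n = n] by metis
  \<comment> \<open>Satisfiability controls \<open>\<gamma>\<close> only on the variables of the
    constraint. Wherever \<open>\<gamma>\<close> yields no value, a constructor term generic up to
    depth \<open>n\<close> takes its place.\<close>
  define \<delta> where "\<delta> x = (if \<gamma> x \<in> value_terms L then \<gamma> x else \<omega> (var_sort L x))" for x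
  have val: "funs (\<gamma> x) \<subseteq> constructors L" "deep n (\<gamma> x)" if "\<gamma> x \<in> value_terms L" for x
    using that by (auto simp: value_terms_def vals_symbol)
  have \<delta>: "has_sort L (\<delta> x) (var_sort L x)" "funs (\<delta> x) \<subseteq> constructors L" "deep n (\<delta> x)" for x
    using \<gamma>(1) \<omega> val by (auto simp: \<delta>_def is_subst_def)
  have csub: "csub V \<delta>" for V
    using \<delta> by (simp add: csub_def)
  have "respects_c L \<delta> (and_c L (\<phi> \<cdot> \<sigma>) (\<psi> \<cdot> \<sigma>))"
  proof -
    have "\<delta> x = \<gamma> x" if "x \<in> vars (and_c L (\<phi> \<cdot> \<sigma>) (\<psi> \<cdot> \<sigma>))" for x
      using \<gamma>(2) that unfolding respects_iff \<delta>_def by simp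
    then show ?thesis
      using \<gamma>(2) holds_cong[of "and_c L (\<phi> \<cdot> \<sigma>) (\<psi> \<cdot> \<sigma>)" \<delta> \<gamma>] unfolding respects_iff by simp
  qed
  then have h: "holds \<delta> (\<phi> \<cdot> \<sigma>)" "holds \<delta> (\<psi> \<cdot> \<sigma>)"
    using holds_and[OF constraints_subst csub] by (simp_all add: respects_iff)
  have comp: "csub V (\<lambda>x. \<sigma> x \<cdot> \<delta>)" if "V \<subseteq> vars s \<union> vars t" for V
    unfolding csub_def
  proof (intro ballI conjI)
    fix x
    assume "x \<in> V"
    show "has_sort L (\<sigma> x \<cdot> \<delta>) (var_sort L x)"
      using subst_sort \<delta>(1) by (rule has_sort_subst)
    show "funs (\<sigma> x \<cdot> \<delta>) \<subseteq> constructors L"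
      unfolding funs_subst using \<delta>(2) unifier_shape(3)[of x] \<open>x \<in> V\<close> that by blast
  qed
  let ?u = "s \<cdot> \<sigma> \<cdot> \<delta>"
  have "deep n ?u"
    using \<delta>(3) by (rule deep_subst)
  moreover have "?u = s \<cdot> (\<lambda>x. \<sigma> x \<cdot> \<delta>)" "?u = t \<cdot> (\<lambda>x. \<sigma> x \<cdot> \<delta>)"
    using unifies by (simp_all add: subst_subst[symmetric])
  moreover have "holds (\<lambda>x. \<sigma> x \<cdot> \<delta>) \<phi>" "holds (\<lambda>x. \<sigma> x \<cdot> \<delta>) \<psi>"
    using h by (simp_all add: holds_subst)
  ultimately have "?u \<in> inst n (s, \<phi>)" "?u \<in> inst n (t, \<psi>)"
    unfolding in_inst_closed[OF constraints(1) closed(1)] in_inst_closed[OF constraints(2) closed(2)]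
    using comp[of "vars s"] comp[of "vars t"] by blast+
  then show ?thesis by blast
qed

end

section \<open>From representatives back to classes\<close>

context lc_signature
begin

text \<open>A common instance gives a unifier \<open>\<tau>\<close> with
  \<open>\<mu> x \<cdot> \<tau> = \<tau> x\<close>, so \<open>\<tau>\<close> itself satisfies the
  instantiated constraints. This is the converse of \<open>common_inst_exists\<close>.\<close>

lemma cunifier_exists:
  assumes "ok n (s, \<phi>)" "ok n (t, \<psi>)" "vars \<phi> \<subseteq> vars s" "vars \<psi> \<subseteq> vars t" "vars s \<inter> vars t = {}"
    and "u \<in> inst n (s, \<phi>)" "u \<in> inst n (t, \<psi>)"
  shows "\<exists>\<mu>. cunifier L \<mu> (s, \<phi>) (t, \<psi>)"
proof -
  have con: "is_constraint L \<phi>" "is_constraint L \<psi>"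
    using assms(1,2) by (simp_all add: ok_constraint)
  obtain \<tau>1 where \<tau>1: "u = s \<cdot> \<tau>1" "is_csubst L \<tau>1" "respects_c L \<tau>1 \<phi>"
    using assms(6) by (auto simp: inst_def)
  obtain \<tau>2 where \<tau>2: "u = t \<cdot> \<tau>2" "is_csubst L \<tau>2" "respects_c L \<tau>2 \<psi>"
    using assms(7) by (auto simp: inst_def)
  define \<tau> where "\<tau> x = (if x \<in> vars s then \<tau>1 x else \<tau>2 x)" for x
  have csub: "csub UNIV \<tau>"
    using \<tau>1(2) \<tau>2(2) by (simp add: is_csubst_iff csub_def \<tau>_def)
  have "s \<cdot> \<tau> = s \<cdot> \<tau>1"
    by (rule subst_cong) (simp add: \<tau>_def)
  moreover have "t \<cdot> \<tau> = t \<cdot> \<tau>2"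
    using assms(5) by (intro subst_cong) (auto simp: \<tau>_def)
  ultimately have uni: "s \<cdot> \<tau> = t \<cdot> \<tau>"
    using \<tau>1(1) \<tau>2(1) by simp
  have val: "\<tau> x \<in> value_terms L" if "x \<in> vars \<phi> \<union> vars \<psi>" for x
    using \<tau>1(3) \<tau>2(3) assms(3-5) that by (auto simp: respects_iff \<tau>_def)
  have "holds \<tau> \<phi> \<longleftrightarrow> holds \<tau>1 \<phi>"
    using assms(3) by (intro holds_cong) (auto simp: \<tau>_def)
  moreover have "holds \<tau> \<psi> \<longleftrightarrow> holds \<tau>2 \<psi>"
    using assms(4,5) by (intro holds_cong) (auto simp: \<tau>_def)
  ultimately have h: "holds \<tau> \<phi>" "holds \<tau> \<psi>"
    using \<tau>1(3) \<tau>2(3) by (simp_all add: respects_iff)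
  obtain \<mu> where \<mu>: "is_mgu L \<mu> s t" "sdom \<mu> \<subseteq> vars s \<union> vars t" "\<And>x. \<mu> x \<cdot> \<tau> = \<tau> x"
      "\<And>x. funs (\<mu> x) \<subseteq> constructors L - vals L"
    using unify_patterns[OF assms(1,2,5) uni] uni by metis
  have sub: "has_sort L (\<mu> x) (var_sort L x)" for x
    using \<mu>(1) by (simp add: is_mgu_def is_subst_def)
  have var: "\<exists>z. \<mu> x = Var z" if "x \<in> vars \<phi> \<union> vars \<psi>" for x
  proof -
    have "var_sort L x \<in> theory_sorts L"
      using that constraint_var_sort con by blast
    then show ?thesis
      using theory_sort_value_free[OF sub _ \<mu>(4)] by metis
  qed
  let ?\<chi> = "and_c L (\<phi> \<cdot> \<mu>) (\<psi> \<cdot> \<mu>)"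
  have con': "is_constraint L (\<phi> \<cdot> \<mu>)" "is_constraint L (\<psi> \<cdot> \<mu>)"
  proof -
    have "is_constraint L (\<chi> \<cdot> \<mu>)" if \<chi>: "is_constraint L \<chi>" "vars \<chi> \<subseteq> vars \<phi> \<union> vars \<psi>" for \<chi>
    proof -
      have "funs (\<mu> x) = {}" if "x \<in> vars \<chi>" for x
      proof -
        have "x \<in> vars \<phi> \<union> vars \<psi>"
          using \<chi>(2) that by blast
        then obtain z where "\<mu> x = Var z"
          using var by blast
        then show ?thesis by simp
      qed
      then show ?thesis
        using \<chi>(1) has_sort_subst[of \<chi> "bool_sort L" \<mu>] sub by (auto simp: is_constraint_iff funs_subst)
    qed
    then show "is_constraint L (\<phi> \<cdot> \<mu>)" "is_constraint L (\<psi> \<cdot> \<mu>)"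
      using con by blast+
  qed
  have "holds \<tau> ?\<chi>"
    using h \<mu>(3) by (simp add: holds_and[OF con' csub_mono[OF csub]] holds_subst)
  moreover have "\<tau> z \<in> value_terms L" if z: "z \<in> vars ?\<chi>" for z
  proof -
    obtain x where x: "x \<in> vars \<phi> \<union> vars \<psi>" "z \<in> vars (\<mu> x)"
      using z by (auto simp: vars_subst)
    then have "\<mu> x = Var z"
      using var by fastforce
    then have "\<tau> z = \<tau> x"
      using \<mu>(3)[of x] by simp
    then show ?thesis
      using val[OF x(1)] by simp
  qed
  ultimately have "respects_c L \<tau> ?\<chi>"
    by (simp add: respects_iff)
  then have "satisfiable L ?\<chi>"
    using csub unfolding satisfiable_def is_csubst_iff[symmetric] is_csubst_def by blast
  moreover have "\<forall>x\<in>vars \<phi> \<union> vars \<psi>. \<mu> x \<in> value_terms L \<union> range Var"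
    using var by blast
  ultimately show ?thesis
    using \<mu>(1,2) unfolding cunifier_def by blast
qed

lemma cdiff_cases:
  assumes "cdiff L c d R" "okc n c" "okc n d"
  obtains (none) "R = {c}" "cinst n c \<inter> cinst n d = {}"
  | (pieces) s \<phi> t \<psi> \<sigma> where "difference L n s \<phi> t \<psi> \<sigma>" "(s, \<phi>) \<in> c" "(t, \<psi>) \<in> d"
      "R = cls L ` diff_pieces L \<sigma> (s, \<phi>) (t, \<psi>)"
proof -
  obtain p q where pq: "p \<in> c" "q \<in> d" "cvars_closed p" "cvars_closed q"
      "(vars (fst p) \<union> vars (snd p)) \<inter> (vars (fst q) \<union> vars (snd q)) = {}"
    and R: "if \<exists>\<sigma>. cunifier L \<sigma> p q
      then \<exists>\<sigma>. cunifier L \<sigma> p q \<and> R = cls L ` diff_pieces L \<sigma> p q else R = {c}"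
    using assms(1) unfolding cdiff_def by blast
  obtain s \<phi> where p: "p = (s, \<phi>)"
    by fastforce
  obtain t \<psi> where q: "q = (t, \<psi>)"
    by fastforce
  have ok: "ok n (s, \<phi>)" "ok n (t, \<psi>)"
    using assms(2,3) pq(1,2) p q by (auto simp: okc_def)
  have vars: "vars \<phi> \<subseteq> vars s" "vars \<psi> \<subseteq> vars t" "vars s \<inter> vars t = {}"
    using pq(3-5) p q by (auto simp: cvars_closed_def)
  show ?thesis
  proof (cases "\<exists>\<sigma>. cunifier L \<sigma> p q")
    case True
    then obtain \<sigma> where "cunifier L \<sigma> p q" "R = cls L ` diff_pieces L \<sigma> p q"
      using R by auto
    moreover from this(1) have "difference L n s \<phi> t \<psi> \<sigma>"
      using ok vars lc_signature_axioms p q by (simp add: difference_def difference_axioms_def)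
    ultimately show ?thesis
      using pieces pq(1,2) p q by blast
  next
    case False
    then have "inst n (s, \<phi>) \<inter> inst n (t, \<psi>) = {}"
      using cunifier_exists[OF ok vars] p q by blast
    moreover have "cinst n c = inst n (s, \<phi>)" "cinst n d = inst n (t, \<psi>)"
      using assms(2,3) pq(1,2) p q cinst_eq by (auto simp: okc_def)
    ultimately show ?thesis
      using none R False by simp
  qed
qed

lemma cdiff_cinst:
  assumes "cdiff L c d R" "okc n c" "okc n d"
  shows "(\<Union>r\<in>R. cinst n r) = cinst n c - cinst n d"
  using assms
proof (cases rule: cdiff_cases)
  case (pieces s \<phi> t \<psi> \<sigma>)
  interpret difference L n s \<phi> t \<psi> \<sigma>
    by (rule pieces(1))
  have "cinst n (cls L r) = inst n r" if "r \<in> pieces" for r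
    using pieces_ok(1)[OF that] by (simp add: cinst_cls ok_def)
  then have "(\<Union>r\<in>R. cinst n r) = inst n (s, \<phi>) - inst n (t, \<psi>)"
    unfolding pieces(4) pieces_inst[symmetric] by simp
  moreover have "cinst n c = inst n (s, \<phi>)" "cinst n d = inst n (t, \<psi>)"
    using assms(2,3) pieces(2,3) cinst_eq by (auto simp: okc_def)
  ultimately show ?thesis by simp
qed auto

lemma cdiff_okc:
  assumes "cdiff L c d R" "okc n c" "okc n d" "r \<in> R"
  shows "okc n r"
  using assms(1-3)
proof (cases rule: cdiff_cases)
  case (pieces s \<phi> t \<psi> \<sigma>)
  interpret difference L n s \<phi> t \<psi> \<sigma>
    by (rule pieces(1))
  show ?thesis
    using assms(4) pieces_ok okc_cls unfolding pieces(4) by blast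
qed (use assms in simp)

text \<open>Stronger than non-overlap, which is the case \<open>u1 = u2\<close>: instances that
  merely share a cut already belong to the same class of the result.\<close>

lemma cdiff_same_cut:
  assumes "cdiff L c d R" "okc n c" "okc n d"
    and "r1 \<in> R" "r2 \<in> R" "u1 \<in> cinst n r1" "u2 \<in> cinst n r2" "cut n u1 = cut n u2"
  shows "r1 = r2"
  using assms(1-3)
proof (cases rule: cdiff_cases)
  case (pieces s \<phi> t \<psi> \<sigma>)
  interpret difference L n s \<phi> t \<psi> \<sigma>
    by (rule pieces(1))
  have eq: "cinst n (cls L r) = inst n r" if "r \<in> pieces" for r
    using pieces_ok(1)[OF that] by (simp add: cinst_cls ok_def)
  obtain p1 p2 where p: "p1 \<in> pieces" "p2 \<in> pieces" "r1 = cls L p1" "r2 = cls L p2"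
    using assms(4,5) unfolding pieces(4) by blast
  then have "u1 \<in> inst n p1" "u2 \<in> inst n p2"
    using assms(6,7) eq by simp_all
  then show ?thesis
    unfolding p(3,4) using assms(8) by (rule pieces_same_cut[OF p(1,2)])
qed (use assms in simp)

text \<open>A difference that changes \<open>c\<close> comes from an actual unifier, whose
  satisfiable constraints provide a common instance. This is the progress made by each step.\<close>

lemma cdiff_overlap:
  assumes "cdiff L c d R" "okc n c" "okc n d" "R \<noteq> {c}"
  shows "cinst n c \<inter> cinst n d \<noteq> {}"
  using assms(1-3)
proof (cases rule: cdiff_cases)
  case (pieces s \<phi> t \<psi> \<sigma>)
  interpret difference L n s \<phi> t \<psi> \<sigma>
    by (rule pieces(1))
  have "cinst n c = inst n (s, \<phi>)" "cinst n d = inst n (t, \<psi>)"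
    using assms(2,3) pieces(2,3) cinst_eq by (auto simp: okc_def)
  then show ?thesis
    using common_inst_exists by simp
qed (use assms in simp)


section \<open>The difference of two sets of patterns\<close>

abbreviation Inst :: "nat \<Rightarrow> ('f, 'v) cclass set \<Rightarrow> ('f, 'v) trm set" where
  "Inst n P \<equiv> (\<Union>c\<in>P. cinst n c)"

text \<open>
  The minuend has to be non-overlapping: a term common to \<open>c \<in> P\<close> and \<open>d \<in> Q\<close> disappears from
  both sides in a step, so it must not survive in another element of \<open>P\<close>.
\<close>

lemma set_diff_correct:
  assumes "set_diff L P Q R" "\<forall>c\<in>P \<union> Q. okc n c"
    and "\<forall>c\<in>P. \<forall>d\<in>P. c \<noteq> d \<longrightarrow> cinst n c \<inter> cinst n d = {}"
  shows "(\<forall>c\<in>R. okc n c) \<and> Inst n R = Inst n P - Inst n Q"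
  using assms
proof (induction rule: set_diff.induct)
  case (step c P d Q P1 Q1 R)
  have ok: "okc n c" "okc n d"
    using step.prems(1) step.hyps(1,2) by auto
  have P1: "Inst n P1 = cinst n c - cinst n d"
    using step.hyps(3) ok by (rule cdiff_cinst)
  have Q1: "Inst n Q1 = cinst n d - cinst n c"
    using step.hyps(5) ok(2,1) by (rule cdiff_cinst)
  have "\<forall>c'\<in>P1. okc n c'"
    using cdiff_okc[OF step.hyps(3) ok] by blast
  moreover have "\<forall>d'\<in>Q1. okc n d'"
    using cdiff_okc[OF step.hyps(5) ok(2,1)] by blast
  ultimately have ok': "\<forall>c\<in>(P - {c} \<union> P1) \<union> (Q - {d} \<union> Q1). okc n c"
    using step.prems(1) by blast
  have old: "cinst n a \<inter> cinst n c = {}" if "a \<in> P - {c}" for a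
    using step.prems(2) step.hyps(1) that by blast
  have disj: "\<forall>a\<in>P - {c} \<union> P1. \<forall>b\<in>P - {c} \<union> P1. a \<noteq> b \<longrightarrow> cinst n a \<inter> cinst n b = {}"
  proof (intro ballI impI)
    fix a b
    assume ab: "a \<in> P - {c} \<union> P1" "b \<in> P - {c} \<union> P1" "a \<noteq> b"
    have new: "cinst n a \<subseteq> cinst n c" if "a \<in> P1" for a
      using P1 that by blast
    consider "a \<in> P1" "b \<in> P1" | "a \<in> P - {c}" "b \<in> P1" | "a \<in> P1" "b \<in> P - {c}" | "a \<in> P" "b \<in> P"
      using ab(1,2) by blast
    then show "cinst n a \<inter> cinst n b = {}"
    proof cases
      case 1
      then show ?thesis
        using cdiff_same_cut[OF step.hyps(3) ok 1] ab(3) by blast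
    qed (use old new step.prems(2) ab(3) in blast)+
  qed
  have "Inst n (P - {c} \<union> P1) - Inst n (Q - {d} \<union> Q1) = Inst n P - Inst n Q"
  proof -
    have "Inst n (P - {c} \<union> P1) = Inst n (P - {c}) \<union> (cinst n c - cinst n d)"
      "Inst n (Q - {d} \<union> Q1) = Inst n (Q - {d}) \<union> (cinst n d - cinst n c)"
      by (simp_all only: UN_Un P1 Q1)
    moreover have "Inst n P = Inst n (P - {c}) \<union> cinst n c" "Inst n Q = Inst n (Q - {d}) \<union> cinst n d"
      using step.hyps(1,2) by auto
    moreover have "Inst n (P - {c}) \<inter> cinst n c = {}"
      using old by blast
    moreover have "A \<union> (C - D) - (B \<union> (D - C)) = A \<union> C - (B \<union> D)" if "A \<inter> C = {}"
      for A B C D :: "('f, 'v) trm set"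
      using that by blast
    ultimately show ?thesis
      by simp
  qed
  then show ?case
    using step.IH[OF ok' disj] by simp
next
  case (stop P Q)
  have "cinst n c \<inter> cinst n d = {}" if "c \<in> P" "d \<in> Q" for c d
  proof -
    have ok: "okc n c" "okc n d"
      using stop.prems(1) that by auto
    then obtain P1 where P1: "cdiff L c d P1"
      using cdiff_exists by blast
    then have "P1 = {c}"
      using stop.hyps that by blast
    then show ?thesis
      using cdiff_cinst[OF P1 ok] by auto
  qed
  then show ?case
    using stop.prems(1) by auto
qed

text \<open>
  The termination measure counts the triples of elements \<open>c \<in> P\<close>, \<open>d \<in> Q\<close> and a cut that common
  instances of \<open>c\<close> and \<open>d\<close> have.  As every cut belongs to at most one element of a difference,
  the triples after a step inject into those before it, and no triple is mapped to the selected
  pair.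
\<close>

definition overlaps ::
    "nat \<Rightarrow> ('f, 'v) cclass set \<Rightarrow> ('f, 'v) cclass set \<Rightarrow>
      (('f, unit) trm \<times> ('f, 'v) cclass \<times> ('f, 'v) cclass) set" where
  "overlaps n P Q = {(cut n u, c, d) |u c d. c \<in> P \<and> d \<in> Q \<and> u \<in> cinst n c \<inter> cinst n d}"

lemma overlaps_decrease:
  assumes "c \<in> P" "d \<in> Q" "cdiff L c d P1" "P1 \<noteq> {c}" "cdiff L d c Q1" "okc n c" "okc n d"
    and "finite (overlaps n P Q)"
  defines "P' \<equiv> P - {c} \<union> P1" and "Q' \<equiv> Q - {d} \<union> Q1"
  shows "finite (overlaps n P' Q')" "card (overlaps n P' Q') < card (overlaps n P Q)"
proof -
  \<comment> \<open>\<open>pc\<close> and \<open>pd\<close> lead a piece back to the class it was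
    cut from; a class that remains from before stays fixed, even if it is also a piece.\<close>
  define pc where "pc a = (if a \<in> P - {c} then a else c)" for a
  define pd where "pd b = (if b \<in> Q - {d} then b else d)" for b
  define g where "g = (\<lambda>(h :: ('f, unit) trm, a, b). (h, pc a, pd b))"
  have P1: "Inst n P1 = cinst n c - cinst n d"
    using assms(3,6,7) by (rule cdiff_cinst)
  have Q1: "Inst n Q1 = cinst n d - cinst n c"
    using assms(5,7,6) by (rule cdiff_cinst)
  obtain u0 where u0: "u0 \<in> cinst n c \<inter> cinst n d"
    using cdiff_overlap[OF assms(3,6,7,4)] by blast
  have pcP: "pc a \<in> P \<and> cinst n a \<subseteq> cinst n (pc a)" if "a \<in> P'" for a
    using that P1 assms(1) by (auto simp: pc_def P'_def)
  have pdQ: "pd b \<in> Q \<and> cinst n b \<subseteq> cinst n (pd b)" if "b \<in> Q'" for b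
    using that Q1 assms(2) by (auto simp: pd_def Q'_def)
  have "g ` overlaps n P' Q' \<subseteq> overlaps n P Q - {(cut n u0, c, d)}"
  proof
    fix x
    assume "x \<in> g ` overlaps n P' Q'"
    then obtain u a b where u: "a \<in> P'" "b \<in> Q'" "u \<in> cinst n a" "u \<in> cinst n b"
        and x: "x = (cut n u, pc a, pd b)"
      by (auto simp: overlaps_def g_def)
    have "x \<in> overlaps n P Q"
      using pcP[OF u(1)] pdQ[OF u(2)] u(3,4) x unfolding overlaps_def by blast
    \<comment> \<open>Only pieces are led back to the pair, and a piece of \<open>c\<close> has no
      instance in common with a piece of \<open>d\<close>: the former avoids \<open>d\<close>, the
      latter consists of instances of \<open>d\<close>.\<close>
    moreover have "\<not> (pc a = c \<and> pd b = d)"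
    proof
      assume "pc a = c \<and> pd b = d"
      then have "a \<in> P1" "b \<in> Q1"
        using u(1,2) by (auto simp: pc_def pd_def P'_def Q'_def split: if_splits)
      then show False
        using P1 Q1 u(3,4) by blast
    qed
    ultimately show "x \<in> overlaps n P Q - {(cut n u0, c, d)}"
      using x by auto
  qed
  moreover have "inj_on g (overlaps n P' Q')"
  proof (rule inj_onI)
    fix x y
    assume x: "x \<in> overlaps n P' Q'" and y: "y \<in> overlaps n P' Q'" and eq: "g x = g y"
    obtain u a b where u: "a \<in> P'" "b \<in> Q'" "u \<in> cinst n a" "u \<in> cinst n b" "x = (cut n u, a, b)"
      using x by (auto simp: overlaps_def)
    obtain u' a' b' where u': "a' \<in> P'" "b' \<in> Q'" "u' \<in> cinst n a'" "u' \<in> cinst n b'"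
        "y = (cut n u', a', b')"
      using y by (auto simp: overlaps_def)
    have cut: "cut n u = cut n u'" and pc: "pc a = pc a'" and pd: "pd b = pd b'"
      using eq u(5) u'(5) by (simp_all add: g_def)
    have "a = a'"
    proof (cases "a \<in> P - {c} \<or> a' \<in> P - {c}")
      case False
      then have "a \<in> P1" "a' \<in> P1"
        using u(1) u'(1) by (auto simp: P'_def)
      then show ?thesis
        using cdiff_same_cut[OF assms(3,6,7)] u(3) u'(3) cut by blast
    qed (use pc in \<open>auto simp: pc_def split: if_splits\<close>)
    moreover have "b = b'"
    proof (cases "b \<in> Q - {d} \<or> b' \<in> Q - {d}")
      case False
      then have "b \<in> Q1" "b' \<in> Q1"
        using u(2) u'(2) by (auto simp: Q'_def)
      then show ?thesis
        using cdiff_same_cut[OF assms(5,7,6)] u(4) u'(4) cut by blast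
    qed (use pd in \<open>auto simp: pd_def split: if_splits\<close>)
    ultimately show "x = y"
      using u(5) u'(5) cut by simp
  qed
  moreover have fin: "finite (overlaps n P Q - {(cut n u0, c, d)})"
    using assms(8) by simp
  ultimately show "finite (overlaps n P' Q')"
    using inj_on_finite by blast
  have "card (overlaps n P' Q') \<le> card (overlaps n P Q - {(cut n u0, c, d)})"
    using \<open>inj_on g _\<close> \<open>g ` _ \<subseteq> _\<close> fin by (rule card_inj_on_le)
  also have "(cut n u0, c, d) \<in> overlaps n P Q"
    using u0 assms(1,2) unfolding overlaps_def by blast
  then have "card (overlaps n P Q - {(cut n u0, c, d)}) < card (overlaps n P Q)"
    using assms(8) by (intro card_Diff1_less)
  finally show "card (overlaps n P' Q') < card (overlaps n P Q)" .
qed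

text \<open>The measure drops whichever applicable step is chosen, so an arbitrary one may be
  taken.\<close>

lemma set_diff_exists:
  assumes "finite (overlaps n P Q)" "\<forall>c\<in>P \<union> Q. okc n c"
  shows "\<exists>R. set_diff L P Q R"
  using assms
proof (induction "card (overlaps n P Q)" arbitrary: P Q rule: less_induct)
  case less
  show ?case
  proof (cases "\<exists>c\<in>P. \<exists>d\<in>Q. \<exists>P1. cdiff L c d P1 \<and> P1 \<noteq> {c}")
    case True
    then obtain c d P1 where P1: "c \<in> P" "d \<in> Q" "cdiff L c d P1" "P1 \<noteq> {c}"
      by blast
    have ok: "okc n c" "okc n d"
      using less.prems(2) P1(1,2) by auto
    then obtain Q1 where Q1: "cdiff L d c Q1"
      using cdiff_exists by blast
    let ?P = "P - {c} \<union> P1" and ?Q = "Q - {d} \<union> Q1"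
    have "okc n a" if "a \<in> P1 \<union> Q1" for a
      using that cdiff_okc[OF P1(3) ok] cdiff_okc[OF Q1 ok(2,1)] by blast
    then have "\<forall>a\<in>?P \<union> ?Q. okc n a"
      using less.prems(2) by blast
    then obtain R where "set_diff L ?P ?Q R"
      using less.hyps[OF overlaps_decrease(2)[OF P1 Q1 ok less.prems(1)]
          overlaps_decrease(1)[OF P1 Q1 ok less.prems(1)]] by blast
    then have "set_diff L P Q R"
      by (rule set_diff.step[OF P1 Q1])
    then show ?thesis ..
  next
    case False
    then have "set_diff L P Q P"
      by (intro set_diff.stop) blast
    then show ?thesis ..
  qed
qed

lemma finite_cut_cinst:
  assumes "okc n c"
  shows "finite (cut n ` cinst n c)"
proof -
  obtain p where p: "p \<in> c" "c \<in> cclasses L" "ok n p"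
    using assms by (auto simp: okc_def)
  obtain t \<psi> where t: "p = (t, \<psi>)"
    by fastforce
  obtain g ts where g: "t = Fun g ts" "has_sort L t (res_sort L g)"
      "\<And>u. u \<in> set ts \<Longrightarrow> funs u \<subseteq> constructors L - vals L"
    using okD[OF p(3)[unfolded t]] by metis
  \<comment> \<open>Constructors other than values are among the finitely many term symbols: a
    theory symbol has a theory sort as result, which such a constructor must not have.\<close>
  have cons: "constructors L - vals L \<subseteq> term_syms L"
    using constructors_sorts theory_syms_sorts syms_all by blast
  have "(\<exists>\<iota>. has_sort L u \<iota>) \<and> funs u - vals L \<subseteq> insert g (term_syms L)" if u: "u \<in> inst n p" for u
  proof -
    obtain \<sigma> where \<sigma>: "u = t \<cdot> \<sigma>" "csub UNIV \<sigma>"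
      using u by (auto simp: t inst_def is_csubst_iff)
    have "has_sort L u (res_sort L g)"
      unfolding \<sigma>(1) using g(2) csubD(1)[OF \<sigma>(2)] by (intro has_sort_subst) simp_all
    moreover have "funs t \<subseteq> insert g (constructors L)"
      using g(1,3) by auto
    then have "funs u \<subseteq> insert g (constructors L)"
      unfolding \<sigma>(1) funs_subst using csubD(2)[OF \<sigma>(2)] by blast
    ultimately show ?thesis
      using cons by blast
  qed
  then have "cut n ` inst n p
      \<subseteq> {cut n u |u. (\<exists>\<iota>. has_sort L u \<iota>) \<and> funs u - vals L \<subseteq> insert g (term_syms L)}"
    by blast
  then have "finite (cut n ` inst n p)"
    using finite_cuts[of "insert g (term_syms L)" n] term_syms_finite finite_subset by blast
  then show ?thesis
    using cinst_eq[OF p(2,1)] by simp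
qed

lemma finite_overlaps:
  assumes "finite P" "finite Q" "\<forall>c\<in>P. okc n c"
  shows "finite (overlaps n P Q)"
proof (rule finite_subset)
  show "overlaps n P Q \<subseteq> (\<Union>c\<in>P. cut n ` cinst n c) \<times> P \<times> Q"
    by (auto simp: overlaps_def)
  show "finite ((\<Union>c\<in>P. cut n ` cinst n c) \<times> P \<times> Q)"
    using assms finite_cut_cinst by auto
qed

section \<open>Depth bounds, and the pattern of all instances with root \<open>f\<close>\<close>

lemma depth_le_mono: "depth_le m t \<Longrightarrow> m \<le> n \<Longrightarrow> depth_le n t"
proof (induction m t arbitrary: n rule: depth_le.induct)
  case (3 m g ts)
  then show ?case
    by (cases n) auto
qed auto

lemma depth_le_exists: "\<exists>n. depth_le n t"
proof (induction t)
  case (Fun g ts)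
  then obtain d where d: "\<And>t. t \<in> set ts \<Longrightarrow> depth_le (d t) t"
    by metis
  have "depth_le (sum d (set ts)) t" if "t \<in> set ts" for t
    using d[OF that] by (rule depth_le_mono) (simp add: member_le_sum that)
  then have "depth_le (Suc (sum d (set ts))) (Fun g ts)"
    by simp
  then show ?case ..
qed simp

lemma okc_mono:
  assumes "okc m c" "m \<le> n"
  shows "okc n c"
  using assms depth_le_mono unfolding okc_def ok_def by blast

lemma okc_exists:
  assumes "c \<in> cclasses L" "\<forall>(t, \<psi>)\<in>c. is_pattern L t \<and> linear t \<and> value_free L t" "p \<in> c" "cvars_closed p"
  shows "\<exists>n. okc n c"
proof -
  obtain n where "depth_le n (fst p)"
    using depth_le_exists by blast
  moreover have "p \<in> cterms L"
    using cclass_doteq[OF assms(1,3,3)] equiv_doteq by (meson equiv_type mem_Sigma_iff subsetD)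
  ultimately have "ok n p"
    using assms(2,3) by (auto simp: ok_def)
  then show ?thesis
    using okc_cls[OF _ assms(4)] cclass_eq_cls[OF assms(1,3)] by auto
qed

lemma ok_full:
  assumes "f \<in> defined_syms L" "arg_vars L f xs" "0 < n"
  shows "ok n (Fun f (map Var xs), true_c L)"
proof (rule okI)
  have "list_all2 (has_sort L) (map Var xs) (map (var_sort L) xs)"
    by (simp add: list_all2_conv_all_nth)
  then show "has_sort L (Fun f (map Var xs)) (res_sort L f)"
    using assms(2) by (simp add: arg_vars_def)
  show "depth_le n (Fun f (map Var xs))"
    using assms(3) by (cases n) auto
qed (use assms in \<open>auto simp: arg_vars_def is_constraint_connectives\<close>)

lemma okc_full:
  assumes "f \<in> defined_syms L" "arg_vars L f xs" "0 < n"
  shows "okc n (full L f xs)"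
  unfolding full_def using ok_full[OF assms] by (rule okc_cls) (simp add: cvars_closed_def)

text \<open>\<open>is_complement\<close> quantifies over all choices of argument variables; this
  reduces them to the choice with which the run started.\<close>

lemma full_unique:
  assumes "f \<in> defined_syms L" "arg_vars L f xs" "arg_vars L f ys"
  shows "full L f xs = full L f ys"
proof -
  obtain \<pi> where \<pi>: "renaming \<pi>" "map \<pi> xs = ys"
    using renaming_lists[of xs ys] assms(2,3) unfolding arg_vars_def by metis
  have "(Fun f (map Var zs), true_c L) \<in> cterms L" if "arg_vars L f zs" for zs
    using ok_full[OF assms(1) that, of 1] by (simp add: ok_def)
  moreover have "map_trm id \<pi> (Fun f (map Var xs)) = Fun f (map Var ys)"
    using \<pi>(2) by auto
  moreover have "ex_closure L (vars (Fun f (map Var ys))) (true_c L) \<alpha>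
      = ex_closure L (vars (Fun f (map Var xs))) (true_c L) (\<alpha> \<circ> \<pi>)" for \<alpha>
    using ex_closure_rename[OF \<pi>(1), of "set xs" "true_c L" \<alpha>] \<pi>(2) by auto
  ultimately have "((Fun f (map Var xs), true_c L), (Fun f (map Var ys), true_c L)) \<in> doteq L"
    unfolding doteq_iff using \<pi>(1) assms(2,3) by blast
  then show ?thesis
    unfolding full_def cls_def by (rule equiv_class_eq[OF equiv_doteq])
qed

lemma cinst_root:
  assumes "okc n c" "u \<in> cinst n c"
  shows "\<exists>(t, \<psi>)\<in>c. root t = root u"
proof -
  obtain t \<psi> where t: "(t, \<psi>) \<in> c" "u \<in> inst n (t, \<psi>)"
    using assms(2) by (auto simp: cinst_def)
  then have "ok n (t, \<psi>)"
    using assms(1) by (simp add: okc_def)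
  then obtain g ts where "t = Fun g ts"
    using okD by metis
  then have "root t = root u"
    using t(2) by (auto simp: inst_def)
  then show ?thesis
    using t(1) by blast
qed

lemma full_root:
  assumes "f \<in> defined_syms L" "arg_vars L f xs" "u \<in> cinst n (full L f xs)"
  shows "root u = Some f"
proof -
  have "okc 1 (full L f xs)"
    using assms(1,2) by (rule okc_full) simp
  then have "full L f xs \<in> cclasses L"
    by (simp add: okc_def)
  moreover obtain p where "p \<in> full L f xs" "u \<in> inst n p"
    using assms(3) by (auto simp: cinst_def)
  ultimately show ?thesis
    by (auto simp: full_def cls_def doteq_iff inst_def)
qed

end

theorem theorem3:
  fixes L :: "('s, 'f, 'v, 'u) signature"
    and Q :: "('f, 'v) cclass set"
    and f :: 'f
    and xs :: "'v list"
  assumes "lc_signature L"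
    and "Q \<subseteq> cclasses L"
    and "finite Q"
    and "\<forall>c\<in>Q. \<forall>(t, \<psi>)\<in>c. is_pattern L t \<and> linear t \<and> value_free L t"
    and "\<forall>c\<in>Q. \<exists>p\<in>c. cvars_closed p"
    and "pairwise_nonoverlapping L Q"
    and "f \<in> defined_syms L"
    and "arg_vars L f xs"
  shows "(\<exists>R. Co L f xs Q R) \<and>
    (\<forall>R. Co L f xs Q R \<longrightarrow>
       GC L R = GC L {full L f xs} - GC L {c \<in> Q. \<exists>(t, \<psi>)\<in>c. root t = Some f} \<and>
       is_complement L f Q R)"
proof -
  interpret lc_signature L
    by (rule assms(1))
  have "\<exists>m. okc m c" if c: "c \<in> Q" for c
  proof -
    obtain p where p: "p \<in> c" "cvars_closed p"
      using bspec[OF assms(5) c] by (rule bexE)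
    show ?thesis
      using subsetD[OF assms(2) c] bspec[OF assms(4) c] p by (rule okc_exists)
  qed
  then obtain m where m: "\<And>c. c \<in> Q \<Longrightarrow> okc (m c) c"
    by metis
  \<comment> \<open>A common depth bound: the sum dominates each \<open>m c\<close>, and the
    successor makes room for the root symbol of the full pattern even if \<open>Q\<close> is
    empty.\<close>
  define n where "n = Suc (sum m Q)"
  have okQ: "okc n c" if "c \<in> Q" for c
  proof (rule okc_mono[OF m[OF that]])
    show "m c \<le> n"
      using member_le_sum[of c Q m] that assms(3) by (simp add: n_def)
  qed
  have okf: "okc n (full L f xs)"
    using assms(7,8) by (rule okc_full) (simp add: n_def)
  have ok: "\<forall>c\<in>{full L f xs} \<union> Q. okc n c"
    using okQ okf by blast
  have "\<exists>R. Co L f xs Q R"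
    unfolding Co_def using assms(3) ok by (intro set_diff_exists[of n] finite_overlaps) auto
  moreover have "GC L R = GC L {full L f xs} - GC L {c \<in> Q. \<exists>(t, \<psi>)\<in>c. root t = Some f} \<and>
      is_complement L f Q R" if "Co L f xs Q R" for R
  proof
    let ?Qf = "{c \<in> Q. \<exists>(t, \<psi>)\<in>c. root t = Some f}"
    have R: "\<forall>c\<in>R. okc n c" "Inst n R = Inst n {full L f xs} - Inst n Q"
      using set_diff_correct[OF that[unfolded Co_def] ok] by auto
    have GC: "GC L R = GC L {full L f xs} - GC L Q"
      unfolding GC_cinst[of _ n] R(2) by blast
    \<comment> \<open>Classes with another root share no instance with the full pattern, so
      subtracting \<open>Q\<close> and subtracting its part with root \<open>f\<close> come to the
      same.\<close>
    have "Inst n {full L f xs} \<inter> Inst n Q \<subseteq> Inst n ?Qf"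
    proof
      fix u
      assume u: "u \<in> Inst n {full L f xs} \<inter> Inst n Q"
      then obtain c where c: "c \<in> Q" "u \<in> cinst n c"
        by blast
      have "root u = Some f"
        using full_root[OF assms(7,8)] u by auto
      then have "c \<in> ?Qf"
        using cinst_root[OF okQ[OF c(1)] c(2)] c(1) by simp
      then show "u \<in> Inst n ?Qf"
        using c(2) by blast
    qed
    moreover have "Inst n ?Qf \<subseteq> Inst n Q"
      by (rule UN_mono) auto
    moreover have "{u \<in> A - B. ground u} = {u \<in> A. ground u} - {u \<in> C. ground u}"
      if "A \<inter> B \<subseteq> C" "C \<subseteq> B" for A B C :: "('f, 'v) trm set"
      using that by blast
    ultimately show "GC L R = GC L {full L f xs} - GC L ?Qf"
      unfolding GC_cinst[of _ n] R(2) by presburger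
    show "is_complement L f Q R"
      unfolding is_complement_def
    proof (intro conjI allI impI)
      show "R \<subseteq> cclasses L"
        using R(1) by (auto simp: okc_def)
      show "\<forall>c\<in>R. \<forall>(t, \<psi>)\<in>c. is_pattern L t"
        using R(1) by (fastforce simp: okc_def ok_def)
      show "GC L R = GC L {full L f ys} - GC L Q" if "arg_vars L f ys" for ys
        using GC full_unique[OF assms(7) that assms(8)] by simp
    qed
  qed
  ultimately show ?thesis by blast
qed

end
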